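(* Let $\mathcal{F}=\{f_0,\ldots,f_{N-1}\}$ be a finite family of $C^1$-diffeomorphisms of the circle $(\mathbb{S}^1,d)$ such that $\mathcal{F}$ is proximal on $(\mathbb{S}^1,d)$ and there is no Borel probability measure $m$ on $\mathbb{S}^1$ satisfying $f_*m=m$ for every $f\in\mathcal{F}$. Let $\mu$ be any non-degenerate probability measure on $\mathcal{I}=\{0,\ldots,N-1\}$ (that is, $\mu(\{i\})>0$ for every $i\in\mathcal{I}$). Then there is a unique $\mu$-stationary probability measure $\nu$ on $\mathbb{S}^1$. Moreover, for every Hölder continuous function $h\colon\mathbb{S}^1\to\mathbb{R}$, writing $\nu(h)=\int h\,d\nu$, the limit $$\sigma^2(h)=\lim_{n\to\infty}\frac1n\int_{\mathcal{I}^{\mathbb{N}}\times \mathbb{S}^1}\Big(\sum_{k=0}^{n-1}h(X_k^x(\mathbf{i}))-n\nu(h)\Big)^2\,d(\mu^{\mathbb{N}}\otimes\nu)(\mathbf{i},x)$$ exists and is finite, and: 1. (strong law of large numbers) for every $x\in \mathbb{S}^1$, $\lim_{n\to\infty}\frac1n\sum_{k=0}^{n-1}h(X_k^x)=\nu(h)$ $\mu^{\mathbb{N}}$-almost surely; 2. (central limit theorem) for every $x\in \mathbb{S}^1$, $\frac{1}{\sqrt n}\Big(\sum_{k=0}^{n-1}h(X_k^x)-n\nu(h)\Big)$ converges in distribution (under $\mu^{\mathbb{N}}$) to the normal law $\mathcal{N}(0,\sigma^2(h))$ as $n\to\infty$ (the Dirac measure at $0$ if $\sigma^2(h)=0$)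.
   Context: $\mathbb{S}^1=[0,1)$ (i.e. $\mathbb{R}/\mathbb{Z}$) with $d(x,y)=\min\{|x-y|,1-|x-y|\}$. $\mu^{\mathbb{N}}$ is the product (Bernoulli) measure on $\mathcal{I}^{\mathbb{N}}$. For $\mathbf{i}=(i_1,i_2,\ldots)\in\mathcal{I}^{\mathbb{N}}$ and $n\in\mathbb{N}$ put $f_{\mathbf{i}}^n=f_{i_n}\circ\cdots\circ f_{i_1}$, $X_n^x(\mathbf{i})=f_{\mathbf{i}}^n(x)$, $X_0^x(\mathbf{i})=x$; for each $x$, $X_n^x$ is regarded as a random variable on $(\mathcal{I}^{\mathbb{N}},\mu^{\mathbb{N}})$. Proximal: for every $x,y\in \mathbb{S}^1$ there exist $\mathbf{i}\in\mathcal{I}^{\mathbb{N}}$ and a (strictly increasing) sequence $(n_k)_{k}$ with $\lim_{k\to\infty}d(f_{\mathbf{i}}^{n_k}(x),f_{\mathbf{i}}^{n_k}(y))=0$. A Borel probability measure $\nu$ on $\mathbb{S}^1$ is $\mu$-stationary if $\nu=\sum_{i\in\mathcal{I}}\mu(\{i\})\,(f_i)_*\nu$, where $(f_i)_*\nu=\nu\circ f_i^{-1}$. *)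

theory Defs
  imports "HOL-Probability.Probability"
begin

text \<open>The circle is the set of representatives \<open>[0,1)\<close> of the real numbers modulo 1.  Its topology
  (hence the \<open>\<sigma>\<close>-algebra \<open>borel\<close> on it) is the one induced by the metric below, not the order
  topology of the interval.\<close>

typedef circle = "{0..<1::real}"
  morphisms rep_circle abs_circle
  by (intro exI[of _ 0]) simp

lemma rep_circle_bounds: "0 \<le> rep_circle x" "rep_circle x < 1"
  using rep_circle[of x] by auto

instantiation circle :: metric_space
begin

definition dist_circle :: "circle \<Rightarrow> circle \<Rightarrow> real" where
  "dist_circle x y = min \<bar>rep_circle x - rep_circle y\<bar> (1 - \<bar>rep_circle x - rep_circle y\<bar>)"

definition uniformity_circle :: "(circle \<times> circle) filter" where
  "uniformity_circle = (INF e\<in>{0 <..}. principal {(x, y). dist x y < e})"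

definition open_circle :: "circle set \<Rightarrow> bool" where
  "open_circle U \<longleftrightarrow> (\<forall>x\<in>U. eventually (\<lambda>(x', y). x' = x \<longrightarrow> y \<in> U) uniformity)"

instance
proof
  fix x y z :: circle
  show "dist x y = 0 \<longleftrightarrow> x = y"
    using rep_circle_bounds[of x] rep_circle_bounds[of y]
    by (auto simp: dist_circle_def min_def rep_circle_inject[symmetric])
  show "dist x y \<le> dist x z + dist y z"
    using rep_circle_bounds[of x] rep_circle_bounds[of y] rep_circle_bounds[of z]
    unfolding dist_circle_def by linarith
qed (simp_all only: uniformity_circle_def open_circle_def)

end

definition circle_proj :: "real \<Rightarrow> circle" where
  "circle_proj t = abs_circle (frac t)"

text \<open>A map of the circle is \<open>C\<^sup>1\<close> iff it has a \<open>C\<^sup>1\<close> lift through the covering \<open>circle_proj\<close>; lifts of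
  any degree are allowed.\<close>

definition C1_circle_map :: "(circle \<Rightarrow> circle) \<Rightarrow> bool" where
  "C1_circle_map g \<longleftrightarrow> (\<exists>G G'. (\<forall>t. (G has_real_derivative G' t) (at t)) \<and>
     continuous_on UNIV G' \<and> (\<forall>t. g (circle_proj t) = circle_proj (G t)))"

definition C1_circle_diffeo :: "(circle \<Rightarrow> circle) \<Rightarrow> bool" where
  "C1_circle_diffeo g \<longleftrightarrow> bij g \<and> C1_circle_map g \<and> C1_circle_map (inv g)"

text \<open>Sequences are indexed from 0 here, so the letter \<open>i\<^sub>n\<close> (\<open>n \<ge> 1\<close>) of the usual notation is
  \<open>\<omega> (n - 1)\<close>, and \<open>rand_iter f \<omega> n = f (\<omega> (n - 1)) \<circ> \<dots> \<circ> f (\<omega> 0)\<close>.\<close>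

primrec rand_iter :: "(nat \<Rightarrow> 'a \<Rightarrow> 'a) \<Rightarrow> (nat \<Rightarrow> nat) \<Rightarrow> nat \<Rightarrow> 'a \<Rightarrow> 'a" where
  "rand_iter f \<omega> 0 = id"
| "rand_iter f \<omega> (Suc n) = f (\<omega> n) \<circ> rand_iter f \<omega> n"

definition proximal :: "nat \<Rightarrow> (nat \<Rightarrow> circle \<Rightarrow> circle) \<Rightarrow> bool" where
  "proximal N f \<longleftrightarrow> (\<forall>x y. \<exists>\<omega> r. (\<forall>n. \<omega> n < N) \<and> strict_mono (r :: nat \<Rightarrow> nat) \<and>
     (\<lambda>k. dist (rand_iter f \<omega> (r k) x) (rand_iter f \<omega> (r k) y)) \<longlonglongrightarrow> 0)"

definition borel_prob :: "'a::topological_space measure \<Rightarrow> bool" where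
  "borel_prob m \<longleftrightarrow> prob_space m \<and> sets m = sets borel"

definition stationary ::
    "nat \<Rightarrow> (nat \<Rightarrow> circle \<Rightarrow> circle) \<Rightarrow> nat measure \<Rightarrow> circle measure \<Rightarrow> bool" where
  "stationary N f \<mu> \<nu> \<longleftrightarrow> borel_prob \<nu> \<and>
     (\<forall>A\<in>sets borel. measure \<nu> A = (\<Sum>i<N. measure \<mu> {i} * measure (distr \<nu> borel (f i)) A))"

definition holder_continuous :: "('a::metric_space \<Rightarrow> real) \<Rightarrow> bool" where
  "holder_continuous h \<longleftrightarrow> (\<exists>\<alpha> C. 0 < \<alpha> \<and> \<alpha> \<le> 1 \<and> (\<forall>x y. \<bar>h x - h y\<bar> \<le> C * dist x y powr \<alpha>))"

abbreviation bernoulli_measure :: "nat measure \<Rightarrow> (nat \<Rightarrow> nat) measure" where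
  "bernoulli_measure \<mu> \<equiv> PiM UNIV (\<lambda>_. \<mu>)"

definition birkhoff_sum ::
    "(nat \<Rightarrow> 'a \<Rightarrow> 'a) \<Rightarrow> ('a \<Rightarrow> real) \<Rightarrow> nat \<Rightarrow> (nat \<Rightarrow> nat) \<Rightarrow> 'a \<Rightarrow> real" where
  "birkhoff_sum f h n \<omega> x = (\<Sum>k<n. h (rand_iter f \<omega> k x))"

definition normal_law :: "real \<Rightarrow> real measure" where
  "normal_law v = (if v = 0 then return borel 0 else density lborel (normal_density 0 (sqrt v)))"

end

theory Submission
  imports Defs "HOL-Library.Discrete_Functions"
begin

text \<open>The mean logarithmic growth rate of derivatives is negative.  Otherwise let \<open>\<Lambda> \<ge> 0\<close> be its
  maximum over all starting points and start from a density concentrated at scale \<open>exp (- n (\<Lambda> + \<epsilon>))\<close> at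
  a point where the mean of \<open>log (f\<^sup>n)'\<close> is almost \<open>n \<Lambda>\<close>.  Its mass stays close to the orbit
  of that point up to time \<open>n\<close>, while its entropy is at most \<open>n (\<Lambda> + \<epsilon>)\<close>.  A step of the transfer
  operator lowers the entropy by the mean logarithm of the derivative plus a relative entropy measuring how far
  the density is from being invariant under each map.  Hence most steps are almost invariant, and a weak
  limit of averaged densities is a common invariant measure, which is excluded.

  With a negative exponent a function comparable to \<open>d(x, y)\<^sup>\<beta>\<close> is contracted in mean near the
  diagonal, and proximality with compactness makes this contraction global.  So the Markov operator contracts
  \<open>\<beta>\<close>-Hoelder seminorms exponentially, which gives the stationary measure and solves Poisson's equation;
  Birkhoff sums are then martingales with bounded increments up to a bounded error.  The law of large numbers
  follows from second moments along squares, and the central limit theorem from comparing characteristic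
  functions with the exponential of the sum of conditional variances, which itself obeys the law of large
  numbers.\<close>

section \<open>Lifts of circle diffeomorphisms\<close>

text \<open>The hypotheses speak about single points: one contracting word for each pair, one
  maximum over starting points. Two devices make them uniform: subtracting a coboundary turns an
  m-step bound on mean log-derivatives into a one-step bound, and compactness of the space of pairs
  bounds the time until contraction sets in.

  In the entropy argument the scales are tied together. Near the diagonal the mean of d^\<beta>
  grows at most like exp (n \<beta> \<theta>), with \<theta> slightly above \<Lambda>. The initial
  scale r = exp (- n (\<theta> + \<eta>)) is small enough that the density still sees the exponent
  of the chosen point at time n, and large enough that its entropy, at most about - ln r, exceeds n
  \<Lambda> by O(n \<eta>) only. This excess bounds the relative entropy spent in n steps. Relative
  entropy itself is awkward in a weak limit, so it is tested against t * \<phi> on one map by the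
  Gibbs inequality: the bound becomes linear in the density up to an error t^2. Dividing by t and
  letting t tend to 0 after the weak limit leaves exact invariance.

  The exponent \<beta> of the contraction must be small and at most the Hoelder exponent of the
  observable, so it is chosen after the observable.\<close>

lemma rep_circle_proj: "rep_circle (circle_proj t) = frac t"
  by (simp add: circle_proj_def abs_circle_inverse frac_lt_1)

lemma circle_proj_rep [simp]: "circle_proj (rep_circle x) = x"
  using rep_circle_bounds[of x] by (simp add: circle_proj_def rep_circle_inverse)

lemma circle_proj_add_int [simp]: "circle_proj (t + of_int n) = circle_proj t"
  by (simp add: circle_proj_def)

lemma circle_proj_add_1 [simp]: "circle_proj (t + 1) = circle_proj t"
  using circle_proj_add_int[of t 1] by simp

lemma circle_proj_diff_1 [simp]: "circle_proj (t - 1) = circle_proj t"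
  using circle_proj_add_int[of t "-1"] by simp

lemma circle_proj_eq_iff: "circle_proj s = circle_proj t \<longleftrightarrow> s - t \<in> \<int>"
proof
  assume "circle_proj s = circle_proj t"
  then have "frac s = frac t"
    by (metis rep_circle_proj)
  then show "s - t \<in> \<int>"
    by (metis Ints_diff Ints_of_int add_diff_cancel_left diff_add_cancel frac_def
        frac_diff_eq frac_eq_0_iff)
next
  assume "s - t \<in> \<int>"
  then obtain n :: int where "s - t = of_int n"
    by (elim Ints_cases)
  then have "s = t + of_int n" by simp
  then show "circle_proj s = circle_proj t" by simp
qed

lemma dist_circle_proj_le: "dist (circle_proj s) (circle_proj t) \<le> \<bar>s - t\<bar>"
proof -
  define k where "k = \<lfloor>s\<rfloor> - \<lfloor>t\<rfloor>"
  have st: "s - t = (frac s - frac t) + of_int k"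
    by (simp add: frac_def k_def)
  have b: "0 \<le> frac s" "frac s < 1" "0 \<le> frac t" "frac t < 1"
    by (auto simp: frac_lt_1)
  consider "k = 0" | "k \<ge> 1" | "k \<le> -1" by linarith
  then show ?thesis
  proof cases
    case 1 then show ?thesis using st by (simp add: dist_circle_def rep_circle_proj)
  next
    case 2
    then have "real_of_int k \<ge> 1" by simp
    then show ?thesis using st b unfolding dist_circle_def rep_circle_proj by linarith
  next
    case 3
    then have "real_of_int k \<le> -1" by simp
    then show ?thesis using st b unfolding dist_circle_def rep_circle_proj by linarith
  qed
qed

lemma dist_circle_le_1: "dist (x::circle) y \<le> 1"
  using rep_circle_bounds[of x] rep_circle_bounds[of y] unfolding dist_circle_def by linarith

text \<open>The integer \<open>k\<close> selects the lift of \<open>y\<close> on the shorter arc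
  from \<open>s\<close>. Distances become absolute differences, so local metric questions move to
  the line.\<close>

lemma circle_lift:
  obtains t where "circle_proj t = y" "\<bar>s - t\<bar> = dist (circle_proj s) y"
proof -
  define a b where "a = frac s" and "b = rep_circle y"
  have b: "0 \<le> a" "a < 1" "0 \<le> b" "b < 1"
    using rep_circle_bounds[of y] by (auto simp: a_def b_def frac_lt_1)
  have s: "s = a + of_int \<lfloor>s\<rfloor>" by (simp add: a_def frac_def)
  have d: "dist (circle_proj s) y = min \<bar>a - b\<bar> (1 - \<bar>a - b\<bar>)"
    by (simp add: dist_circle_def rep_circle_proj a_def b_def)
  define k :: int where "k = (if \<bar>a - b\<bar> \<le> 1 - \<bar>a - b\<bar> then 0 else if a \<ge> b then 1 else -1)"
  have "\<bar>a - (b + of_int k)\<bar> = min \<bar>a - b\<bar> (1 - \<bar>a - b\<bar>)"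
    using b by (auto simp: k_def)
  then have "\<bar>s - (b + of_int (\<lfloor>s\<rfloor> + k))\<bar> = dist (circle_proj s) y"
    using s d by (smt (verit) of_int_add)
  moreover have "circle_proj (b + of_int (\<lfloor>s\<rfloor> + k)) = y"
    unfolding circle_proj_add_int by (simp add: b_def)
  ultimately show ?thesis using that by blast
qed

lemma continuous_on_circle_proj: "continuous_on S circle_proj"
proof (rule continuous_on_iff[THEN iffD2], intro ballI allI impI)
  fix x :: real and e :: real assume "0 < e"
  show "\<exists>d>0. \<forall>x'\<in>S. dist x' x < d \<longrightarrow> dist (circle_proj x') (circle_proj x) < e"
    using dist_circle_proj_le \<open>0 < e\<close> by (intro exI[of _ e]) (auto simp: dist_real_def intro: le_less_trans)
qed

lemma compact_circle: "compact (UNIV :: circle set)"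
proof -
  have "x \<in> circle_proj ` {0..1}" for x
    using rep_circle_bounds[of x] by (intro image_eqI[of _ _ "rep_circle x"]) auto
  then have "UNIV = circle_proj ` {0..1}" by auto
  then show ?thesis
    using compact_continuous_image[OF continuous_on_circle_proj compact_Icc, of 0 1] by simp
qed

text \<open>By nearest lifts, every point close to \<open>x\<close> is the projection of a real
  close to a lift of \<open>x\<close>, so continuity can be tested upstairs. Circle maps and
  Jacobians are treated this way.\<close>

lemma continuous_on_circle:
  fixes \<phi> :: "circle \<Rightarrow> 'a::metric_space"
  assumes "continuous_on UNIV (\<lambda>t. \<phi> (circle_proj t))"
  shows "continuous_on UNIV \<phi>"
proof (rule continuous_on_iff[THEN iffD2], intro ballI allI impI)
  fix x :: circle and e :: real assume "0 < e"
  define s where "s = rep_circle x"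
  obtain d where "d > 0" and d: "\<And>t. dist t s < d \<Longrightarrow> dist (\<phi> (circle_proj t)) (\<phi> (circle_proj s)) < e"
    using assms \<open>0 < e\<close> unfolding continuous_on_iff by (meson UNIV_I)
  have "dist (\<phi> y) (\<phi> x) < e" if "dist y x < d" for y
  proof -
    obtain t where "circle_proj t = y" "\<bar>s - t\<bar> = dist (circle_proj s) y"
      by (rule circle_lift)
    then show ?thesis using that d[of t] by (simp add: s_def dist_commute dist_real_def abs_minus_commute)
  qed
  then show "\<exists>d>0. \<forall>x'\<in>UNIV. dist x' x < d \<longrightarrow> dist (\<phi> x') (\<phi> x) < e"
    using \<open>d > 0\<close> by blast
qed

lemma continuous_on_comp_proj:
  assumes "continuous_on UNIV (\<phi> :: circle \<Rightarrow> 'a::topological_space)"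
  shows "continuous_on S (\<lambda>t. \<phi> (circle_proj t))"
  using continuous_on_compose2[OF assms continuous_on_circle_proj] by simp

lemma circle_bounded:
  assumes "continuous_on UNIV (\<phi> :: circle \<Rightarrow> real)"
  obtains B where "B > 0" "\<And>x. \<bar>\<phi> x\<bar> \<le> B"
proof -
  have "bounded (range \<phi>)"
    by (intro compact_imp_bounded compact_continuous_image assms compact_circle)
  then show ?thesis using that unfolding bounded_pos by auto
qed

lemma circle_uniformly_continuous:
  assumes "continuous_on UNIV (\<phi> :: circle \<Rightarrow> real)" "e > 0"
  obtains d where "d > 0" "\<And>x y. dist x y < d \<Longrightarrow> \<bar>\<phi> x - \<phi> y\<bar> < e"
  using compact_uniformly_continuous[OF assms(1) compact_circle] assms(2)
  unfolding uniformly_continuous_on_def dist_real_def by (metis UNIV_I)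

section \<open>Integration of continuous functions on the circle\<close>

definition circle_int :: "(circle \<Rightarrow> real) \<Rightarrow> real" where
  "circle_int \<phi> = integral {0..1} (\<lambda>t. \<phi> (circle_proj t))"

lemma circle_integrable:
  assumes "continuous_on UNIV (\<phi> :: circle \<Rightarrow> real)"
  shows "(\<lambda>t. \<phi> (circle_proj t)) integrable_on {a..b}"
  by (intro integrable_continuous_real continuous_on_comp_proj assms)

lemma circle_int_add:
  assumes "continuous_on UNIV \<phi>" "continuous_on UNIV \<psi>"
  shows "circle_int (\<lambda>x. \<phi> x + \<psi> x) = circle_int \<phi> + circle_int \<psi>"
  unfolding circle_int_def by (intro integral_add circle_integrable assms)

lemma circle_int_diff:
  assumes "continuous_on UNIV \<phi>" "continuous_on UNIV \<psi>"
  shows "circle_int (\<lambda>x. \<phi> x - \<psi> x) = circle_int \<phi> - circle_int \<psi>"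
  unfolding circle_int_def by (intro integral_diff circle_integrable assms)

lemma circle_int_cmult: "circle_int (\<lambda>x. c * \<phi> x) = c * circle_int \<phi>"
  unfolding circle_int_def by simp

lemma circle_int_sum:
  assumes "\<And>i. i \<in> A \<Longrightarrow> continuous_on UNIV (\<phi> i)" "finite A"
  shows "circle_int (\<lambda>x. \<Sum>i\<in>A. \<phi> i x) = (\<Sum>i\<in>A. circle_int (\<phi> i))"
  unfolding circle_int_def by (intro integral_sum circle_integrable assms)

lemma circle_int_mono:
  assumes "continuous_on UNIV \<phi>" "continuous_on UNIV \<psi>" "\<And>x. \<phi> x \<le> \<psi> x"
  shows "circle_int \<phi> \<le> circle_int \<psi>"
  unfolding circle_int_def by (intro integral_le circle_integrable assms)

lemma circle_int_const [simp]: "circle_int (\<lambda>x. c) = c"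
  unfolding circle_int_def by simp

lemma FTC_real:
  fixes K k :: "real \<Rightarrow> real"
  assumes "\<And>t. (K has_real_derivative k t) (at t)" "a \<le> b"
  shows "(k has_integral (K b - K a)) {a..b}"
proof (rule fundamental_theorem_of_calculus)
  fix x assume "x \<in> {a..b}"
  show "(K has_vector_derivative k x) (at x within {a..b})"
    by (rule has_vector_derivative_at_within)
      (use assms(1)[of x] in \<open>simp only: has_real_derivative_iff_has_vector_derivative\<close>)
qed (fact assms(2))

text \<open>The increment over a period has derivative zero because the integrand has period 1. Such
  a \<open>K\<close> reduces shift invariance and change of variables to the chain rule and
  evaluation at two points.\<close>

lemma circle_antiderivative:
  assumes "continuous_on UNIV (\<phi> :: circle \<Rightarrow> real)"
  obtains K where "\<And>t. (K has_real_derivative \<phi> (circle_proj t)) (at t)"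
    "\<And>t. K (t + 1) - K t = circle_int \<phi>"
proof -
  have "\<exists>K. \<forall>t. - \<infinity> < ereal t \<longrightarrow> ereal t < \<infinity> \<longrightarrow>
      (K has_vector_derivative \<phi> (circle_proj t)) (at t)"
    using continuous_on_comp_proj[OF assms, of UNIV]
    by (intro einterval_antiderivative) (auto simp: continuous_on_eq_continuous_at)
  then obtain K where K: "\<And>t. (K has_real_derivative \<phi> (circle_proj t)) (at t)"
    by (auto simp: has_real_derivative_iff_has_vector_derivative)
  have "((\<lambda>t. K (t + 1) - K t) has_real_derivative 0) (at t)" for t
  proof -
    have "((\<lambda>t. K (t + 1)) has_real_derivative \<phi> (circle_proj t)) (at t)"
      using K[of "t + 1"] by (subst DERIV_shift[symmetric]) simp
    from DERIV_diff[OF this K[of t]] show ?thesis by simp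
  qed
  then have const: "K (t + 1) - K t = K (0 + 1) - K 0" for t
    using DERIV_isconst_all[of "\<lambda>t. K (t + 1) - K t"] by blast
  have "((\<lambda>t. \<phi> (circle_proj t)) has_integral (K 1 - K 0)) {0..1}"
    by (rule FTC_real) (use K in auto)
  then have "circle_int \<phi> = K 1 - K 0"
    unfolding circle_int_def by (rule integral_unique)
  with const have "\<And>t. K (t + 1) - K t = circle_int \<phi>" by simp
  with K show ?thesis by (rule that)
qed

lemma circle_int_shift:
  assumes "continuous_on UNIV (\<phi> :: circle \<Rightarrow> real)"
  shows "integral {s..s+1} (\<lambda>t. \<phi> (circle_proj t)) = circle_int \<phi>"
proof -
  obtain K where K: "\<And>t. (K has_real_derivative \<phi> (circle_proj t)) (at t)"
    "\<And>t. K (t + 1) - K t = circle_int \<phi>"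
    using circle_antiderivative[OF assms] by blast
  have "((\<lambda>t. \<phi> (circle_proj t)) has_integral (K (s+1) - K s)) {s..s+1}"
    by (rule FTC_real) (use K(1) in auto)
  with K(2) show ?thesis by (simp add: integral_unique)
qed

section \<open>Degree of lifts and Jacobians of diffeomorphisms\<close>

lemma continuous_Ints_const:
  fixes F :: "real \<Rightarrow> real"
  assumes "continuous_on UNIV F" "\<And>t. F t \<in> \<int>"
  obtains n :: int where "\<And>t. F t = of_int n"
proof -
  have "F constant_on UNIV"
  proof (rule continuous_discrete_range_constant)
    fix x :: real
    show "\<exists>e>0. \<forall>y. y \<in> UNIV \<and> F y \<noteq> F x \<longrightarrow> e \<le> norm (F y - F x)"
    proof (intro exI[of _ 1] conjI allI impI)
      fix y assume "y \<in> UNIV \<and> F y \<noteq> F x"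
      moreover have "F y - F x \<in> \<int>" using assms(2) by simp
      ultimately show "1 \<le> norm (F y - F x)"
        using Ints_nonzero_abs_ge1[of "F y - F x"] by simp
    qed simp
  qed (use assms in auto)
  then obtain c where "\<And>t. F t = c" unfolding constant_on_def by auto
  with assms(2)[of 0] that show ?thesis by (metis Ints_cases)
qed

text \<open>\<open>G (t + 1)\<close> and \<open>G t\<close> project to the same point, so their
  difference is a continuous integer-valued function and hence constant: the degree
  \<open>d\<close>.\<close>

lemma C1_circle_map_lift:
  assumes "C1_circle_map g"
  obtains G G' and d :: int where "\<And>t. (G has_real_derivative G' t) (at t)" "continuous_on UNIV G'"
    "\<And>t. g (circle_proj t) = circle_proj (G t)" "\<And>t. G (t + 1) = G t + of_int d"
proof -
  obtain G G' where G: "\<And>t. (G has_real_derivative G' t) (at t)" "continuous_on UNIV G'"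
    "\<And>t. g (circle_proj t) = circle_proj (G t)"
    using assms unfolding C1_circle_map_def by blast
  have cG: "continuous_on UNIV G"
    using G(1) by (meson DERIV_isCont continuous_at_imp_continuous_on)
  have "continuous_on UNIV (\<lambda>t. G (t + 1) - G t)"
    by (intro continuous_intros continuous_on_compose2[OF cG]) auto
  moreover have "G (t + 1) - G t \<in> \<int>" for t
    using G(3)[of t] G(3)[of "t + 1"] by (simp flip: circle_proj_eq_iff)
  ultimately obtain d :: int where "\<And>t. G (t + 1) - G t = of_int d"
    by (rule continuous_Ints_const) blast
  then have "\<And>t. G (t + 1) = G t + of_int d" by (metis add.commute diff_add_cancel)
  with G that show ?thesis by blast
qed

lemma add_int_period:
  assumes "\<And>t. H (t + 1) = H t + (e :: real)"
  shows "H (t + of_int n) = H t + of_int n * e"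
proof -
  have nat: "H (t + of_nat k) = H t + of_nat k * e" for t k
  proof (induction k)
    case (Suc k)
    have "H (t + of_nat (Suc k)) = H ((t + of_nat k) + 1)" by (simp add: add_ac)
    also have "\<dots> = H (t + of_nat k) + e" by (rule assms)
    finally show ?case using Suc by (simp add: algebra_simps)
  qed simp
  show ?thesis
  proof (cases "n \<ge> 0")
    case True then show ?thesis using nat[of t "nat n"] by simp
  next
    case False
    then show ?thesis using nat[of "t + of_int n" "nat (-n)"] by (simp add: algebra_simps)
  qed
qed

lemma C1_circle_map_continuous:
  assumes "C1_circle_map g" shows "continuous_on UNIV g"
proof -
  obtain G G' and d :: int where G: "\<And>t. (G has_real_derivative G' t) (at t)"
    "\<And>t. g (circle_proj t) = circle_proj (G t)"
    using C1_circle_map_lift[OF assms] by metis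
  have cG: "continuous_on UNIV G"
    using G(1) by (meson DERIV_isCont continuous_at_imp_continuous_on)
  show ?thesis
    by (rule continuous_on_circle)
      (simp add: G(2) continuous_on_compose2[OF continuous_on_circle_proj[of UNIV] cG])
qed

text \<open>The function \<open>J\<close> is the absolute value of the derivative.\<close>

lemma C1_circle_diffeo_jacobian:
  assumes "C1_circle_diffeo g"
  obtains J where "continuous_on UNIV J" "\<And>x. J x > 0"
    "\<And>x y. \<exists>z. dist z x \<le> dist x y \<and> dist (g x) (g y) \<le> J z * dist x y"
    "\<And>\<psi>. continuous_on UNIV \<psi> \<Longrightarrow> circle_int (\<lambda>x. \<psi> (g x) * J x) = circle_int \<psi>"
proof -
  have bij: "bij g" and C: "C1_circle_map g" "C1_circle_map (inv g)"
    using assms by (auto simp: C1_circle_diffeo_def)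
  obtain G G' and d :: int where G: "\<And>t. (G has_real_derivative G' t) (at t)" "continuous_on UNIV G'"
    "\<And>t. g (circle_proj t) = circle_proj (G t)" "\<And>t. G (t + 1) = G t + of_int d"
    using C1_circle_map_lift[OF C(1)] by metis
  obtain H H' and e :: int where H: "\<And>t. (H has_real_derivative H' t) (at t)" "continuous_on UNIV H'"
    "\<And>t. inv g (circle_proj t) = circle_proj (H t)" "\<And>t. H (t + 1) = H t + of_int e"
    using C1_circle_map_lift[OF C(2)] by metis
  have cG: "continuous_on S G" for S
    using G(1) by (meson DERIV_isCont continuous_at_imp_continuous_on)
  have cH: "continuous_on UNIV H"
    using H(1) by (meson DERIV_isCont continuous_at_imp_continuous_on)
  have "continuous_on UNIV (\<lambda>t. H (G t) - t)"
    by (intro continuous_intros continuous_on_compose2[OF cH cG]) auto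
  moreover have "H (G t) - t \<in> \<int>" for t
    using H(3)[of "G t"] G(3)[of t] bij by (metis bij_is_inj circle_proj_eq_iff inv_f_f)
  ultimately obtain k :: int where k: "\<And>t. H (G t) - t = of_int k"
    by (rule continuous_Ints_const) blast
  have HG: "H (G t) = t + of_int k" for t using k[of t] by simp
  \<comment> \<open>The composed lift is a translation, so its derivative is 1; this keeps
    \<open>G'\<close> away from 0.\<close>
  have "H' (G t) * G' t = 1" for t
  proof -
    have "((\<lambda>t. H (G t)) has_real_derivative H' (G t) * G' t) (at t)"
      by (rule DERIV_chain2[OF H(1) G(1)])
    moreover have "((\<lambda>t. H (G t)) has_real_derivative 1) (at t)"
      unfolding HG by (auto intro!: derivative_eq_intros)
    ultimately show ?thesis by (rule DERIV_unique)
  qed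
  then have nz: "G' t \<noteq> 0" for t
    using mult_zero_right zero_neq_one by metis
  \<comment> \<open>Degrees multiply under composition and a translation has degree 1, so both
    degrees are units of the integers.\<close>
  have "of_int (d * e) = (1::real)"
  proof -
    have "H (G (0 + 1)) = H (G 0) + of_int d * of_int e"
      unfolding G(4) by (rule add_int_period) (rule H(4))
    then show ?thesis by (simp add: HG)
  qed
  then have "d * e = 1" by linarith
  then have d: "d = 1 \<or> d = -1" using zmult_eq_1_iff by blast
  have G'per: "G' (t + 1) = G' t" for t
  proof -
    have "((\<lambda>t. G (t + 1)) has_real_derivative G' (t + 1)) (at t)"
      using G(1)[of "t + 1"] by (subst DERIV_shift[symmetric]) simp
    moreover have "((\<lambda>t. G (t + 1)) has_real_derivative G' t) (at t)"
      unfolding G(4) using G(1)[of t] by (auto intro!: derivative_eq_intros)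
    ultimately show ?thesis by (rule DERIV_unique)
  qed
  define J where "J x = \<bar>G' (rep_circle x)\<bar>" for x
  have Jp: "J (circle_proj t) = \<bar>G' t\<bar>" for t
  proof -
    have "G' (frac t + of_int \<lfloor>t\<rfloor>) = G' (frac t) + of_int \<lfloor>t\<rfloor> * 0"
      by (rule add_int_period) (simp add: G'per)
    then show ?thesis by (simp add: J_def rep_circle_proj frac_def)
  qed
  have "continuous_on UNIV J"
    by (rule continuous_on_circle) (simp add: Jp continuous_on_rabs G(2))
  moreover have "J x > 0" for x by (simp add: J_def nz)
  \<comment> \<open>Mean value theorem along the shorter arc. The intermediate point is retained as
    a point of the circle within \<open>dist x y\<close> of \<open>x\<close>, in the form in which
    uniform continuity of \<open>ln J\<close> will use it.\<close>
  moreover have "\<exists>z. dist z x \<le> dist x y \<and> dist (g x) (g y) \<le> J z * dist x y" for x y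
  proof -
    define s where "s = rep_circle x"
    have s: "circle_proj s = x" by (simp add: s_def)
    obtain t where t: "circle_proj t = y" "\<bar>s - t\<bar> = dist x y"
      using circle_lift[of y s] s by metis
    have "\<exists>u. \<bar>u - s\<bar> \<le> \<bar>s - t\<bar> \<and> G t - G s = (t - s) * G' u"
    proof -
      consider "s < t" | "s = t" | "t < s" by linarith
      then show ?thesis
      proof cases
        case 1
        from MVT2[OF 1 G(1)] show ?thesis by force
      next
        case 3
        from MVT2[OF 3 G(1)] obtain u where "t < u" "u < s" "G s - G t = (s - t) * G' u" by blast
        then show ?thesis by (intro exI[of _ u]) (auto simp: algebra_simps)
      qed auto
    qed
    then obtain u where u: "\<bar>u - s\<bar> \<le> \<bar>s - t\<bar>" "G t - G s = (t - s) * G' u" by blast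
    have "dist (g x) (g y) \<le> \<bar>G s - G t\<bar>"
      using dist_circle_proj_le[of "G s" "G t"] by (simp add: G(3)[symmetric] s t)
    also have "\<dots> = J (circle_proj u) * dist x y"
      using u(2) t(2) by (metis Jp abs_minus_commute abs_mult mult.commute)
    finally have "dist (g x) (g y) \<le> J (circle_proj u) * dist x y" .
    moreover have "dist (circle_proj u) x \<le> dist x y"
      using dist_circle_proj_le[of u s] u(1) t(2) s by simp
    ultimately show ?thesis by blast
  qed
  moreover have "circle_int (\<lambda>x. \<psi> (g x) * J x) = circle_int \<psi>"
    if cpsi: "continuous_on UNIV \<psi>" for \<psi>
  proof -
    obtain K where K: "\<And>t. (K has_real_derivative \<psi> (circle_proj t)) (at t)"
      "\<And>t. K (t + 1) - K t = circle_int \<psi>"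
      using circle_antiderivative[OF cpsi] by blast
    have sgn: "(\<forall>t. G' t > 0) \<or> (\<forall>t. G' t < 0)"
    proof (rule ccontr)
      assume "\<not> ?thesis"
      then obtain a b where ab: "G' a \<le> 0" "G' b \<ge> 0" by (meson not_le)
      have "connected (range G')"
        by (intro connected_continuous_image G(2)) auto
      then have "0 \<in> range G'"
        using ab by (rule connectedD_interval[OF _ rangeI[of _ a] rangeI[of _ b]])
      with nz show False by auto
    qed
    \<comment> \<open>The orientation. In degree -1 the period is traversed backwards and the sign
      compensates, so both cases end with one increment of \<open>K\<close> over a full
      period.\<close>
    define \<epsilon> :: real where "\<epsilon> = (if \<forall>t. G' t > 0 then 1 else -1)"
    have eps: "\<bar>G' t\<bar> = \<epsilon> * G' t" for t
    proof (cases "\<forall>t. G' t > 0")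
      case True then show ?thesis by (simp add: \<epsilon>_def less_imp_le)
    next
      case False
      then have "G' t < 0" using sgn by blast
      with False show ?thesis by (simp add: \<epsilon>_def)
    qed
    have "((\<lambda>t. \<epsilon> * K (G t)) has_real_derivative \<psi> (g (circle_proj t)) * J (circle_proj t)) (at t)" for t
      unfolding Jp eps G(3) using DERIV_cmult[OF DERIV_chain2[OF K(1) G(1)], of \<epsilon>]
      by (simp add: mult_ac)
    then have "((\<lambda>t. \<psi> (g (circle_proj t)) * J (circle_proj t)) has_integral
        (\<epsilon> * K (G 1) - \<epsilon> * K (G 0))) {0..1}"
      by (rule FTC_real) simp
    then have i1: "circle_int (\<lambda>x. \<psi> (g x) * J x) = \<epsilon> * (K (G 1) - K (G 0))"
      unfolding circle_int_def by (simp add: integral_unique algebra_simps)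
    obtain u where u: "G 1 - G 0 = (1 - 0) * G' u"
      using MVT2[of 0 1 G G'] G(1) by auto
    have g10: "G 1 = G 0 + of_int d" using G(4)[of 0] by simp
    show ?thesis
    proof (cases "\<forall>t. G' t > 0")
      case True
      then have "G' u > 0" by blast
      then have "d = 1" using d u g10 by auto
      then show ?thesis using i1 g10 K(2)[of "G 0"] True by (simp add: \<epsilon>_def)
    next
      case False
      then have "G' u < 0" using sgn by blast
      then have "d = -1" using d u g10 by auto
      then show ?thesis using i1 g10 K(2)[of "G 0 - 1"] False by (simp add: \<epsilon>_def)
    qed
  qed
  ultimately show ?thesis using that by blast
qed

section \<open>Markov operators and local contraction in mean\<close>

definition markov :: "nat \<Rightarrow> (nat \<Rightarrow> real) \<Rightarrow> (nat \<Rightarrow> 'a \<Rightarrow> 'a) \<Rightarrow> ('a \<Rightarrow> real) \<Rightarrow> 'a \<Rightarrow> real" where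
  "markov N p f \<phi> x = (\<Sum>i<N. p i * \<phi> (f i x))"

text \<open>Both points are moved by the same random letter, so \<open>M (pair_maps f)\<close>
  averages over the synchronous coupling of two orbits.\<close>

abbreviation pair_maps :: "(nat \<Rightarrow> 'a \<Rightarrow> 'a) \<Rightarrow> nat \<Rightarrow> 'a \<times> 'a \<Rightarrow> 'a \<times> 'a" where
  "pair_maps f i \<equiv> map_prod (f i) (f i)"

locale weights =
  fixes N :: nat and p :: "nat \<Rightarrow> real"
  assumes p_pos: "i < N \<Longrightarrow> p i > 0" and p_sum: "(\<Sum>i<N. p i) = 1"
begin

abbreviation M :: "(nat \<Rightarrow> 'a \<Rightarrow> 'a) \<Rightarrow> ('a \<Rightarrow> real) \<Rightarrow> 'a \<Rightarrow> real" where
  "M \<equiv> markov N p"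

lemma p_le_1: "i < N \<Longrightarrow> p i \<le> 1"
  using member_le_sum[of i "{..<N}" p] p_pos p_sum by (force intro: less_imp_le)

lemma M_const [simp]: "M f (\<lambda>x. c) = (\<lambda>x. c)"
  by (simp add: markov_def fun_eq_iff p_sum flip: sum_distrib_right)

lemma M_add: "M f (\<lambda>x. \<phi> x + \<psi> x) = (\<lambda>x. M f \<phi> x + M f \<psi> x)"
  by (simp add: markov_def fun_eq_iff algebra_simps sum.distrib)

lemma M_diff: "M f (\<lambda>x. \<phi> x - \<psi> x) = (\<lambda>x. M f \<phi> x - M f \<psi> x)"
  by (simp add: markov_def fun_eq_iff algebra_simps sum_subtractf)

lemma M_cmult: "M f (\<lambda>x. c * \<phi> x) = (\<lambda>x. c * M f \<phi> x)"
  by (simp add: markov_def fun_eq_iff algebra_simps sum_distrib_left)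

lemma M_sum: "M f (\<lambda>x. \<Sum>j\<in>A. \<phi> j x) = (\<lambda>x. \<Sum>j\<in>A. M f (\<phi> j) x)"
  by (simp add: markov_def fun_eq_iff sum_distrib_left sum.swap[of _ A])

lemma M_mono: "(\<And>x. \<phi> x \<le> \<psi> x) \<Longrightarrow> M f \<phi> x \<le> M f \<psi> x"
  unfolding markov_def by (intro sum_mono mult_left_mono) (auto simp: p_pos less_imp_le)

lemma M_iter_const [simp]: "(M f ^^ n) (\<lambda>x. c) = (\<lambda>x. c)"
  by (induction n) simp_all

lemma M_iter_add: "(M f ^^ n) (\<lambda>x. \<phi> x + \<psi> x) = (\<lambda>x. (M f ^^ n) \<phi> x + (M f ^^ n) \<psi> x)"
  by (induction n) (simp_all add: M_add)

lemma M_iter_cmult: "(M f ^^ n) (\<lambda>x. c * \<phi> x) = (\<lambda>x. c * (M f ^^ n) \<phi> x)"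
  by (induction n) (simp_all add: M_cmult)

lemma M_iter_mono: "(\<And>x. \<phi> x \<le> \<psi> x) \<Longrightarrow> (M f ^^ n) \<phi> x \<le> (M f ^^ n) \<psi> x"
  by (induction n arbitrary: x) (simp_all add: M_mono)

lemma M_iter_bound:
  assumes "\<And>x. \<bar>\<phi> x\<bar> \<le> B" shows "\<bar>(M f ^^ n) \<phi> x\<bar> \<le> B"
proof -
  have "(M f ^^ n) \<phi> x \<le> (M f ^^ n) (\<lambda>x. B) x" "(M f ^^ n) (\<lambda>x. -B) x \<le> (M f ^^ n) \<phi> x"
    by (intro M_iter_mono; use assms abs_le_iff minus_le_iff in blast)+
  then show ?thesis by simp
qed

lemma M_iter_pair:
  "(M (pair_maps f) ^^ n) (\<lambda>z. \<phi> (fst z) - \<phi> (snd z)) (x, y) = (M f ^^ n) \<phi> x - (M f ^^ n) \<phi> y"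
proof (induction n arbitrary: x y)
  case (Suc n)
  then show ?case by (simp add: markov_def sum_subtractf right_diff_distrib)
qed simp

text \<open>By \<open>M_iter_pair\<close> the difference of the iterates is the iterate of the
  difference on pairs; monotonicity is applied to it and to its negative. Contraction on functions
  is thereby reduced to contraction of distances in mean.\<close>

lemma M_iter_osc:
  assumes "\<And>x y. \<bar>\<phi> x - \<phi> y\<bar> \<le> u (x, y)"
  shows "\<bar>(M f ^^ n) \<phi> x - (M f ^^ n) \<phi> y\<bar> \<le> (M (pair_maps f) ^^ n) u (x, y)"
proof -
  have "(M (pair_maps f) ^^ n) (\<lambda>z. \<phi> (fst z) - \<phi> (snd z)) (x, y) \<le> (M (pair_maps f) ^^ n) u (x, y)"
    using assms by (intro M_iter_mono) (auto simp: abs_le_iff)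
  moreover have "(M (pair_maps f) ^^ n) (\<lambda>z. (-1) * (\<phi> (fst z) - \<phi> (snd z))) (x, y)
      \<le> (M (pair_maps f) ^^ n) u (x, y)"
    using assms by (intro M_iter_mono) (auto simp: abs_le_iff)
  ultimately show ?thesis unfolding M_iter_cmult M_iter_pair by (simp add: abs_le_iff)
qed

lemma M_continuous:
  assumes "\<And>i. i < N \<Longrightarrow> continuous_on UNIV (f i)" "continuous_on UNIV \<phi>"
  shows "continuous_on UNIV (M f \<phi>)"
  unfolding markov_def
  by (intro continuous_intros continuous_on_compose2[OF assms(2) assms(1)]) auto

lemma M_iter_continuous:
  assumes "\<And>i. i < N \<Longrightarrow> continuous_on UNIV (f i)" "continuous_on UNIV \<phi>"
  shows "continuous_on UNIV ((M f ^^ n) \<phi>)"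
  by (induction n) (simp_all add: assms M_continuous)

text \<open>The iterate averages over all words of length \<open>n\<close> with positive weights, so
  a single word with value below 1 pulls the average strictly below 1. Proximality supplies just one
  such word. The induction absorbs the last letter into \<open>\<phi>\<close>.\<close>

lemma M_iter_less_1:
  assumes "\<And>x. \<phi> x \<le> 1" "\<And>k. \<omega> k < N" "\<phi> (rand_iter f \<omega> n x) < 1"
  shows "(M f ^^ n) \<phi> x < 1"
  using assms(1,3)
proof (induction n arbitrary: \<phi>)
  case (Suc n)
  have "M f \<phi> y \<le> 1" for y
    using M_mono[of \<phi> "\<lambda>_. 1" f y] Suc.prems(1) by simp
  moreover have "M f \<phi> (rand_iter f \<omega> n x) < (\<Sum>i<N. p i * 1)"
    unfolding markov_def
  proof (rule sum_strict_mono_ex1)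
    show "\<forall>i\<in>{..<N}. p i * \<phi> (f i (rand_iter f \<omega> n x)) \<le> p i * 1"
      using Suc.prems(1) p_pos by (intro ballI mult_left_mono) (auto simp: less_imp_le)
    show "\<exists>i\<in>{..<N}. p i * \<phi> (f i (rand_iter f \<omega> n x)) < p i * 1"
      using Suc.prems(2) p_pos assms(2) by (intro bexI[of _ "\<omega> n"] mult_strict_left_mono) auto
  qed auto
  ultimately have "(M f ^^ n) (M f \<phi>) x < 1"
    by (intro Suc.IH) (auto simp: p_sum)
  then show ?case by (simp only: funpow_Suc_right o_def)
qed simp

end

section \<open>Lyapunov functions near the diagonal\<close>

lemma exp_le_quadratic:
  fixes u :: real
  assumes "u \<le> 1" shows "exp u \<le> 1 + u + u\<^sup>2"
proof (cases "u \<ge> 0")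
  case True then show ?thesis using exp_bound assms by simp
next
  case False
  define v where "v = - u"
  have v: "v > 0" using False by (simp add: v_def)
  have "1 - v + v\<^sup>2 = (v - 1/2)\<^sup>2 + 3/4" by (simp add: power2_eq_square algebra_simps)
  then have quad: "0 \<le> 1 - v + v\<^sup>2" by simp
  \<comment> \<open>The product equals \<open>1 + v ^ 3\<close>.\<close>
  have "1 \<le> (1 + v) * (1 - v + v\<^sup>2)"
    using v by (simp add: algebra_simps power2_eq_square)
  also have "\<dots> \<le> exp v * (1 - v + v\<^sup>2)"
    using exp_ge_add_one_self[of v] quad by (intro mult_right_mono) auto
  finally have "exp u \<le> 1 - v + v\<^sup>2"
    by (simp add: v_def exp_minus field_simps)
  then show ?thesis by (simp add: v_def)
qed

text \<open>Smoothness enters only through \<open>J\<close>: continuity and positivity, the mean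
  value bound \<open>J_lip\<close>, and the change of variables \<open>J_int\<close>. The maps
  \<open>g i\<close> are the inverses, needed for pushing densities forward.\<close>

locale circle_ifs = weights +
  fixes f g :: "nat \<Rightarrow> circle \<Rightarrow> circle" and J :: "nat \<Rightarrow> circle \<Rightarrow> real"
  assumes f_cont: "i < N \<Longrightarrow> continuous_on UNIV (f i)"
    and g_cont: "i < N \<Longrightarrow> continuous_on UNIV (g i)"
    and g_f: "i < N \<Longrightarrow> g i (f i x) = x"
    and f_g: "i < N \<Longrightarrow> f i (g i x) = x"
    and J_cont: "i < N \<Longrightarrow> continuous_on UNIV (J i)"
    and J_pos: "i < N \<Longrightarrow> J i x > 0"
    and J_lip: "i < N \<Longrightarrow> \<exists>z. dist z x \<le> dist x y \<and> dist (f i x) (f i y) \<le> J i z * dist x y"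
    and J_int: "i < N \<Longrightarrow> continuous_on UNIV \<psi> \<Longrightarrow> circle_int (\<lambda>x. \<psi> (f i x) * J i x) = circle_int \<psi>"
begin

definition log_J :: "circle \<Rightarrow> real" where
  "log_J x = (\<Sum>i<N. p i * ln (J i x))"

text \<open>By the chain rule this is the mean, over random words of length \<open>m\<close>, of the
  logarithm of the derivative of the composed map at \<open>x\<close>.\<close>

definition log_J_sum :: "nat \<Rightarrow> circle \<Rightarrow> real" where
  "log_J_sum m x = (\<Sum>k<m. (M f ^^ k) log_J x)"

lemma ln_J_cont: "i < N \<Longrightarrow> continuous_on UNIV (\<lambda>x. ln (J i x))"
  using J_cont J_pos by (intro continuous_on_ln) (auto simp: less_le)

lemma log_J_cont: "continuous_on UNIV log_J"
  unfolding log_J_def by (intro continuous_intros ln_J_cont) auto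

lemma log_J_sum_cont: "continuous_on UNIV (log_J_sum m)"
  unfolding log_J_sum_def by (intro continuous_intros M_iter_continuous f_cont log_J_cont)

lemma M_log_J_sum: "M f (log_J_sum m) x = log_J_sum (Suc m) x - log_J x"
proof -
  have "M f (log_J_sum m) x = (\<Sum>k<m. (M f ^^ Suc k) log_J x)"
    unfolding log_J_sum_def M_sum by simp
  also have "\<dots> = log_J_sum (Suc m) x - log_J x"
    unfolding log_J_sum_def by (subst sum.lessThan_Suc_shift) simp
  finally show ?thesis .
qed

text \<open>Take for \<open>\<psi>\<close> the mean of \<open>log_J_sum j\<close> over
  \<open>j < m\<close>. Telescoping shows that \<open>log_J x + M f \<psi> x - \<psi> x\<close> is
  exactly \<open>log_J_sum m x / m\<close>, so an m-step bound becomes a one-step bound up to a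
  coboundary.\<close>

lemma cohomological_bound:
  assumes "m > 0" "\<And>x. log_J_sum m x \<le> real m * \<theta>"
  obtains \<psi> where "continuous_on UNIV \<psi>" "\<And>x. log_J x + M f \<psi> x - \<psi> x \<le> \<theta>"
proof
  define \<psi> where "\<psi> x = (1 / m) * (\<Sum>j<m. log_J_sum j x)" for x
  show "continuous_on UNIV \<psi>"
    unfolding \<psi>_def by (intro continuous_intros log_J_sum_cont)
  fix x
  have "M f \<psi> x = (1 / m) * (\<Sum>j<m. log_J_sum (Suc j) x - log_J x)"
    unfolding \<psi>_def M_cmult M_sum M_log_J_sum ..
  also have "\<dots> = (1 / m) * ((\<Sum>j<Suc m. log_J_sum j x) - log_J_sum 0 x - m * log_J x)"
    by (subst sum.lessThan_Suc_shift) (simp add: sum_subtractf)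
  also have "\<dots> = \<psi> x + log_J_sum m x / m - log_J x"
    using \<open>m > 0\<close> by (simp add: \<psi>_def log_J_sum_def field_simps)
  finally have "M f \<psi> x = \<psi> x + log_J_sum m x / m - log_J x" .
  moreover have "log_J_sum m x / m \<le> \<theta>"
    using assms by (simp add: pos_divide_le_eq mult.commute)
  ultimately show "log_J x + M f \<psi> x - \<psi> x \<le> \<theta>" by linarith
qed

text \<open>The truncation at \<open>\<kappa>\<close> confines the one-step inequality to a
  neighbourhood of the diagonal and keeps \<open>u\<close> bounded. The rate \<open>\<theta>\<close>
  may have either sign: a positive one controls how fast mass spreads in the entropy argument, a
  negative one gives contraction.\<close>

definition local_lyapunov ::
    "real \<Rightarrow> real \<Rightarrow> (circle \<times> circle \<Rightarrow> real) \<Rightarrow> real \<Rightarrow> real \<Rightarrow> real \<Rightarrow> bool" where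
  "local_lyapunov \<beta> \<theta> u \<kappa> c C \<longleftrightarrow> 0 < \<kappa> \<and> 0 < c \<and> 0 < C \<and>
    continuous_on UNIV u \<and> (\<forall>z. 0 \<le> u z \<and> u z \<le> \<kappa>) \<and>
    (\<forall>z. u z < \<kappa> \<longrightarrow> M (pair_maps f) u z \<le> exp (\<beta> * \<theta>) * u z) \<and>
    (\<forall>x y. c * dist x y powr \<beta> \<le> u (x, y) \<and> u (x, y) \<le> C * dist x y powr \<beta>)"

lemma local_lyapunovD:
  assumes "local_lyapunov \<beta> \<theta> u \<kappa> c C"
  shows "0 < \<kappa>" "0 < c" "0 < C" "continuous_on UNIV u" "0 \<le> u z" "u z \<le> \<kappa>"
    "u z < \<kappa> \<Longrightarrow> M (pair_maps f) u z \<le> exp (\<beta> * \<theta>) * u z"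
    "c * dist x y powr \<beta> \<le> u (x, y)" "u (x, y) \<le> C * dist x y powr \<beta>"
  using assms unfolding local_lyapunov_def by blast+

text \<open>Use d^\<beta> weighted by exp (\<beta> \<psi>). To first order in \<beta> the
  logarithmic growth in mean is \<beta> times the one-step bound of
  \<open>cohomological_bound\<close>; the second-order term is dominated once \<beta> is small. Half
  of the gap \<theta>' - \<theta> pays for that term, the other half for the variation of
  \<open>ln J\<close> between the two points.\<close>

lemma local_growth:
  assumes "m > 0" "\<And>x. log_J_sum m x \<le> real m * \<theta>" "\<theta> < \<theta>'"
  obtains \<beta>0 where "\<beta>0 > 0" "\<And>\<beta>. 0 < \<beta> \<Longrightarrow> \<beta> \<le> \<beta>0 \<Longrightarrow> 
    \<exists>u \<kappa> c C. local_lyapunov \<beta> \<theta>' u \<kappa> c C"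
proof -
  obtain \<psi> where \<psi>: "continuous_on UNIV \<psi>" "\<And>x. log_J x + M f \<psi> x - \<psi> x \<le> \<theta>"
    using cohomological_bound[OF assms(1,2)] by blast
  obtain \<Psi> where \<Psi>: "\<Psi> > 0" "\<And>x. \<bar>\<psi> x\<bar> \<le> \<Psi>" using circle_bounded[OF \<psi>(1)] by blast
  define \<epsilon> where "\<epsilon> = (\<theta>' - \<theta>) / 2"
  have \<epsilon>: "\<epsilon> > 0" using assms(3) by (simp add: \<epsilon>_def)
  have eps2: "2 * \<epsilon> = \<theta>' - \<theta>" by (simp add: \<epsilon>_def)
  have "\<forall>i\<in>{..<N}. \<exists>d>0. \<forall>x y. dist x y < d \<longrightarrow> \<bar>ln (J i x) - ln (J i y)\<bar> < \<epsilon>"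
    using circle_uniformly_continuous[OF ln_J_cont \<epsilon>] by (metis lessThan_iff)
  then obtain d where d: "\<And>i. i < N \<Longrightarrow> d i > 0"
    "\<And>i x y. i < N \<Longrightarrow> dist x y < d i \<Longrightarrow> \<bar>ln (J i x) - ln (J i y)\<bar> < \<epsilon>"
    by (metis lessThan_iff)
  define \<delta> where "\<delta> = Min (insert 1 (d ` {..<N}))"
  have \<delta>: "\<delta> > 0" "\<And>i. i < N \<Longrightarrow> \<delta> \<le> d i" using d(1) by (auto simp: \<delta>_def)
  have "\<forall>i\<in>{..<N}. \<exists>B. \<forall>x. \<bar>ln (J i x)\<bar> \<le> B"
    using circle_bounded[OF ln_J_cont] by (metis lessThan_iff)
  then obtain B where B: "\<And>i x. i < N \<Longrightarrow> \<bar>ln (J i x)\<bar> \<le> B i"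
    by (metis lessThan_iff)
  define K where "K = 2 * \<Psi> + (\<Sum>i<N. \<bar>B i\<bar>) + \<epsilon>"
  have K: "K > 0" using \<Psi>(1) \<epsilon> by (simp add: K_def add_pos_nonneg sum_nonneg)
  \<comment> \<open>Near the diagonal, \<beta> times \<open>w i x\<close> bounds the logarithm of
    the factor by which the weighted distance changes under \<open>f i\<close>; the summand
    \<epsilon> is the oscillation of \<open>ln (J i)\<close>.\<close>
  define w where "w i x = \<psi> (f i x) - \<psi> x + ln (J i x) + \<epsilon>" for i x
  have w: "\<bar>w i x\<bar> \<le> K" if "i < N" for i x
  proof -
    have "B i \<le> (\<Sum>i<N. \<bar>B i\<bar>)"
      using that member_le_sum[of i "{..<N}" "\<lambda>i. \<bar>B i\<bar>"] by force
    then show ?thesis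
      using B[OF that, of x] \<Psi>(2)[of x] \<Psi>(2)[of "f i x"] \<epsilon> unfolding w_def K_def by linarith
  qed
  \<comment> \<open>The first bound gives \<beta> |w| at most 1, so that
    \<open>exp_le_quadratic\<close> applies; the second makes the square of \<beta> K at most
    \<beta> \<epsilon>.\<close>
  define \<beta>0 where "\<beta>0 = min (1 / K) (\<epsilon> / K\<^sup>2)"
  show ?thesis
  proof
    show "\<beta>0 > 0" using K \<epsilon> by (simp add: \<beta>0_def)
    fix \<beta> assume \<beta>: "0 < \<beta>" "\<beta> \<le> \<beta>0"
    have \<beta>K: "\<beta> * K \<le> 1" "\<beta> * K\<^sup>2 \<le> \<epsilon>"
      using \<beta> K by (auto simp: \<beta>0_def field_simps)
    define U where "U z = exp (\<beta> * \<psi> (fst z)) * dist (fst z) (snd z) powr \<beta>" for z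
    have U_step: "M (pair_maps f) U (x, y) \<le> exp (\<beta> * \<theta>') * U (x, y)" if xy: "dist x y < \<delta>" for x y
    proof -
      have summand: "p i * U (f i x, f i y) \<le> U (x, y) * (p i * (1 + \<beta> * w i x + \<beta> * \<epsilon>))" if i: "i < N" for i
      proof -
        obtain z where z: "dist z x \<le> dist x y" "dist (f i x) (f i y) \<le> J i z * dist x y"
          using J_lip[OF i] by blast
        have lnJ: "ln (J i z) \<le> ln (J i x) + \<epsilon>"
          using d(2)[OF i, of z x] z(1) xy \<delta>(2)[OF i] by linarith
        have "dist (f i x) (f i y) powr \<beta> \<le> (J i z * dist x y) powr \<beta>"
          using z \<beta> by (intro powr_mono2) auto
        also have "\<dots> = exp (\<beta> * ln (J i z)) * dist x y powr \<beta>"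
          using J_pos[OF i, of z] by (simp add: powr_mult) (simp add: powr_def)
        also have "\<dots> \<le> exp (\<beta> * (ln (J i x) + \<epsilon>)) * dist x y powr \<beta>"
          using lnJ \<beta> by (intro mult_right_mono) auto
        finally have "U (f i x, f i y) \<le>
            exp (\<beta> * \<psi> (f i x)) * (exp (\<beta> * (ln (J i x) + \<epsilon>)) * dist x y powr \<beta>)"
          by (simp add: U_def)
        also have "\<dots> = U (x, y) * exp (\<beta> * w i x)"
          by (simp add: U_def w_def algebra_simps flip: exp_add)
        also have "\<dots> \<le> U (x, y) * (1 + \<beta> * w i x + \<beta> * \<epsilon>)"
        proof (rule mult_left_mono)
          have a: "\<bar>\<beta> * w i x\<bar> \<le> \<beta> * K"
            using w[OF i, of x] \<beta> by (simp add: abs_mult)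
          then have "(\<beta> * w i x)\<^sup>2 \<le> (\<beta> * K)\<^sup>2"
            by (metis abs_ge_zero power2_abs power_mono)
          also have "\<dots> = \<beta> * (\<beta> * K\<^sup>2)" by (simp add: power2_eq_square)
          also have "\<dots> \<le> \<beta> * \<epsilon>" using \<beta>K \<beta> by (intro mult_left_mono) auto
          finally show "exp (\<beta> * w i x) \<le> 1 + \<beta> * w i x + \<beta> * \<epsilon>"
            using exp_le_quadratic[of "\<beta> * w i x"] a \<beta>K(1) by linarith
        qed (simp add: U_def)
        finally show ?thesis
          using p_pos[OF i] by (simp add: mult_left_mono mult.left_commute)
      qed
      have "(\<Sum>i<N. p i * (1 + \<beta> * w i x + \<beta> * \<epsilon>)) =
          (\<Sum>i<N. p i + \<beta> * (p i * \<psi> (f i x)) - \<beta> * \<psi> x * p i + \<beta> * (p i * ln (J i x)) + 2 * \<beta> * \<epsilon> * p i)"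
        by (intro sum.cong) (auto simp: w_def algebra_simps)
      also have "\<dots> = 1 + \<beta> * (M f \<psi> x - \<psi> x + log_J x + 2 * \<epsilon>)"
        using p_sum by (simp add: sum.distrib sum_subtractf markov_def log_J_def algebra_simps
            flip: sum_distrib_left sum_distrib_right)
      also have "\<dots> \<le> 1 + \<beta> * \<theta>'"
        using \<psi>(2)[of x] \<beta> eps2 by (intro add_left_mono mult_left_mono) linarith+
      also have "\<dots> \<le> exp (\<beta> * \<theta>')" by (rule exp_ge_add_one_self)
      finally have "U (x, y) * (\<Sum>i<N. p i * (1 + \<beta> * w i x + \<beta> * \<epsilon>)) \<le> U (x, y) * exp (\<beta> * \<theta>')"
        by (rule mult_left_mono) (simp add: U_def)
      moreover
      have "M (pair_maps f) U (x, y) \<le> (\<Sum>i<N. U (x, y) * (p i * (1 + \<beta> * w i x + \<beta> * \<epsilon>)))"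
        unfolding markov_def using summand by (intro sum_mono) simp
      then have "M (pair_maps f) U (x, y) \<le> U (x, y) * (\<Sum>i<N. p i * (1 + \<beta> * w i x + \<beta> * \<epsilon>))"
        by (simp add: sum_distrib_left)
      ultimately show ?thesis by (simp add: mult.commute)
    qed
    \<comment> \<open>Since \<open>U\<close> is at least exp (- \<beta> \<Psi>) d^\<beta>, a value
      below \<kappa> forces the distance below \<delta>, where \<open>U_step\<close> holds.\<close>
    define \<kappa> where "\<kappa> = exp (- \<beta> * \<Psi>) * \<delta> powr \<beta>"
    define u where "u z = min (U z) \<kappa>" for z
    have \<kappa>: "\<kappa> > 0" using \<delta> by (simp add: \<kappa>_def)
    have Ub: "exp (- \<beta> * \<Psi>) * dist x y powr \<beta> \<le> U (x, y)"
      "U (x, y) \<le> exp (\<beta> * \<Psi>) * dist x y powr \<beta>" for x y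
    proof -
      have "\<beta> * (- \<Psi>) \<le> \<beta> * \<psi> x" "\<beta> * \<psi> x \<le> \<beta> * \<Psi>"
        using \<Psi>(2)[of x] \<beta>(1) by (intro mult_left_mono; simp add: abs_le_iff)+
      then show "exp (- \<beta> * \<Psi>) * dist x y powr \<beta> \<le> U (x, y)"
        "U (x, y) \<le> exp (\<beta> * \<Psi>) * dist x y powr \<beta>"
        unfolding U_def by (auto intro!: mult_right_mono)
    qed
    have "u (x, y) \<ge> min (exp (- \<beta> * \<Psi>)) \<kappa> * dist x y powr \<beta>" for x y
    proof -
      have "dist x y powr \<beta> \<le> 1 powr \<beta>"
        using \<beta> dist_circle_le_1[of x y] by (intro powr_mono2) auto
      then have "min (exp (- \<beta> * \<Psi>)) \<kappa> * dist x y powr \<beta> \<le> \<kappa> * 1"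
        using \<kappa> by (intro mult_mono) auto
      moreover have "min (exp (- \<beta> * \<Psi>)) \<kappa> * dist x y powr \<beta> \<le> U (x, y)"
        by (rule order_trans[OF _ Ub(1)]) (auto intro: mult_right_mono)
      ultimately show ?thesis by (simp add: u_def)
    qed
    moreover have "u (x, y) \<le> exp (\<beta> * \<Psi>) * dist x y powr \<beta>" for x y
      using Ub(2)[of x y] by (simp add: u_def)
    moreover have "continuous_on UNIV u"
      unfolding u_def U_def using \<beta>
      by (intro continuous_intros continuous_on_compose2[OF \<psi>(1)] continuous_on_powr') auto
    moreover have "0 \<le> u z \<and> u z \<le> \<kappa>" for z
      using \<kappa> by (simp add: u_def U_def)
    moreover have "M (pair_maps f) u z \<le> exp (\<beta> * \<theta>') * u z" if "u z < \<kappa>" for z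
    proof -
      obtain x y where z: "z = (x, y)" by (cases z)
      have "U (x, y) < \<kappa>" using that unfolding z by (auto simp: u_def min_less_iff_disj)
      then have "exp (- \<beta> * \<Psi>) * dist x y powr \<beta> < exp (- \<beta> * \<Psi>) * \<delta> powr \<beta>"
        using Ub(1)[of x y] unfolding \<kappa>_def by (rule le_less_trans[rotated])
      then have "dist x y powr \<beta> < \<delta> powr \<beta>" by (simp only: mult_less_cancel_left_pos exp_gt_zero)
      then have "dist x y < \<delta>"
        using \<beta> \<delta> by (meson not_le powr_mono2 less_imp_le)
      moreover have "M (pair_maps f) u z \<le> M (pair_maps f) U z"
        by (rule M_mono) (simp add: u_def)
      moreover have "u z = U z" using that by (simp add: u_def)
      ultimately show ?thesis using U_step[of x y] by (simp add: z)
    qed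
    ultimately show "\<exists>u \<kappa> c C. local_lyapunov \<beta> \<theta>' u \<kappa> c C"
      unfolding local_lyapunov_def
      using \<kappa> by (intro exI[of _ u] exI[of _ \<kappa>] exI[of _ "min (exp (- \<beta> * \<Psi>)) \<kappa>"]
          exI[of _ "exp (\<beta> * \<Psi>)"]) auto
  qed
qed

end

section \<open>Entropy of densities\<close>

text \<open>Strict positivity makes \<open>ln (q x)\<close> continuous, so entropies stay within
  integrals of continuous functions.\<close>

definition density_fun :: "(circle \<Rightarrow> real) \<Rightarrow> bool" where
  "density_fun q \<longleftrightarrow> continuous_on UNIV q \<and> (\<forall>x. q x > 0) \<and> circle_int q = 1"

context circle_ifs
begin

text \<open>If a measure has density \<open>q\<close> with respect to arc length, this is the
  density of its image under \<open>f i\<close>.\<close>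

definition push_density :: "nat \<Rightarrow> (circle \<Rightarrow> real) \<Rightarrow> circle \<Rightarrow> real" where
  "push_density i q y = q (g i y) / J i (g i y)"

text \<open>The adjoint of the Markov operator with respect to arc length, see
  \<open>circle_int_transfer\<close>.\<close>

definition transfer :: "(circle \<Rightarrow> real) \<Rightarrow> circle \<Rightarrow> real" where
  "transfer q y = (\<Sum>i<N. p i * push_density i q y)"

text \<open>The sign is opposite to differential entropy: the value is relative entropy with respect
  to arc length, nonnegative, and large for concentrated densities.\<close>

definition entropy :: "(circle \<Rightarrow> real) \<Rightarrow> real" where
  "entropy q = circle_int (\<lambda>x. q x * ln (q x))"

lemma push_density_cont:
  assumes "i < N" "continuous_on UNIV q"
  shows "continuous_on UNIV (push_density i q)"
proof -
  have "J i (g i y) \<noteq> 0" for y using J_pos[OF assms(1), of "g i y"] by simp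
  then show ?thesis unfolding push_density_def
    by (intro continuous_intros continuous_on_compose2[OF assms(2) g_cont[OF assms(1)]]
        continuous_on_compose2[OF J_cont[OF assms(1)] g_cont[OF assms(1)]]) auto
qed

lemma push_density_pos: "i < N \<Longrightarrow> (\<And>x. q x > 0) \<Longrightarrow> push_density i q y > 0"
  by (simp add: push_density_def J_pos)

lemma circle_int_push_density:
  assumes "i < N" "continuous_on UNIV q" "continuous_on UNIV \<psi>"
  shows "circle_int (\<lambda>y. \<psi> y * push_density i q y) = circle_int (\<lambda>x. \<psi> (f i x) * q x)"
proof -
  have nz: "J i x \<noteq> 0" for x using J_pos[OF assms(1), of x] by simp
  have "circle_int (\<lambda>x. \<psi> (f i x) * push_density i q (f i x) * J i x)
      = circle_int (\<lambda>y. \<psi> y * push_density i q y)"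
    by (rule J_int[OF assms(1)]) (intro continuous_intros assms push_density_cont)
  moreover have "\<psi> (f i x) * push_density i q (f i x) * J i x = \<psi> (f i x) * q x" for x
    using nz[of x] by (simp add: push_density_def g_f[OF assms(1)])
  ultimately show ?thesis by simp
qed

lemma transfer_cont: "continuous_on UNIV q \<Longrightarrow> continuous_on UNIV (transfer q)"
  unfolding transfer_def by (intro continuous_intros push_density_cont) auto

lemma N_pos: "N > 0"
  using p_sum by (cases N) auto

lemma transfer_pos: "(\<And>x. q x > 0) \<Longrightarrow> transfer q y > 0"
  unfolding transfer_def using N_pos
  by (intro sum_pos mult_pos_pos p_pos push_density_pos) auto

lemma circle_int_transfer:
  assumes "continuous_on UNIV q" "continuous_on UNIV \<psi>"
  shows "circle_int (\<lambda>y. \<psi> y * transfer q y) = circle_int (\<lambda>x. M f \<psi> x * q x)"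
proof -
  have "circle_int (\<lambda>y. \<psi> y * transfer q y)
      = circle_int (\<lambda>y. \<Sum>i<N. p i * (\<psi> y * push_density i q y))"
    by (simp add: transfer_def sum_distrib_left mult_ac)
  also have "\<dots> = (\<Sum>i<N. p i * circle_int (\<lambda>x. \<psi> (f i x) * q x))"
    by (subst circle_int_sum)
      (auto intro!: continuous_intros assms push_density_cont simp: circle_int_cmult circle_int_push_density assms)
  also have "\<dots> = circle_int (\<lambda>x. \<Sum>i<N. p i * (\<psi> (f i x) * q x))"
    by (subst circle_int_sum)
      (auto intro!: continuous_intros assms continuous_on_compose2[OF assms(2) f_cont] simp: circle_int_cmult)
  finally show ?thesis by (simp add: markov_def sum_distrib_left sum_distrib_right mult_ac)
qed

lemma density_transfer: "density_fun q \<Longrightarrow> density_fun (transfer q)"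
  using circle_int_transfer[of q "\<lambda>_. 1"]
  by (simp add: density_fun_def transfer_cont transfer_pos)

lemma density_transfer_iter: "density_fun q \<Longrightarrow> density_fun ((transfer ^^ k) q)"
  by (induction k) (simp_all add: density_transfer)

lemma circle_int_transfer_iter:
  assumes "density_fun q" "continuous_on UNIV \<psi>"
  shows "circle_int (\<lambda>y. \<psi> y * (transfer ^^ k) q y) = circle_int (\<lambda>x. (M f ^^ k) \<psi> x * q x)"
  using assms(2)
proof (induction k arbitrary: \<psi>)
  case (Suc k)
  have "circle_int (\<lambda>y. \<psi> y * (transfer ^^ Suc k) q y) = circle_int (\<lambda>x. M f \<psi> x * (transfer ^^ k) q x)"
    using circle_int_transfer[OF _ Suc.prems] density_transfer_iter[OF assms(1), of k]
    by (simp add: density_fun_def)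
  also have "\<dots> = circle_int (\<lambda>x. (M f ^^ k) (M f \<psi>) x * q x)"
    by (intro Suc.IH M_continuous f_cont Suc.prems)
  finally show ?case by (simp only: funpow_Suc_right o_def)
qed simp

text \<open>Pointwise form of the Gibbs variational principle, obtained from ln z \<le> z - 1 at z =
  b exp \<phi> / a. The test value \<phi> is free; \<phi> = 0 recovers nonnegativity of relative
  entropy.\<close>

lemma gibbs_pointwise:
  fixes a b \<phi> :: real
  assumes "a > 0" "b > 0"
  shows "a * (ln a - ln b) \<ge> a - b + (a * \<phi> - b * (exp \<phi> - 1))"
proof -
  have "ln (b * exp \<phi> / a) \<le> b * exp \<phi> / a - 1"
    using assms by (intro ln_le_minus_one) auto
  moreover have "ln (b * exp \<phi> / a) = ln b + \<phi> - ln a"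
    using assms by (simp add: ln_div ln_mult)
  ultimately have "a * (ln b + \<phi> - ln a) \<le> a * (b * exp \<phi> / a - 1)"
    using assms by (intro mult_left_mono) auto
  also have "\<dots> = b * exp \<phi> - a" using assms by (simp add: field_simps)
  finally show ?thesis by (simp add: algebra_simps)
qed

text \<open>The left side is the Jensen gap, the p-weighted sum of a_i (ln a_i - ln b). The test
  value t \<phi> is used for the index \<open>j\<close> and 0 for all others, so only the deviation
  of a_j from the mean \<open>b\<close> is detected; expanding the exponential costs t^2 b.\<close>

lemma entropy_pointwise:
  assumes "\<And>i. i < N \<Longrightarrow> a i > 0" "j < N" "\<bar>\<phi>\<bar> \<le> 1" "0 \<le> t" "t \<le> 1"
  defines "b \<equiv> \<Sum>i<N. p i * a i"
  shows "(\<Sum>i<N. p i * (a i * ln (a i))) - b * ln b \<ge> p j * t * (\<phi> * a j - \<phi> * b) - t\<^sup>2 * b"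
proof -
  have b: "b > 0" unfolding b_def using N_pos by (intro sum_pos mult_pos_pos p_pos assms) auto
  \<comment> \<open>The gain beyond \<open>a i - b\<close> in the Gibbs inequality. The terms
    \<open>a i - b\<close> themselves cancel in the weighted sum, leaving the contribution of
    \<open>j\<close>.\<close>
  define e where "e i = (if i = j then a i * (t * \<phi>) - b * (exp (t * \<phi>) - 1) else 0)" for i
  have "a i * (ln (a i) - ln b) \<ge> a i - b + e i" if "i < N" for i
    using gibbs_pointwise[OF assms(1)[OF that] b, of "t * \<phi>"]
      gibbs_pointwise[OF assms(1)[OF that] b, of 0] by (auto simp: e_def)
  then have "(\<Sum>i<N. p i * (a i - b + e i)) \<le> (\<Sum>i<N. p i * (a i * (ln (a i) - ln b)))"
    by (intro sum_mono mult_left_mono) (auto simp: p_pos less_imp_le)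
  also have "\<dots> = (\<Sum>i<N. p i * (a i * ln (a i))) - b * ln b"
    unfolding b_def sum_distrib_right sum_subtractf[symmetric] by (simp add: algebra_simps)
  also have "(\<Sum>i<N. p i * (a i - b + e i)) = (\<Sum>i<N. p i * a i) - b * (\<Sum>i<N. p i) + (\<Sum>i<N. p i * e i)"
    by (simp add: algebra_simps sum_subtractf sum.distrib sum_distrib_left)
  also have "\<dots> = p j * (a j * (t * \<phi>) - b * (exp (t * \<phi>) - 1))"
    using \<open>j < N\<close> by (simp add: p_sum b_def[symmetric] e_def if_distrib sum.delta cong: if_cong)
  finally have 1: "p j * (a j * (t * \<phi>) - b * (exp (t * \<phi>) - 1))
      \<le> (\<Sum>i<N. p i * (a i * ln (a i))) - b * ln b" .
  have "\<bar>t * \<phi>\<bar> \<le> t * 1" unfolding abs_mult using assms by (intro mult_mono) auto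
  then have "t * \<phi> \<le> 1" using \<open>t \<le> 1\<close> by linarith
  then have "exp (t * \<phi>) - 1 \<le> t * \<phi> + (t * \<phi>)\<^sup>2"
    using exp_le_quadratic[of "t * \<phi>"] by linarith
  moreover have "(t * \<phi>)\<^sup>2 \<le> t\<^sup>2"
    using \<open>\<bar>t * \<phi>\<bar> \<le> t * 1\<close> abs_le_square_iff[of "t * \<phi>" t] \<open>0 \<le> t\<close> by auto
  ultimately have "exp (t * \<phi>) - 1 \<le> t * \<phi> + t\<^sup>2" by linarith
  then have "b * (exp (t * \<phi>) - 1) \<le> b * (t * \<phi> + t\<^sup>2)"
    using b by (intro mult_left_mono) auto
  then have "p j * (a j * (t * \<phi>) - b * (t * \<phi> + t\<^sup>2)) \<le> p j * (a j * (t * \<phi>) - b * (exp (t * \<phi>) - 1))"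
    using p_pos[OF \<open>j < N\<close>] by (intro mult_left_mono) auto
  moreover have "p j * (b * t\<^sup>2) \<le> 1 * (b * t\<^sup>2)"
    using p_le_1[OF \<open>j < N\<close>] b by (intro mult_right_mono) auto
  ultimately show ?thesis using 1 by (simp add: algebra_simps)
qed

text \<open>Changing variables, the weighted sum of the entropies of the pushed densities is
  \<open>entropy q\<close> minus the mean of \<open>log_J\<close>. Subtracting the entropy of their
  mixture leaves the integrated Jensen gap, bounded below by
  \<open>entropy_pointwise\<close>.\<close>

lemma entropy_step:
  assumes q: "density_fun q" and \<phi>: "continuous_on UNIV \<phi>" "\<And>x. \<bar>\<phi> x\<bar> \<le> 1"
    and "j < N" "0 \<le> t" "t \<le> 1"
  shows "circle_int (\<lambda>x. log_J x * q x) +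
      p j * t * (circle_int (\<lambda>x. \<phi> (f j x) * q x) - circle_int (\<lambda>x. \<phi> x * transfer q x)) - t\<^sup>2
    \<le> entropy q - entropy (transfer q)"
proof -
  have qc: "continuous_on UNIV q" and qp: "\<And>x. q x > 0" and q1: "circle_int q = 1"
    using q by (auto simp: density_fun_def)
  have T: "continuous_on UNIV (transfer q)" "\<And>x. transfer q x > 0" "circle_int (transfer q) = 1"
    using density_transfer[OF q] by (auto simp: density_fun_def)
  let ?a = "\<lambda>i. push_density i q"
  have ac: "continuous_on UNIV (?a i)" and ap: "?a i y > 0" if "i < N" for i y
    using that push_density_cont push_density_pos qc qp by auto
  have lnc: "continuous_on UNIV (\<lambda>x. ln (h x))" if "continuous_on UNIV h" "\<And>x. h x > 0"
    for h :: "circle \<Rightarrow> real" using that by (intro continuous_on_ln) (auto simp: less_le)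
  have i1: "circle_int (\<lambda>y. ?a i y * ln (?a i y)) = circle_int (\<lambda>x. q x * ln (q x) - ln (J i x) * q x)"
    if i: "i < N" for i
  proof -
    have "circle_int (\<lambda>y. ln (?a i y) * ?a i y) = circle_int (\<lambda>x. ln (?a i (f i x)) * q x)"
      by (rule circle_int_push_density[OF i qc lnc[OF ac[OF i] ap[OF i]]])
    moreover have "ln (?a i (f i x)) * q x = q x * ln (q x) - ln (J i x) * q x" for x
      using qp[of x] J_pos[OF i, of x] by (simp add: push_density_def g_f[OF i] ln_div algebra_simps)
    ultimately show ?thesis by (simp add: mult.commute)
  qed
  have "circle_int (\<lambda>y. \<Sum>i<N. p i * (?a i y * ln (?a i y))) =
      (\<Sum>i<N. p i * circle_int (\<lambda>x. q x * ln (q x) - ln (J i x) * q x))"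
    by (subst circle_int_sum) (auto intro!: continuous_intros ac lnc ap simp: circle_int_cmult i1)
  also have "\<dots> = (\<Sum>i<N. p i * (entropy q - circle_int (\<lambda>x. ln (J i x) * q x)))"
    unfolding entropy_def
    by (intro sum.cong refl arg_cong2[where f = "(*)"] circle_int_diff continuous_intros qc lnc qp ln_J_cont) auto
  also have "\<dots> = entropy q - (\<Sum>i<N. p i * circle_int (\<lambda>x. ln (J i x) * q x))"
    by (simp add: right_diff_distrib sum_subtractf p_sum flip: sum_distrib_right)
  also have "(\<Sum>i<N. p i * circle_int (\<lambda>x. ln (J i x) * q x))
      = circle_int (\<lambda>x. \<Sum>i<N. p i * (ln (J i x) * q x))"
    by (subst circle_int_sum) (auto intro!: continuous_intros ln_J_cont qc simp: circle_int_cmult)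
  also have "\<dots> = circle_int (\<lambda>x. log_J x * q x)"
    by (simp add: log_J_def sum_distrib_left mult_ac)
  finally have A: "circle_int (\<lambda>y. \<Sum>i<N. p i * (?a i y * ln (?a i y)))
      = entropy q - circle_int (\<lambda>x. log_J x * q x)" .
  have "circle_int (\<lambda>y. p j * t * (\<phi> y * ?a j y - \<phi> y * transfer q y) - t\<^sup>2 * transfer q y) \<le>
      circle_int (\<lambda>y. (\<Sum>i<N. p i * (?a i y * ln (?a i y))) - transfer q y * ln (transfer q y))"
  proof (rule circle_int_mono)
    fix y
    show "p j * t * (\<phi> y * ?a j y - \<phi> y * transfer q y) - t\<^sup>2 * transfer q y \<le>
      (\<Sum>i<N. p i * (?a i y * ln (?a i y))) - transfer q y * ln (transfer q y)"
      unfolding transfer_def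
      by (rule entropy_pointwise) (use ap \<phi>(2) assms(4-6) in auto)
  qed (auto intro!: continuous_intros ac lnc ap T \<phi>(1) \<open>j < N\<close>)
  also have "\<dots> = entropy q - circle_int (\<lambda>x. log_J x * q x) - entropy (transfer q)"
    unfolding entropy_def[of "transfer q"]
    by (subst circle_int_diff) (auto intro!: continuous_intros ac lnc ap T simp: A)
  also have "circle_int (\<lambda>y. p j * t * (\<phi> y * ?a j y - \<phi> y * transfer q y) - t\<^sup>2 * transfer q y)
      = p j * t * (circle_int (\<lambda>y. \<phi> y * ?a j y) - circle_int (\<lambda>y. \<phi> y * transfer q y)) - t\<^sup>2 * 1"
    unfolding T(3)[symmetric]
    by (subst circle_int_diff, (intro continuous_intros ac T \<phi> \<open>j < N\<close>)+, unfold circle_int_cmult,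
        subst circle_int_diff, (intro continuous_intros ac T \<phi> \<open>j < N\<close>)+) simp
  also have "circle_int (\<lambda>y. \<phi> y * ?a j y) = circle_int (\<lambda>x. \<phi> (f j x) * q x)"
    by (rule circle_int_push_density) fact+
  finally show ?thesis by simp
qed

text \<open>Relative entropy against the constant density 1; the circle has total length 1.\<close>

lemma entropy_nonneg: assumes "density_fun q" shows "entropy q \<ge> 0"
proof -
  have q: "continuous_on UNIV q" "\<And>x. q x > 0" "circle_int q = 1"
    using assms by (auto simp: density_fun_def)
  have lnc: "continuous_on UNIV (\<lambda>x. ln (q x))" using q by (intro continuous_on_ln) (auto simp: less_le)
  have "circle_int (\<lambda>x. q x - 1) \<le> circle_int (\<lambda>x. q x * ln (q x))"
    using gibbs_pointwise[OF q(2), of 1 _ 0]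
    by (intro circle_int_mono continuous_intros q lnc) simp
  moreover have "circle_int (\<lambda>x. q x - 1) = 0"
    using q by (subst circle_int_diff) auto
  ultimately show ?thesis by (simp add: entropy_def)
qed

text \<open>Sum \<open>entropy_step\<close> along the orbit of \<open>q\<close>: entropies telescope
  and the last one is nonnegative. Duality moves the log-derivatives back to the initial density,
  where they form \<open>log_J_sum n\<close>.\<close>

lemma entropy_sum:
  assumes q: "density_fun q" and \<phi>: "continuous_on UNIV \<phi>" "\<And>x. \<bar>\<phi> x\<bar> \<le> 1"
    and "j < N" "0 \<le> t" "t \<le> 1"
  shows "circle_int (\<lambda>x. log_J_sum n x * q x) +
      p j * t * (\<Sum>k<n. circle_int (\<lambda>x. \<phi> (f j x) * (transfer ^^ k) q x)
        - circle_int (\<lambda>x. \<phi> x * (transfer ^^ Suc k) q x)) - n * t\<^sup>2 \<le> entropy q"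
proof -
  have qc: "continuous_on UNIV q" using q by (simp add: density_fun_def)
  have "circle_int (\<lambda>x. log_J_sum n x * q x) = (\<Sum>k<n. circle_int (\<lambda>x. (M f ^^ k) log_J x * q x))"
    unfolding log_J_sum_def sum_distrib_right
    by (subst circle_int_sum) (auto intro!: continuous_intros M_iter_continuous f_cont log_J_cont qc)
  also have "\<dots> = (\<Sum>k<n. circle_int (\<lambda>x. log_J x * (transfer ^^ k) q x))"
    by (simp add: circle_int_transfer_iter[OF q log_J_cont])
  finally have "circle_int (\<lambda>x. log_J_sum n x * q x) +
      p j * t * (\<Sum>k<n. circle_int (\<lambda>x. \<phi> (f j x) * (transfer ^^ k) q x)
        - circle_int (\<lambda>x. \<phi> x * (transfer ^^ Suc k) q x)) - n * t\<^sup>2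
     = (\<Sum>k<n. circle_int (\<lambda>x. log_J x * (transfer ^^ k) q x) +
      p j * t * (circle_int (\<lambda>x. \<phi> (f j x) * (transfer ^^ k) q x)
        - circle_int (\<lambda>x. \<phi> x * (transfer ^^ Suc k) q x)) - t\<^sup>2)"
    by (simp add: sum.distrib sum_subtractf flip: sum_distrib_left)
  also have "\<dots> \<le> (\<Sum>k<n. entropy ((transfer ^^ k) q) - entropy ((transfer ^^ Suc k) q))"
  proof (rule sum_mono)
    fix k
    show "circle_int (\<lambda>x. log_J x * (transfer ^^ k) q x) +
      p j * t * (circle_int (\<lambda>x. \<phi> (f j x) * (transfer ^^ k) q x)
        - circle_int (\<lambda>x. \<phi> x * (transfer ^^ Suc k) q x)) - t\<^sup>2
        \<le> entropy ((transfer ^^ k) q) - entropy ((transfer ^^ Suc k) q)"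
      using entropy_step[OF density_transfer_iter[OF q, of k] \<phi> assms(4-6)] by simp
  qed
  also have "\<dots> = entropy q - entropy ((transfer ^^ n) q)"
    by (subst sum_lessThan_telescope') simp
  also have "\<dots> \<le> entropy q" using entropy_nonneg[OF density_transfer_iter[OF q, of n]] by simp
  finally show ?thesis .
qed

text \<open>A tent of radius \<open>r\<close> around \<open>x\<close> over a small background. The
  last conclusion says that integrals against \<open>q\<close> see only the ball of radius
  \<open>r\<close>, up to an error linear in \<open>r\<close>.\<close>

lemma bump_density:
  assumes r: "0 < r" "r \<le> 1"
  obtains q where "density_fun q" "entropy q \<le> ln (8 / r)"
    "\<And>w A K. continuous_on UNIV w \<Longrightarrow> 0 \<le> A \<Longrightarrow> (\<And>y. w y \<le> K) \<Longrightarrow> 0 \<le> K \<Longrightarrow>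
      (\<And>y. dist x y \<le> r \<Longrightarrow> w y \<le> A) \<Longrightarrow> circle_int (\<lambda>y. w y * q y) \<le> A + 4 * K * r"
proof -
  \<comment> \<open>The background of height r^2 secures positivity. After division by
    \<open>Z\<close>, which is at least r / 4, it contributes at most 4 r.\<close>
  define b where "b y = r\<^sup>2 + max 0 (1 - dist x y / r)" for y
  define Z where "Z = circle_int b"
  have bc: "continuous_on UNIV b"
    unfolding b_def using r by (intro continuous_intros) auto
  have r2: "r\<^sup>2 > 0" "r\<^sup>2 \<le> 1" using r power_le_one[of r 2] by auto
  have bp: "b y > 0" for y using r2 by (simp add: b_def add_pos_nonneg)
  have b2: "b y \<le> 2" for y
  proof -
    have "0 \<le> dist x y / r" using r by simp
    then have "max 0 (1 - dist x y / r) \<le> 1" by simp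
    then show ?thesis using r2 unfolding b_def by linarith
  qed
  have Z: "Z \<ge> r / 4"
  proof -
    define s where "s = rep_circle x"
    have s: "circle_proj s = x" by (simp add: s_def)
    \<comment> \<open>The tent is at least 1/2 on an arc of length r / 2, which gives the bound r /
      4 for \<open>Z\<close>.\<close>
    have "1/2 \<le> b (circle_proj t)" if "t \<in> {s..s+r/2}" for t
    proof -
      have "dist x (circle_proj t) \<le> r / 2"
        using dist_circle_proj_le[of s t] that s by simp
      then have "dist x (circle_proj t) / r \<le> 1 / 2" using r by (simp add: field_simps)
      then have "1 / 2 \<le> max 0 (1 - dist x (circle_proj t) / r)" by linarith
      then show ?thesis using r2 unfolding b_def by linarith
    qed
    then have "integral {s..s+r/2} (\<lambda>t. 1/2) \<le> integral {s..s+r/2} (\<lambda>t. b (circle_proj t))"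
      by (intro integral_le circle_integrable bc) auto
    also have "\<dots> \<le> integral {s..s+1} (\<lambda>t. b (circle_proj t))"
      using r bp by (intro integral_subset_le circle_integrable bc) (auto simp: less_imp_le)
    also have "\<dots> = Z" unfolding Z_def by (rule circle_int_shift[OF bc])
    finally show ?thesis using r by simp
  qed
  then have Zp: "Z > 0" using r by linarith
  define q where "q y = (1 / Z) * b y" for y
  have qc: "continuous_on UNIV q" unfolding q_def by (intro continuous_intros bc)
  have qp: "q y > 0" for y using Zp bp by (simp add: q_def)
  have q1: "circle_int q = 1" unfolding q_def circle_int_cmult using Zp by (simp add: Z_def)
  have qle: "q y \<le> 8 / r" for y
  proof -
    have "b y * r \<le> 2 * r" using b2[of y] r by (intro mult_right_mono) auto
    also have "\<dots> \<le> 8 * Z" using Z by linarith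
    finally show ?thesis using Zp r by (simp add: q_def field_simps)
  qed
  show ?thesis
  proof
    show "density_fun q" by (simp add: density_fun_def qc qp q1)
    have "entropy q \<le> circle_int (\<lambda>y. ln (8 / r) * q y)"
      unfolding entropy_def
    proof (rule circle_int_mono)
      fix y
      have "ln (q y) \<le> ln (8 / r)" using qp[of y] qle[of y] r by (subst ln_le_cancel_iff) auto
      then show "q y * ln (q y) \<le> ln (8 / r) * q y"
        using qp[of y] by (simp add: mult.commute)
    qed (intro continuous_intros qc continuous_on_ln; use qp in \<open>simp add: less_le\<close>)+
    also have "\<dots> = ln (8 / r)" unfolding circle_int_cmult by (simp add: q1)
    finally show "entropy q \<le> ln (8 / r)" .
    fix w :: "circle \<Rightarrow> real" and A K :: real
    assume w: "continuous_on UNIV w" "0 \<le> A" "\<And>y. w y \<le> K" "0 \<le> K" "\<And>y. dist x y \<le> r \<Longrightarrow> w y \<le> A"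
    have "circle_int (\<lambda>y. w y * q y) \<le> circle_int (\<lambda>y. A * q y + K * r\<^sup>2 / Z)"
    proof (rule circle_int_mono)
      fix y
      show "w y * q y \<le> A * q y + K * r\<^sup>2 / Z"
      proof (cases "dist x y \<le> r")
        case True
        then have "w y * q y \<le> A * q y" using w(5) qp[of y] by (intro mult_right_mono) auto
        moreover have "0 \<le> K * r\<^sup>2 / Z" using w Zp r by simp
        ultimately show ?thesis by linarith
      next
        case False
        then have "q y = r\<^sup>2 / Z" using r by (simp add: q_def b_def)
        moreover have "w y * (r\<^sup>2 / Z) \<le> K * (r\<^sup>2 / Z)"
          using w(3)[of y] Zp by (intro mult_right_mono) auto
        moreover have "0 \<le> A * q y" using w(2) qp[of y] by simp
        ultimately show ?thesis by simp
      qed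
    qed (intro continuous_intros w qc)+
    also have "\<dots> = A + K * r\<^sup>2 / Z"
      by (subst circle_int_add) (auto intro!: continuous_intros qc simp: circle_int_cmult q1)
    also have "K * r\<^sup>2 / Z \<le> 4 * K * r"
    proof -
      have "(K * r) * r \<le> (K * r) * (4 * Z)" using Z w r by (intro mult_left_mono) auto
      then show ?thesis using Zp by (simp add: field_simps power2_eq_square)
    qed
    finally show "circle_int (\<lambda>y. w y * q y) \<le> A + 4 * K * r" by simp
  qed
qed

text \<open>Initial entropy minus the mean log-derivative collected in \<open>n\<close> steps is
  what remains for relative entropies, here at most a small multiple of \<open>n\<close>. The
  density found is the time average of the transferred bump.\<close>

lemma almost_invariant_density:
  assumes "\<Lambda> \<ge> 0" "\<And>n. \<exists>x. log_J_sum n x \<ge> real n * \<Lambda> - 1"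
    and "\<And>\<theta>. \<theta> > \<Lambda> \<Longrightarrow> \<exists>m>0. \<forall>x. log_J_sum m x \<le> real m * \<theta>"
    and "\<epsilon> > 0"
  obtains q where "density_fun q"
    "\<And>\<phi> j t. continuous_on UNIV \<phi> \<Longrightarrow> (\<And>x. \<bar>\<phi> x\<bar> \<le> 1) \<Longrightarrow> j < N \<Longrightarrow> 0 \<le> t \<Longrightarrow> t \<le> 1 \<Longrightarrow>
      p j * t * circle_int (\<lambda>x. (\<phi> (f j x) - \<phi> x) * q x) \<le> \<epsilon> + t\<^sup>2"
proof -
  \<comment> \<open>Six shares of \<eta>: three in the initial entropy (\<theta> + \<eta> =
    \<Lambda> + 3 \<eta>), one for the oscillation of \<open>log_J\<close>, one for mass leaving the
    orbit, and one absorbing the constant ln 8 + 3.\<close>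
  define \<eta> where "\<eta> = \<epsilon> / 6"
  have \<eta>: "\<eta> > 0" using assms(4) by (simp add: \<eta>_def)
  define \<theta> where "\<theta> = \<Lambda> + 2 * \<eta>"
  have "\<Lambda> < \<Lambda> + \<eta>" using \<eta> by simp
  from assms(3)[OF this] obtain m where m: "m > 0" "\<And>x. log_J_sum m x \<le> real m * (\<Lambda> + \<eta>)"
    by blast
  have th: "\<Lambda> + \<eta> < \<theta>" "\<theta> \<ge> 0" using \<eta> assms(1) by (auto simp: \<theta>_def)
  obtain \<beta>0 where b0: "\<beta>0 > 0"
    "\<And>\<beta>. 0 < \<beta> \<Longrightarrow> \<beta> \<le> \<beta>0 \<Longrightarrow> \<exists>u \<kappa> c C. local_lyapunov \<beta> \<theta> u \<kappa> c C"
    using local_growth[OF m th(1)] by blast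
  define \<beta> where "\<beta> = min \<beta>0 1"
  have \<beta>: "0 < \<beta>" "\<beta> \<le> \<beta>0" "\<beta> \<le> 1" using b0(1) by (auto simp: \<beta>_def)
  obtain u \<kappa> c C where "local_lyapunov \<beta> \<theta> u \<kappa> c C"
    using b0(2)[OF \<beta>(1,2)] by blast
  note u = local_lyapunovD[OF this]
  \<comment> \<open>Where the truncation is active the bound holds because
    \<open>\<theta> \<ge> 0\<close>; this uses the assumption that \<Lambda> is nonnegative.\<close>
  have growth1: "M (pair_maps f) u z \<le> exp (\<beta> * \<theta>) * u z" for z
  proof (cases "u z < \<kappa>")
    case False
    then have "u z = \<kappa>" using u(6)[of z] by simp
    moreover have "M (pair_maps f) u z \<le> \<kappa>"
      using M_mono[of u "\<lambda>_. \<kappa>" "pair_maps f" z] u(6) by simp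
    moreover have "1 * \<kappa> \<le> exp (\<beta> * \<theta>) * \<kappa>"
      using u(1) \<beta>(1) th(2) by (intro mult_right_mono) auto
    ultimately show ?thesis by simp
  qed (rule u(7))
  have growth: "(M (pair_maps f) ^^ k) u z \<le> exp (\<beta> * \<theta>) ^ k * u z" for k z
  proof (induction k arbitrary: z)
    case (Suc k)
    have "(M (pair_maps f) ^^ Suc k) u z \<le> M (pair_maps f) (\<lambda>z. exp (\<beta> * \<theta>) ^ k * u z) z"
      using Suc.IH by (simp add: M_mono)
    also have "\<dots> = exp (\<beta> * \<theta>) ^ k * M (pair_maps f) u z" by (simp add: M_cmult)
    also have "\<dots> \<le> exp (\<beta> * \<theta>) ^ k * (exp (\<beta> * \<theta>) * u z)"
      by (intro mult_left_mono growth1) auto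
    finally show ?case by (simp add: mult_ac)
  qed simp
  obtain B where B: "B > 0" "\<And>x. \<bar>log_J x\<bar> \<le> B" using circle_bounded[OF log_J_cont] by blast
  obtain d where d: "d > 0" "\<And>x y. dist x y < d \<Longrightarrow> \<bar>log_J x - log_J y\<bar> < \<eta>"
    using circle_uniformly_continuous[OF log_J_cont \<eta>] by blast
  \<comment> \<open>Within distance \<open>d\<close> the oscillation of \<open>log_J\<close> is
    below \<eta>. Beyond it \<open>u\<close> is at least \<open>c * d powr \<beta>\<close>, so
    \<open>D * u\<close> dominates the trivial bound 2 B.\<close>
  define D where "D = 2 * B / (c * d powr \<beta>)"
  have D: "D > 0" using B d u by (simp add: D_def)
  have osc1: "\<bar>log_J x - log_J y\<bar> \<le> \<eta> + D * u (x, y)" for x y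
  proof (cases "dist x y < d")
    case True
    then show ?thesis using d(2)[OF True] u(5)[of "(x, y)"] D by (smt (verit) mult_nonneg_nonneg)
  next
    case False
    then have "c * d powr \<beta> \<le> c * dist x y powr \<beta>"
      using d \<beta> u by (intro mult_left_mono powr_mono2) auto
    also have "\<dots> \<le> u (x, y)" by (rule u(8))
    finally have "D * (c * d powr \<beta>) \<le> D * u (x, y)" using D by simp
    moreover have "D * (c * d powr \<beta>) = 2 * B" using d u by (simp add: D_def)
    ultimately show ?thesis using B(2)[of x] B(2)[of y] \<eta> by linarith
  qed
  have osc: "(M f ^^ k) log_J x - (\<eta> + D * (exp (\<beta> * \<theta>) ^ n * u (x, y))) \<le> (M f ^^ k) log_J y"
    if "k < n" for k n x y
  proof -
    have "\<bar>(M f ^^ k) log_J x - (M f ^^ k) log_J y\<bar> \<le> (M (pair_maps f) ^^ k) (\<lambda>z. \<eta> + D * u z) (x, y)"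
      by (rule M_iter_osc) (rule osc1)
    also have "\<dots> = \<eta> + D * (M (pair_maps f) ^^ k) u (x, y)"
      by (simp add: M_iter_add M_iter_cmult)
    also have "(M (pair_maps f) ^^ k) u (x, y) \<le> exp (\<beta> * \<theta>) ^ k * u (x, y)" by (rule growth)
    also have "exp (\<beta> * \<theta>) ^ k * u (x, y) \<le> exp (\<beta> * \<theta>) ^ n * u (x, y)"
      using u(5) \<beta>(1) th(2) that by (intro mult_right_mono power_increasing) auto
    finally show ?thesis using D by (simp add: abs_le_iff)
  qed
  \<comment> \<open>\<open>C\<close> accounts for the mass within \<open>r\<close> of the starting
    point, \<open>4 * \<kappa>\<close> for the background of the bump.\<close>
  define E where "E = D * (C + 4 * \<kappa>)"
  have "(\<lambda>n. E * exp (- \<beta> * \<eta>) ^ n) \<longlonglongrightarrow> E * 0"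
    using \<beta>(1) \<eta> by (intro tendsto_mult LIMSEQ_power_zero tendsto_const) auto
  then have "eventually (\<lambda>n. E * exp (- \<beta> * \<eta>) ^ n < \<eta>) sequentially"
    using \<eta> by (intro order_tendstoD) auto
  moreover have "eventually (\<lambda>n. (ln 8 + 3) / \<eta> \<le> real n) sequentially"
    using eventually_ge_at_top[of "nat \<lceil>(ln 8 + 3) / \<eta>\<rceil>"] by eventually_elim linarith
  ultimately have "eventually (\<lambda>n. E * exp (- \<beta> * \<eta>) ^ n < \<eta> \<and> (ln 8 + 3) / \<eta> \<le> real n \<and> n > 0) sequentially"
    using eventually_gt_at_top[of 0] by eventually_elim auto
  from eventually_happens'[OF sequentially_bot this]
  obtain n where n: "E * exp (- \<beta> * \<eta>) ^ n < \<eta>" "(ln 8 + 3) / \<eta> \<le> real n" "n > 0"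
    by blast
  have n': "ln 8 + 3 \<le> real n * \<eta>" using n(2) \<eta> by (simp add: field_simps)
  \<comment> \<open>The scale at which growth exp (n \<beta> \<theta>) of the mean of
    \<open>u\<close> still leaves exp (- n \<beta> \<eta>) at time \<open>n\<close>.\<close>
  define r where "r = exp (- real n * (\<theta> + \<eta>))"
  have r: "0 < r" "r \<le> 1" using th \<eta> by (auto simp: r_def)
  obtain x where x: "log_J_sum n x \<ge> real n * \<Lambda> - 1" using assms(2) by blast
  obtain q where q: "density_fun q" "entropy q \<le> ln (8 / r)"
    "\<And>w A K. continuous_on UNIV w \<Longrightarrow> 0 \<le> A \<Longrightarrow> (\<And>y. w y \<le> K) \<Longrightarrow> 0 \<le> K \<Longrightarrow>
      (\<And>y. dist x y \<le> r \<Longrightarrow> w y \<le> A) \<Longrightarrow> circle_int (\<lambda>y. w y * q y) \<le> A + 4 * K * r"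
    using bump_density[OF r] by blast
  have qc: "continuous_on UNIV q" and q1: "circle_int q = 1" and qp: "\<And>x. q x > 0"
    using q by (auto simp: density_fun_def)
  have uxc: "continuous_on UNIV (\<lambda>y. u (x, y))"
    by (intro continuous_on_compose2[OF u(4)] continuous_intros) auto
  have "circle_int (\<lambda>y. u (x, y) * q y) \<le> C * r powr \<beta> + 4 * \<kappa> * r"
  proof (rule q(3)[OF uxc _ u(6)])
    fix y assume "dist x y \<le> r"
    then have "C * dist x y powr \<beta> \<le> C * r powr \<beta>"
      using u \<beta> by (intro mult_left_mono powr_mono2) auto
    then show "u (x, y) \<le> C * r powr \<beta>" using u(9)[of x y] by linarith
  qed (use u in auto)
  also have "\<dots> \<le> C * r powr \<beta> + 4 * \<kappa> * r powr \<beta>"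
  proof -
    have "r powr 1 \<le> r powr \<beta>" using r \<beta> by (intro powr_mono') auto
    then show ?thesis using r u by simp
  qed
  finally have ui: "circle_int (\<lambda>y. u (x, y) * q y) \<le> (C + 4 * \<kappa>) * r powr \<beta>"
    by (simp add: algebra_simps)
  define L where "L = real n * (D * exp (\<beta> * \<theta>) ^ n)"
  have L: "L \<ge> 0" using D by (simp add: L_def)
  have "circle_int (\<lambda>y. (real n * \<Lambda> - 1 - n * \<eta>) * q y - L * (u (x, y) * q y)) \<le> circle_int (\<lambda>y. log_J_sum n y * q y)"
  proof (rule circle_int_mono)
    fix y
    have "log_J_sum n x - n * \<eta> - L * u (x, y) = (\<Sum>k<n. (M f ^^ k) log_J x - (\<eta> + D * (exp (\<beta> * \<theta>) ^ n * u (x, y))))"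
      by (simp add: log_J_sum_def sum_subtractf L_def algebra_simps)
    also have "\<dots> \<le> log_J_sum n y"
      unfolding log_J_sum_def by (intro sum_mono osc) simp
    finally have "real n * \<Lambda> - 1 - n * \<eta> - L * u (x, y) \<le> log_J_sum n y" using x by linarith
    then have "(real n * \<Lambda> - 1 - n * \<eta> - L * u (x, y)) * q y \<le> log_J_sum n y * q y"
      using qp[of y] by (intro mult_right_mono) auto
    then show "(real n * \<Lambda> - 1 - n * \<eta>) * q y - L * (u (x, y) * q y) \<le> log_J_sum n y * q y"
      by (simp add: algebra_simps)
  qed (intro continuous_intros qc uxc log_J_sum_cont)+
  also have "circle_int (\<lambda>y. (real n * \<Lambda> - 1 - n * \<eta>) * q y - L * (u (x, y) * q y)) =
      (real n * \<Lambda> - 1 - n * \<eta>) - L * circle_int (\<lambda>y. u (x, y) * q y)"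
    by (subst circle_int_diff) (auto intro!: continuous_intros qc uxc simp: circle_int_cmult q1)
  finally have "real n * \<Lambda> - 1 - n * \<eta> - L * circle_int (\<lambda>y. u (x, y) * q y) \<le> circle_int (\<lambda>y. log_J_sum n y * q y)" .
  moreover have "L * circle_int (\<lambda>y. u (x, y) * q y) \<le> n * \<eta>"
  proof -
    have "L * circle_int (\<lambda>y. u (x, y) * q y) \<le> L * ((C + 4 * \<kappa>) * r powr \<beta>)"
      using L ui by (rule mult_left_mono[rotated])
    also have "\<dots> = n * (E * (exp (\<beta> * \<theta>) ^ n * r powr \<beta>))" by (simp add: L_def E_def)
    also have "exp (\<beta> * \<theta>) ^ n * r powr \<beta> = exp (- \<beta> * \<eta>) ^ n"
      by (simp add: r_def powr_def algebra_simps flip: exp_of_nat_mult exp_add)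
    also have "n * (E * exp (- \<beta> * \<eta>) ^ n) \<le> n * \<eta>"
      using n by (intro mult_left_mono) auto
    finally show ?thesis .
  qed
  ultimately have lower: "real n * \<Lambda> - 1 - 2 * n * \<eta> \<le> circle_int (\<lambda>y. log_J_sum n y * q y)" by simp
  have lnr: "ln (8 / r) = ln 8 + n * (\<theta> + \<eta>)"
    by (simp add: r_def ln_div)
  let ?Q = "\<lambda>k. (transfer ^^ k) q"
  have Q: "continuous_on UNIV (?Q k)" "\<And>x. ?Q k x > 0" "circle_int (?Q k) = 1" for k
    using density_transfer_iter[OF q(1), of k] by (auto simp: density_fun_def)
  define qb where "qb x = (1 / n) * (\<Sum>k<n. ?Q k x)" for x
  have qb_int: "circle_int (\<lambda>x. \<phi> x * qb x) = (1 / n) * (\<Sum>k<n. circle_int (\<lambda>x. \<phi> x * ?Q k x))"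
    if "continuous_on UNIV \<phi>" for \<phi>
  proof -
    have "circle_int (\<lambda>x. \<phi> x * qb x) = circle_int (\<lambda>x. (1 / n) * (\<Sum>k<n. \<phi> x * ?Q k x))"
      by (simp add: qb_def sum_distrib_left mult_ac)
    then show ?thesis unfolding circle_int_cmult
      by (subst (asm) circle_int_sum) (auto intro!: continuous_intros that Q)
  qed
  show ?thesis
  proof
    show "density_fun qb"
      unfolding density_fun_def
    proof (intro conjI allI)
      show "continuous_on UNIV qb" unfolding qb_def by (intro continuous_intros Q)
      show "qb x > 0" for x
        unfolding qb_def using Q n(3) by (intro mult_pos_pos sum_pos) auto
      show "circle_int qb = 1" using qb_int[of "\<lambda>_. 1"] Q(3) n(3) by simp
    qed
    fix \<phi> :: "circle \<Rightarrow> real" and j :: nat and t :: real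
    assume \<phi>: "continuous_on UNIV \<phi>" "\<And>x. \<bar>\<phi> x\<bar> \<le> 1" and j: "j < N" and t: "0 \<le> t" "t \<le> 1"
    let ?S = "\<Sum>k<n. circle_int (\<lambda>x. \<phi> (f j x) * ?Q k x) - circle_int (\<lambda>x. \<phi> x * ?Q (Suc k) x)"
    have fc: "continuous_on UNIV (\<lambda>x. \<phi> (f j x))"
      by (rule continuous_on_compose2[OF \<phi>(1) f_cont[OF j]]) auto
    have "p j * t * ?S \<le> ln 8 + n * (\<theta> + \<eta>) + n * t\<^sup>2 - (real n * \<Lambda> - 1 - 2 * n * \<eta>)"
      using entropy_sum[OF q(1) \<phi> j t, of n] q(2) lower unfolding lnr by linarith
    also have "\<dots> = ln 8 + 1 + 5 * (n * \<eta>) + n * t\<^sup>2"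
      by (simp add: \<theta>_def algebra_simps)
    finally have S1: "p j * t * ?S \<le> ln 8 + 1 + 5 * (n * \<eta>) + n * t\<^sup>2" .
    have bound: "\<bar>circle_int (\<lambda>x. \<phi> x * ?Q k x)\<bar> \<le> 1" for k
    proof -
      have a: "- (?Q k x) \<le> \<phi> x * ?Q k x \<and> \<phi> x * ?Q k x \<le> ?Q k x" for x
      proof -
        have "\<bar>\<phi> x * ?Q k x\<bar> \<le> 1 * ?Q k x"
          unfolding abs_mult using \<phi>(2)[of x] Q(2)[of k x] by (intro mult_mono) auto
        then show ?thesis by (simp only: abs_le_iff) linarith
      qed
      have "circle_int (\<lambda>x. \<phi> x * ?Q k x) \<le> circle_int (?Q k)"
        using a by (intro circle_int_mono continuous_intros \<phi> Q) auto
      moreover have "circle_int (\<lambda>x. (-1) * ?Q k x) \<le> circle_int (\<lambda>x. \<phi> x * ?Q k x)"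
        using a by (intro circle_int_mono continuous_intros \<phi> Q) auto
      ultimately show ?thesis unfolding circle_int_cmult Q(3) by simp
    qed
    \<comment> \<open>\<open>entropy_sum\<close> compares the image of step \<open>k\<close> with
      step \<open>k + 1\<close>. Replacing the latter by step \<open>k\<close> costs this
      telescoping sum, bounded independently of \<open>n\<close>.\<close>
    have "(\<Sum>k<n. circle_int (\<lambda>x. \<phi> x * ?Q (Suc k) x) - circle_int (\<lambda>x. \<phi> x * ?Q k x))
        = circle_int (\<lambda>x. \<phi> x * ?Q n x) - circle_int (\<lambda>x. \<phi> x * ?Q 0 x)"
      by (rule sum_lessThan_telescope)
    also have "\<dots> \<le> 2" using bound[of n] bound[of 0] by linarith
    finally have S2: "(\<Sum>k<n. circle_int (\<lambda>x. \<phi> x * ?Q (Suc k) x) - circle_int (\<lambda>x. \<phi> x * ?Q k x)) \<le> 2"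
      (is "?S2 \<le> 2") .
    have "p j * t \<le> 1 * 1" using p_le_1[OF j] p_pos[OF j] t by (intro mult_mono) auto
    then have "p j * t * 2 \<le> 2" by simp
    moreover have "p j * t * ?S2 \<le> p j * t * 2"
      using S2 t p_pos[OF j] by (intro mult_left_mono) auto
    ultimately have S3: "p j * t * ?S2 \<le> 2" by (rule order_trans[rotated])
    have split: "circle_int (\<lambda>x. (\<phi> (f j x) - \<phi> x) * ?Q k x)
        = circle_int (\<lambda>x. \<phi> (f j x) * ?Q k x) - circle_int (\<lambda>x. \<phi> x * ?Q k x)" for k
      unfolding left_diff_distrib by (intro circle_int_diff continuous_intros fc \<phi> Q)
    have "circle_int (\<lambda>x. (\<phi> (f j x) - \<phi> x) * qb x)
        = (1 / n) * (\<Sum>k<n. circle_int (\<lambda>x. (\<phi> (f j x) - \<phi> x) * ?Q k x))"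
      by (intro qb_int continuous_intros fc \<phi>)
    also have "(\<Sum>k<n. circle_int (\<lambda>x. (\<phi> (f j x) - \<phi> x) * ?Q k x)) = ?S + ?S2"
      unfolding sum.distrib[symmetric] split by (intro sum.cong) auto
    finally have "circle_int (\<lambda>x. (\<phi> (f j x) - \<phi> x) * qb x) = (1 / n) * (?S + ?S2)" .
    then have "n * (p j * t * circle_int (\<lambda>x. (\<phi> (f j x) - \<phi> x) * qb x)) = p j * t * (?S + ?S2)"
      using n(3) by simp
    also have "\<dots> = p j * t * ?S + p j * t * ?S2" by (rule distrib_left)
    also have "\<dots> \<le> ln 8 + 3 + 5 * (n * \<eta>) + n * t\<^sup>2"
      using S1 S3 by linarith
    also have "\<dots> \<le> 6 * (n * \<eta>) + n * t\<^sup>2" using n' by linarith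
    also have "\<dots> = n * (\<epsilon> + t\<^sup>2)" by (simp add: \<eta>_def algebra_simps)
    finally show "p j * t * circle_int (\<lambda>x. (\<phi> (f j x) - \<phi> x) * qb x) \<le> \<epsilon> + t\<^sup>2"
      using n(3) by simp
  qed
qed

end

section \<open>Negativity of the Lyapunov exponent and global contraction\<close>

text \<open>Unlike in \<open>holder_continuous\<close> the exponent is a parameter, because the
  contraction is available for one fixed small \<beta> at a time.\<close>

definition holder :: "real \<Rightarrow> ('a::metric_space \<Rightarrow> real) \<Rightarrow> bool" where
  "holder \<beta> \<phi> \<longleftrightarrow> (\<exists>L\<ge>0. \<forall>x y. \<bar>\<phi> x - \<phi> y\<bar> \<le> L * dist x y powr \<beta>)"

lemma holderI:
  assumes "\<And>x y. \<bar>\<phi> x - \<phi> y\<bar> \<le> L * dist x y powr \<beta>"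
  shows "holder \<beta> \<phi>"
proof -
  have "\<bar>\<phi> x - \<phi> y\<bar> \<le> \<bar>L\<bar> * dist x y powr \<beta>" for x y
    by (rule order_trans[OF assms]) (auto intro: mult_right_mono)
  then show ?thesis unfolding holder_def by (intro exI[of _ "\<bar>L\<bar>"]) auto
qed

lemma holder_continuous_on:
  assumes "holder \<beta> \<phi>" "\<beta> > 0" shows "continuous_on S \<phi>"
proof (rule continuous_at_imp_continuous_on, intro ballI)
  fix x
  obtain L where L: "\<And>x y. \<bar>\<phi> x - \<phi> y\<bar> \<le> L * dist x y powr \<beta>"
    using assms(1) by (auto simp: holder_def)
  have "((\<lambda>y. \<phi> y - \<phi> x) \<longlongrightarrow> 0) (at x)"
  proof (rule Lim_null_comparison)
    show "\<forall>\<^sub>F y in at x. norm (\<phi> y - \<phi> x) \<le> L * dist y x powr \<beta>" using L by simp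
    have "((\<lambda>y. L * dist y x powr \<beta>) \<longlongrightarrow> L * dist x x powr \<beta>) (at x)"
      using assms(2) by (intro tendsto_intros tendsto_powr') auto
    then show "((\<lambda>y. L * dist y x powr \<beta>) \<longlongrightarrow> 0) (at x)" using assms(2) by simp
  qed
  then show "isCont \<phi> x" by (simp add: isCont_def LIM_zero_cancel)
qed

section \<open>Probability measures and weak limits on the circle\<close>

lemma abs_infdist_diff_le:
  fixes C :: "'a::metric_space set"
  shows "\<bar>infdist x C - infdist y C\<bar> \<le> dist x y"
  using infdist_triangle[of x C y] infdist_triangle[of y C x] by (simp add: dist_commute abs_le_iff)

lemma borel_eq_sigma_closed: "sets borel = sigma_sets UNIV (Collect closed)"
proof (rule antisym)
  have "open S \<Longrightarrow> S \<in> sigma_sets UNIV (Collect closed)" for S :: "'a set"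
    using sigma_sets.Compl[of "- S" UNIV "Collect closed"] by (auto simp: closed_Compl double_diff Compl_eq_Diff_UNIV)
  then have "sigma_sets UNIV {S :: 'a set. open S} \<subseteq> sigma_sets UNIV (Collect closed)"
    by (intro sigma_sets_mono) auto
  then show "sets borel \<subseteq> sigma_sets UNIV (Collect closed :: 'a set set)"
    by (simp add: borel_def)
  have closed_borel: "Collect closed \<subseteq> sets (borel :: 'a measure)" by auto
  show "sigma_sets UNIV (Collect closed :: 'a set set) \<subseteq> sets borel"
    using sets.sigma_sets_subset[of "Collect closed" "borel :: 'a measure"] closed_borel by simp
qed

text \<open>Lipschitz functions of the distance to a closed set decrease to its indicator, and
  closed sets form an intersection-stable generator of the Borel sets.\<close>

lemma borel_prob_eqI:
  fixes m1 m2 :: "'a::metric_space measure"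
  assumes m: "borel_prob m1" "borel_prob m2"
    and eq: "\<And>\<phi> L. (\<And>x y. \<bar>\<phi> x - \<phi> y\<bar> \<le> L * dist x y) \<Longrightarrow> (\<And>x. 0 \<le> \<phi> x \<and> \<phi> x \<le> 1) \<Longrightarrow>
      (\<integral>x. \<phi> x \<partial>m1) = (\<integral>x. \<phi> x \<partial>m2)"
  shows "m1 = m2"
proof -
  have lim: "(\<lambda>n. \<integral>x. max 0 (1 - real n * infdist x C) \<partial>m) \<longlonglongrightarrow> measure m C"
    if "borel_prob m" "closed C" "C \<noteq> {}" for m :: "'a measure" and C
  proof -
    interpret prob_space m using that by (simp add: borel_prob_def)
    have [measurable_cong]: "sets m = sets borel" using that by (simp add: borel_prob_def)
    have [measurable]: "C \<in> sets borel" using that by simp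
    have [measurable]: "(\<lambda>x. infdist x C) \<in> borel_measurable borel"
      by (intro borel_measurable_continuous_onI continuous_intros)
    have "(\<lambda>n. \<integral>x. max 0 (1 - real n * infdist x C) \<partial>m) \<longlonglongrightarrow> (\<integral>x. indicator C x \<partial>m)"
    proof (rule integral_dominated_convergence[where w = "\<lambda>_. 1"])
      show "AE x in m. (\<lambda>n. max 0 (1 - real n * infdist x C)) \<longlonglongrightarrow> indicator C x"
      proof (rule AE_I2)
        fix x
        show "(\<lambda>n. max 0 (1 - real n * infdist x C)) \<longlonglongrightarrow> indicator C x"
        proof (cases "x \<in> C")
          case False
          then have d: "infdist x C > 0"
            using that infdist_nonneg[of x C] in_closed_iff_infdist_zero[of C x] by (metis less_le)
          have "eventually (\<lambda>n. max 0 (1 - real n * infdist x C) = 0) sequentially"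
            using eventually_ge_at_top[of "nat \<lceil>1 / infdist x C\<rceil>"]
          proof eventually_elim
            case (elim n)
            then have "1 / infdist x C \<le> real n" by linarith
            then show ?case using d by (simp add: field_simps)
          qed
          then show ?thesis using False by (simp add: tendsto_eventually)
        qed simp
      qed
    qed (auto simp: infdist_nonneg)
    then show ?thesis by (simp add: sets_eq_imp_space_eq[OF \<open>sets m = sets borel\<close>])
  qed
  have closed: "measure m1 C = measure m2 C" if "closed C" for C
  \<comment> \<open>The distance to the empty set is 0 by convention, so the approximation would
    converge to the wrong function there.\<close>
  proof (cases "C = {}")
    case False
    have "(\<integral>x. max 0 (1 - real n * infdist x C) \<partial>m1) = (\<integral>x. max 0 (1 - real n * infdist x C) \<partial>m2)" for n
    proof (rule eq[where L = "real n"])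
      fix x y
      have "\<bar>max 0 (1 - real n * infdist x C) - max 0 (1 - real n * infdist y C)\<bar>
          \<le> \<bar>real n * (infdist x C - infdist y C)\<bar>"
        by (auto simp: max_def right_diff_distrib)
      also have "\<dots> \<le> real n * dist x y"
        by (simp add: abs_mult mult_left_mono abs_infdist_diff_le)
      finally show "\<bar>max 0 (1 - real n * infdist x C) - max 0 (1 - real n * infdist y C)\<bar> \<le> real n * dist x y" .
    qed (auto simp: infdist_nonneg)
    then show ?thesis using lim[OF m(1) that False] lim[OF m(2) that False] LIMSEQ_unique by auto
  qed simp
  interpret m1: prob_space m1 using m by (simp add: borel_prob_def)
  interpret m2: prob_space m2 using m by (simp add: borel_prob_def)
  show ?thesis
  proof (rule measure_eqI_generator_eq[where E = "Collect closed" and \<Omega> = UNIV and A = "\<lambda>_. UNIV"])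
    show "Int_stable (Collect closed :: 'a set set)" by (auto simp: Int_stable_def)
    show "sets m1 = sigma_sets UNIV (Collect closed)" "sets m2 = sigma_sets UNIV (Collect closed)"
      using m borel_eq_sigma_closed by (auto simp: borel_prob_def)
  qed (auto simp: m1.emeasure_eq_measure m2.emeasure_eq_measure closed)
qed

text \<open>Spread the densities over the interval from 0 to 1, where they are tight on the line,
  take a weak limit there and project it. Continuous functions on the circle lift to bounded
  continuous functions, and mass at the two endpoints is identified by the projection.\<close>

lemma circle_prob_compactness:
  assumes q: "\<And>n. density_fun (q n)"
  obtains r :: "nat \<Rightarrow> nat" and \<nu> where "strict_mono r" "borel_prob \<nu>"
    "\<And>\<phi>. continuous_on UNIV \<phi> \<Longrightarrow> (\<lambda>n. circle_int (\<lambda>x. \<phi> x * q (r n) x)) \<longlonglongrightarrow> (\<integral>x. \<phi> x \<partial>\<nu>)"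
proof -
  define h where "h n t = indicator {0..1} t * q n (circle_proj t)" for n and t :: real
  define \<mu> where "\<mu> n = density lborel (\<lambda>t. ennreal (h n t))" for n
  have qc: "continuous_on UNIV (q n)" and qp: "q n x > 0" and q1: "circle_int (q n) = 1" for n x
    using q[of n] by (auto simp: density_fun_def)
  have meas: "(\<lambda>t. \<phi> (circle_proj t)) \<in> borel_measurable borel" if "continuous_on UNIV \<phi>"
    for \<phi> :: "circle \<Rightarrow> real"
    by (intro borel_measurable_continuous_onI continuous_on_comp_proj that)
  have [measurable]: "h n \<in> borel_measurable borel" for n
    unfolding h_def using meas[OF qc[of n]] by measurable
  have h0: "h n t \<ge> 0" for n t using qp[of n "circle_proj t"] by (simp add: h_def less_imp_le)
  have int: "integrable lborel (\<lambda>t. h n t * \<phi> (circle_proj t))"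
    "(\<integral>t. h n t * \<phi> (circle_proj t) \<partial>lborel) = circle_int (\<lambda>x. \<phi> x * q n x)"
    if "continuous_on UNIV \<phi>" for \<phi> n
  proof -
    have S: "set_integrable lborel {0..1} (\<lambda>t. \<phi> (circle_proj t) * q n (circle_proj t))"
      by (intro borel_integrable_atLeastAtMost' continuous_intros continuous_on_comp_proj that qc)
    then show "integrable lborel (\<lambda>t. h n t * \<phi> (circle_proj t))"
      by (simp add: set_integrable_def h_def mult_ac)
    from set_borel_integral_eq_integral(2)[OF S]
    show "(\<integral>t. h n t * \<phi> (circle_proj t) \<partial>lborel) = circle_int (\<lambda>x. \<phi> x * q n x)"
      by (simp add: set_lebesgue_integral_def h_def circle_int_def mult_ac)
  qed
  have em: "emeasure (\<mu> n) UNIV = 1" for n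
  proof -
    have "emeasure (\<mu> n) UNIV = (\<integral>\<^sup>+t. ennreal (h n t) \<partial>lborel)"
      unfolding \<mu>_def by (subst emeasure_density) auto
    also have "\<dots> = ennreal (\<integral>t. h n t \<partial>lborel)"
      using int(1)[of "\<lambda>_. 1" n] h0 by (intro nn_integral_eq_integral) auto
    also have "\<dots> = 1" using int(2)[of "\<lambda>_. 1" n] q1 by simp
    finally show ?thesis .
  qed
  have real: "real_distribution (\<mu> n)" for n
  proof -
    have "prob_space (\<mu> n)" by (rule prob_spaceI) (simp add: \<mu>_def em[unfolded \<mu>_def])
    then show ?thesis by (auto simp: real_distribution_def real_distribution_axioms_def \<mu>_def)
  qed
  \<comment> \<open>\<open>tight\<close> uses intervals open on the left; starting at -1 covers the
    whole support including 0.\<close>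
  have "measure (\<mu> n) {-1<..1} = 1" for n
  proof -
    have "emeasure (\<mu> n) {-1<..1} = (\<integral>\<^sup>+t. ennreal (h n t) * indicator {-1<..1} t \<partial>lborel)"
      unfolding \<mu>_def by (subst emeasure_density) auto
    also have "\<dots> = (\<integral>\<^sup>+t. ennreal (h n t) * indicator UNIV t \<partial>lborel)"
      by (intro nn_integral_cong) (auto simp: h_def indicator_def)
    also have "\<dots> = emeasure (\<mu> n) UNIV"
      unfolding \<mu>_def by (subst emeasure_density) auto
    finally show ?thesis by (simp add: em measure_def)
  qed
  then have "tight \<mu>" unfolding tight_def
    using real by (intro conjI allI impI exI[of _ "-1"] exI[of _ 1]) auto
  from tight_imp_convergent_subsubsequence[OF this strict_mono_id]
  obtain r M where r: "strict_mono r" and M: "real_distribution M" "weak_conv_m (\<mu> \<circ> r) M"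
    by auto
  interpret M: real_distribution M by fact
  have [measurable]: "circle_proj \<in> borel_measurable M"
    using borel_measurable_continuous_onI[OF continuous_on_circle_proj] by (simp add: measurable_cong_sets[OF M.events_eq_borel refl])
  define \<nu> where "\<nu> = distr M borel circle_proj"
  show ?thesis
  proof (rule that[OF r, of \<nu>])
    show "borel_prob \<nu>" unfolding borel_prob_def \<nu>_def by (auto intro: M.prob_space_distr)
    fix \<phi> :: "circle \<Rightarrow> real" assume \<phi>: "continuous_on UNIV \<phi>"
    obtain B where B: "\<And>x. \<bar>\<phi> x\<bar> \<le> B" using circle_bounded[OF \<phi>] by blast
    have "(\<lambda>n. \<integral>t. \<phi> (circle_proj t) \<partial>((\<mu> \<circ> r) n)) \<longlonglongrightarrow> (\<integral>t. \<phi> (circle_proj t) \<partial>M)"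
    proof (rule weak_conv_imp_integral_bdd_continuous_conv[OF _ M])
      show "real_distribution ((\<mu> \<circ> r) n)" for n using real by simp
      show "isCont (\<lambda>t. \<phi> (circle_proj t)) t" for t
        using continuous_on_comp_proj[OF \<phi>, of UNIV] by (simp add: continuous_on_eq_continuous_at)
      show "norm (\<phi> (circle_proj t)) \<le> B" for t using B by simp
    qed
    moreover have "(\<integral>t. \<phi> (circle_proj t) \<partial>((\<mu> \<circ> r) n)) = circle_int (\<lambda>x. \<phi> x * q (r n) x)" for n
      unfolding o_def \<mu>_def
      using int(2)[OF \<phi>, of "r n"] h0 meas[OF \<phi>] by (subst integral_density) auto
    moreover have "(\<integral>t. \<phi> (circle_proj t) \<partial>M) = (\<integral>x. \<phi> x \<partial>\<nu>)"
      unfolding \<nu>_def by (subst integral_distr) (auto intro: borel_measurable_continuous_onI \<phi>)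
    ultimately show "(\<lambda>n. circle_int (\<lambda>x. \<phi> x * q (r n) x)) \<longlonglongrightarrow> (\<integral>x. \<phi> x \<partial>\<nu>)" by simp
  qed
qed

lemma borel_prob_integrable:
  assumes "borel_prob m" "\<phi> \<in> borel_measurable borel" "\<And>x. \<bar>\<phi> x\<bar> \<le> (B::real)"
  shows "integrable m \<phi>"
proof -
  interpret prob_space m using assms by (simp add: borel_prob_def)
  have [measurable_cong]: "sets m = sets borel" using assms by (simp add: borel_prob_def)
  show ?thesis using assms by (intro integrable_const_bound[where B = B]) auto
qed

section \<open>Excluding a nonnegative exponent; contraction at all distances\<close>

context circle_ifs
begin

lemma f_measurable [measurable]: "i < N \<Longrightarrow> f i \<in> borel_measurable borel"
  by (rule borel_measurable_continuous_onI[OF f_cont])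

lemma borel_prob_distr:
  assumes "borel_prob m" "i < N" shows "borel_prob (distr m borel (f i))"
proof -
  interpret prob_space m using assms by (simp add: borel_prob_def)
  have [measurable_cong]: "sets m = sets borel" using assms by (simp add: borel_prob_def)
  show ?thesis using assms(2) by (auto simp: borel_prob_def intro!: prob_space_distr)
qed

text \<open>If no maximum \<open>S m\<close> is negative, almost invariant densities with errors 1 /
  (l + 1) exist and a weak limit of them is invariant under every map, against the
  hypothesis.\<close>

lemma negative_exponent:
  assumes "\<not> (\<exists>m. borel_prob m \<and> (\<forall>i<N. distr m borel (f i) = m))"
  obtains m \<eta> where "m > 0" "\<eta> > 0" "\<And>x. log_J_sum m x \<le> real m * (- \<eta>)"
proof -
  have sup: "\<exists>x. \<forall>y. log_J_sum m y \<le> log_J_sum m x" for m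
    using continuous_attains_sup[OF compact_circle _ log_J_sum_cont[of m]] by auto
  define S where "S m = Sup (range (log_J_sum m))" for m
  have S: "log_J_sum m x \<le> S m" for m x
  proof -
    obtain B where "\<And>x. \<bar>log_J_sum m x\<bar> \<le> B" using circle_bounded[OF log_J_sum_cont[of m]] by blast
    then show ?thesis unfolding S_def by (intro cSup_upper) (auto intro!: bdd_aboveI simp: abs_le_iff)
  qed
  have S_att: "\<exists>x. log_J_sum m x = S m" for m
  proof -
    obtain x where "\<And>y. log_J_sum m y \<le> log_J_sum m x" using sup by blast
    then have "S m = log_J_sum m x" unfolding S_def by (intro cSup_eq_maximum) auto
    then show ?thesis by metis
  qed
  show ?thesis
  proof (cases "\<exists>m>0. S m < 0")
    case True
    then obtain m where m: "m > 0" "S m < 0" by blast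
    show ?thesis
    proof (rule that[of m "- S m / m"])
      fix x show "log_J_sum m x \<le> real m * (- (- S m / m))" using S[of m x] m by simp
    qed (use m in \<open>simp_all add: field_simps\<close>)
  next
    case False
    have S0: "S m \<ge> 0" if "m > 0" for m
    proof (rule leI)
      show "\<not> S m < 0" using False that by blast
    qed
    \<comment> \<open>The infimum delivers both requirements of
      \<open>almost_invariant_density\<close>: \<open>S n\<close> is at least n \<Lambda> for every
      \<open>n\<close>, and for each \<theta> above \<Lambda> some \<open>m\<close> has
      \<open>S m\<close> at most m \<theta>.\<close>
    define \<Lambda> where "\<Lambda> = Inf ((\<lambda>m. S m / real m) ` {0<..})"
    have bdd: "bdd_below ((\<lambda>m. S m / real m) ` {0<..})"
      using S0 by (auto intro!: bdd_belowI[of _ 0])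
    have L0: "\<Lambda> \<ge> 0" unfolding \<Lambda>_def using S0 by (intro cInf_greatest) auto
    have L1: "\<exists>x. log_J_sum n x \<ge> real n * \<Lambda> - 1" for n
    proof (cases "n = 0")
      case False
      obtain x where x: "log_J_sum n x = S n" using S_att by blast
      have "\<Lambda> \<le> S n / n" unfolding \<Lambda>_def using False bdd by (intro cInf_lower) auto
      then have "real n * \<Lambda> \<le> S n" using False by (simp add: field_simps)
      then show ?thesis using x by (intro exI[of _ x]) simp
    qed (simp add: log_J_sum_def)
    have L2: "\<exists>m>0. \<forall>x. log_J_sum m x \<le> real m * \<theta>" if "\<theta> > \<Lambda>" for \<theta>
    proof -
      have "\<exists>a\<in>(\<lambda>m. S m / real m) ` {0<..}. a < \<theta>"
        using that unfolding \<Lambda>_def by (intro cInf_lessD) auto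
      then obtain m where m: "m > 0" "S m / real m < \<theta>" by auto
      then have "S m \<le> real m * \<theta>" by (simp add: field_simps)
      then have "\<forall>x. log_J_sum m x \<le> real m * \<theta>" using S order_trans by blast
      with m(1) show ?thesis by blast
    qed
    define R where "R q l \<longleftrightarrow> density_fun q \<and>
      (\<forall>\<phi> j t. continuous_on UNIV \<phi> \<longrightarrow> (\<forall>x. \<bar>\<phi> x\<bar> \<le> 1) \<longrightarrow> j < N \<longrightarrow> 0 \<le> t \<longrightarrow> t \<le> 1 \<longrightarrow>
        p j * t * circle_int (\<lambda>x. (\<phi> (f j x) - \<phi> x) * q x) \<le> 1 / real (Suc l) + t\<^sup>2)"
      for q :: "circle \<Rightarrow> real" and l :: nat
    have "\<exists>q. R q l" for l
    proof (rule almost_invariant_density[OF L0 L1 L2])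
      show "1 / real (Suc l) > 0" by simp
      fix q assume q: "density_fun q"
        "\<And>\<phi> j t. continuous_on UNIV \<phi> \<Longrightarrow> (\<And>x. \<bar>\<phi> x\<bar> \<le> 1) \<Longrightarrow> j < N \<Longrightarrow> 0 \<le> t \<Longrightarrow> t \<le> 1 \<Longrightarrow>
          p j * t * circle_int (\<lambda>x. (\<phi> (f j x) - \<phi> x) * q x) \<le> 1 / real (Suc l) + t\<^sup>2"
      show ?thesis
        unfolding R_def by (intro exI[of _ q] conjI allI impI q) auto
    qed
    then obtain q where "\<And>l. R (q l) l" by metis
    then have q: "\<And>l. density_fun (q l)"
      "\<And>l \<phi> j t. continuous_on UNIV \<phi> \<Longrightarrow> (\<And>x. \<bar>\<phi> x\<bar> \<le> 1) \<Longrightarrow> j < N \<Longrightarrow> 0 \<le> t \<Longrightarrow> t \<le> 1 \<Longrightarrow>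
        p j * t * circle_int (\<lambda>x. (\<phi> (f j x) - \<phi> x) * q l x) \<le> 1 / real (Suc l) + t\<^sup>2"
      unfolding R_def by blast+
    obtain r :: "nat \<Rightarrow> nat" and \<nu> where r: "strict_mono r" and \<nu>: "borel_prob \<nu>"
      and lim: "\<And>\<phi>. continuous_on UNIV \<phi> \<Longrightarrow> (\<lambda>n. circle_int (\<lambda>x. \<phi> x * q (r n) x)) \<longlonglongrightarrow> (\<integral>x. \<phi> x \<partial>\<nu>)"
      by (rule circle_prob_compactness[of q, OF q(1)]) (rule that)
    have le: "(\<integral>x. \<phi> (f j x) - \<phi> x \<partial>\<nu>) \<le> 0"
      if \<phi>: "continuous_on UNIV \<phi>" "\<And>x. \<bar>\<phi> x\<bar> \<le> 1" and j: "j < N" for \<phi> :: "circle \<Rightarrow> real" and j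
    proof -
      have fc: "continuous_on UNIV (\<lambda>x. \<phi> (f j x) - \<phi> x)"
        by (intro continuous_intros \<phi> continuous_on_compose2[OF \<phi>(1) f_cont[OF j]]) auto
      \<comment> \<open>In the limit the error 1 / (l + 1) is gone, and dividing p_j t I \<le> t^2
        by \<open>t\<close> bounds p_j I by every positive \<open>t\<close>.\<close>
      have bound: "p j * (\<integral>x. \<phi> (f j x) - \<phi> x \<partial>\<nu>) \<le> t" if t: "0 < t" "t \<le> 1" for t
      proof -
        have "(\<lambda>n. p j * t * circle_int (\<lambda>x. (\<phi> (f j x) - \<phi> x) * q (r n) x)) \<longlonglongrightarrow>
            p j * t * (\<integral>x. \<phi> (f j x) - \<phi> x \<partial>\<nu>)"
          by (intro tendsto_intros lim fc)
        moreover have "(\<lambda>n. 1 / real (Suc (r n)) + t\<^sup>2) \<longlonglongrightarrow> 0 + t\<^sup>2"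
          using LIMSEQ_subseq_LIMSEQ[OF LIMSEQ_inverse_real_of_nat r]
          by (intro tendsto_intros) (simp add: o_def inverse_eq_divide)
        ultimately have "p j * t * (\<integral>x. \<phi> (f j x) - \<phi> x \<partial>\<nu>) \<le> 0 + t\<^sup>2"
          by (rule LIMSEQ_le) (use q(2)[OF \<phi> j] t in auto)
        then have "t * (p j * (\<integral>x. \<phi> (f j x) - \<phi> x \<partial>\<nu>)) \<le> t * t"
          by (simp add: power2_eq_square mult_ac)
        then show ?thesis using t by simp
      qed
      have "p j * (\<integral>x. \<phi> (f j x) - \<phi> x \<partial>\<nu>) \<le> 0"
      proof (rule field_le_epsilon)
        fix e :: real assume "0 < e"
        then show "p j * (\<integral>x. \<phi> (f j x) - \<phi> x \<partial>\<nu>) \<le> 0 + e" using bound[of "min e 1"] by simp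
      qed
      then show ?thesis using p_pos[OF j] by (simp add: mult_le_0_iff)
    qed
    have "distr \<nu> borel (f j) = \<nu>" if j: "j < N" for j
    proof (rule borel_prob_eqI[OF borel_prob_distr[OF \<nu> j] \<nu>])
      fix \<phi> :: "circle \<Rightarrow> real" and L
      assume L: "\<And>x y. \<bar>\<phi> x - \<phi> y\<bar> \<le> L * dist x y" and \<phi>01: "\<And>x. 0 \<le> \<phi> x \<and> \<phi> x \<le> 1"
      have \<phi>: "continuous_on UNIV \<phi>"
        using holderI[of \<phi> L 1] L by (intro holder_continuous_on[of 1]) simp_all
      have [measurable_cong]: "sets \<nu> = sets borel" using \<nu> by (simp add: borel_prob_def)
      have m\<phi>[measurable]: "\<phi> \<in> borel_measurable borel" by (rule borel_measurable_continuous_onI[OF \<phi>])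
      have [measurable]: "f j \<in> borel_measurable borel" using j by simp
      have i1: "integrable \<nu> \<phi>" "integrable \<nu> (\<lambda>x. \<phi> (f j x))"
        by (rule borel_prob_integrable[OF \<nu>, where B = 1]; use \<phi>01 in \<open>simp add: abs_le_iff order_trans[of _ 0]\<close>)+
      have "(\<integral>x. \<phi> (f j x) - \<phi> x \<partial>\<nu>) \<le> 0"
        using \<phi>01 by (intro le \<phi> j) (auto simp: abs_le_iff intro: order_trans[of _ 0])
      \<comment> \<open>The one-sided bound for the negated test function turns the inequality into
        equality.\<close>
      moreover have "(\<integral>x. - \<phi> (f j x) - - \<phi> x \<partial>\<nu>) \<le> 0"
        using \<phi>01 by (intro le continuous_intros \<phi> j) (auto simp: abs_le_iff intro: order_trans[of _ 0])
      ultimately have "(\<integral>x. \<phi> (f j x) \<partial>\<nu>) = (\<integral>x. \<phi> x \<partial>\<nu>)"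
        using i1 by simp
      then show "(\<integral>x. \<phi> x \<partial>distr \<nu> borel (f j)) = (\<integral>x. \<phi> x \<partial>\<nu>)"
        by (subst integral_distr) auto
    qed
    then show ?thesis using assms \<nu> by blast
  qed
qed

lemma rand_iter_pair_maps:
  "rand_iter (pair_maps h) \<omega> n (x, y) = (rand_iter h \<omega> n x, rand_iter h \<omega> n y)"
  by (induction n) auto

text \<open>The Lyapunov function contracts in one step except where it is truncated. There
  proximality makes some iterate drop strictly below the maximum, and compactness makes the time and
  the drop uniform.\<close>

lemma global_contraction:
  assumes "proximal N f" and "m > 0" "\<eta> > 0" "\<And>x. log_J_sum m x \<le> real m * (- \<eta>)" and "0 < \<alpha>"
  obtains \<beta> C k where "0 < \<beta>" "\<beta> \<le> \<alpha>" "0 < C" "0 < k" "k < 1"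
    "\<And>n x y. (M (pair_maps f) ^^ n) (\<lambda>z. dist (fst z) (snd z) powr \<beta>) (x, y) \<le> C * k ^ n * dist x y powr \<beta>"
proof -
  let ?M2 = "M (pair_maps f)"
  have th: "- \<eta> < - \<eta> / 2" using assms(3) by simp
  obtain \<beta>0 where b0: "\<beta>0 > 0"
    "\<And>\<beta>. 0 < \<beta> \<Longrightarrow> \<beta> \<le> \<beta>0 \<Longrightarrow> \<exists>u \<kappa> c C. local_lyapunov \<beta> (- \<eta> / 2) u \<kappa> c C"
    using local_growth[OF assms(2,4) th] by blast
  \<comment> \<open>The second bound lets the caller prescribe the Hoelder exponent of the functions
    to be treated.\<close>
  define \<beta> where "\<beta> = min \<beta>0 \<alpha>"
  have \<beta>: "0 < \<beta>" "\<beta> \<le> \<beta>0" "\<beta> \<le> \<alpha>" using b0(1) assms(5) by (auto simp: \<beta>_def)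
  obtain u \<kappa> c C where "local_lyapunov \<beta> (- \<eta> / 2) u \<kappa> c C"
    using b0(2)[OF \<beta>(1,2)] by blast
  note u = local_lyapunovD[OF this]
  define l where "l = exp (\<beta> * (- \<eta> / 2))"
  have l: "0 < l" "l < 1" using \<beta> assms(3) by (auto simp: l_def)
  define v where "v z = (1 / \<kappa>) * u z" for z
  have v01: "0 \<le> v z" "v z \<le> 1" for z using u(1) u(5)[of z] u(6)[of z] by (auto simp: v_def)
  have v1: "?M2 v z \<le> l * v z" if "v z < 1" for z
  proof -
    have "u z < \<kappa>" using that u(1) by (simp add: v_def field_simps)
    then have "?M2 u z \<le> l * u z" using u(7) by (simp add: l_def)
    then have "(1 / \<kappa>) * ?M2 u z \<le> (1 / \<kappa>) * (l * u z)" using u(1) by (intro mult_left_mono) auto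
    then show ?thesis unfolding v_def M_cmult by (simp add: mult_ac)
  qed
  \<comment> \<open>At truncated points this holds because 1 is the maximum of \<open>v\<close>. It
    makes the iterates decrease in time, so a drop once reached persists.\<close>
  have v2: "?M2 v z \<le> v z" for z
  proof (cases "v z < 1")
    case True
    then show ?thesis using v1[OF True] l v01(1)[of z] mult_right_mono[of l 1 "v z"] by linarith
  next
    case False
    then have "v z = 1" using v01(2)[of z] by simp
    then show ?thesis using M_mono[of v "\<lambda>_. 1" "pair_maps f" z] v01(2) by simp
  qed
  have dec1: "(?M2 ^^ Suc n) v z \<le> (?M2 ^^ n) v z" for n z
    unfolding funpow_Suc_right o_def by (rule M_iter_mono) (rule v2)
  have dec: "n \<le> n' \<Longrightarrow> (?M2 ^^ n') v z \<le> (?M2 ^^ n) v z" for n n' z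
    by (induction n' rule: dec_induct) (use dec1 order_trans in blast)+
  have vc: "continuous_on UNIV v" unfolding v_def by (intro continuous_intros u(4))
  have pc: "continuous_on UNIV (pair_maps f i)" if "i < N" for i
    unfolding map_prod_def case_prod_beta
    by (intro continuous_intros continuous_on_compose2[OF f_cont[OF that]]) auto
  have Mc: "continuous_on UNIV ((?M2 ^^ n) v)" for n by (intro M_iter_continuous pc vc)
  \<comment> \<open>Along the proximal word the distance becomes small at some time, hence
    \<open>u\<close> falls below \<kappa>; the averaged iterate at that time is then below
    1.\<close>
  have reach: "\<exists>n. (?M2 ^^ n) v z < 1" for z
  proof -
    obtain x y where z: "z = (x, y)" by (cases z)
    obtain \<omega> r where w: "\<And>n. \<omega> n < N"
      "(\<lambda>k. dist (rand_iter f \<omega> (r k) x) (rand_iter f \<omega> (r k) y)) \<longlonglongrightarrow> 0"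
      using assms(1) unfolding proximal_def by metis
    have "(\<lambda>k. C * dist (rand_iter f \<omega> (r k) x) (rand_iter f \<omega> (r k) y) powr \<beta>) \<longlonglongrightarrow> C * 0 powr \<beta>"
      using \<beta> by (intro tendsto_mult tendsto_const tendsto_powr' w(2)) auto
    then have "eventually (\<lambda>k. C * dist (rand_iter f \<omega> (r k) x) (rand_iter f \<omega> (r k) y) powr \<beta> < \<kappa>) sequentially"
      using u(1) \<beta> by (intro order_tendstoD(2)) auto
    from eventually_happens'[OF sequentially_bot this]
    obtain k where "C * dist (rand_iter f \<omega> (r k) x) (rand_iter f \<omega> (r k) y) powr \<beta> < \<kappa>" by blast
    then have "u (rand_iter (pair_maps f) \<omega> (r k) z) < \<kappa>"
      unfolding z rand_iter_pair_maps using u(9) le_less_trans by blast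
    then have "v (rand_iter (pair_maps f) \<omega> (r k) z) < 1" using u(1) by (simp add: v_def field_simps)
    then have "(?M2 ^^ r k) v z < 1" by (intro M_iter_less_1[where \<omega> = \<omega>] v01 w)
    then show ?thesis ..
  qed
  obtain n where n: "\<And>z. (?M2 ^^ n) v z < 1" "n > 0"
  proof -
    let ?A = "\<lambda>n. {z. (?M2 ^^ n) v z < 1}"
    have "compact (UNIV :: (circle \<times> circle) set)"
      using compact_Times[OF compact_circle compact_circle] by simp
    moreover have "open (?A n)" for n
      by (intro open_Collect_less Mc continuous_intros)
    moreover have "UNIV \<subseteq> (\<Union>n\<in>UNIV. ?A n)" using reach by auto
    ultimately obtain F where F: "finite F" "UNIV \<subseteq> (\<Union>n\<in>F. ?A n)"
      by (elim compactE_image) auto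
    \<comment> \<open>The successor makes the common time positive, as the contraction of
      untruncated points and the root below require.\<close>
    have "(?M2 ^^ Suc (Max (insert 0 F))) v z < 1" for z
    proof -
      obtain k where k: "k \<in> F" "(?M2 ^^ k) v z < 1" using F(2) by auto
      then have "k \<le> Suc (Max (insert 0 F))" using F(1) by (simp add: le_SucI)
      from dec[OF this, of z] k(2) show ?thesis by linarith
    qed
    then show ?thesis using that by blast
  qed
  obtain z0 where z0: "\<And>z. (?M2 ^^ n) v z \<le> (?M2 ^^ n) v z0"
  proof -
    have "compact (UNIV :: (circle \<times> circle) set)"
      using compact_Times[OF compact_circle compact_circle] by simp
    from continuous_attains_sup[OF this _ Mc[of n]] that show ?thesis by auto
  qed
  \<comment> \<open>One rate for both kinds of points: \<open>l\<close> where \<open>v\<close> is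
    below 1, the maximum of the iterate where \<open>v\<close> equals 1.\<close>
  define a where "a = max l ((?M2 ^^ n) v z0)"
  have a: "0 < a" "a < 1" using l n(1)[of z0] by (auto simp: a_def)
  have vn: "(?M2 ^^ n) v z \<le> a * v z" for z
  proof (cases "v z < 1")
    case True
    have "(?M2 ^^ n) v z \<le> (?M2 ^^ 1) v z" using n(2) by (intro dec) auto
    also have "\<dots> \<le> l * v z" using v1[OF True] by simp
    also have "\<dots> \<le> a * v z" using v01(1) by (intro mult_right_mono) (auto simp: a_def)
    finally show ?thesis .
  next
    case False
    then have "v z = 1" using v01(2)[of z] by simp
    then show ?thesis using z0[of z] by (simp add: a_def)
  qed
  have vnk: "(?M2 ^^ (n * k)) v z \<le> a ^ k * v z" for k z
  proof (induction k arbitrary: z)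
    case (Suc k)
    have "(?M2 ^^ (n * Suc k)) v z = (?M2 ^^ n) ((?M2 ^^ (n * k)) v) z" by (simp add: funpow_add)
    also have "\<dots> \<le> (?M2 ^^ n) (\<lambda>z. a ^ k * v z) z" by (intro M_iter_mono Suc.IH)
    also have "\<dots> = a ^ k * (?M2 ^^ n) v z" by (simp add: M_iter_cmult)
    also have "\<dots> \<le> a ^ k * (a * v z)" using a by (intro mult_left_mono vn) auto
    finally show ?case by (simp add: mult_ac)
  qed simp
  \<comment> \<open>The per-step rate. The factor 1 / a in \<open>vj\<close> pays for the incomplete
    last block of fewer than \<open>n\<close> steps.\<close>
  define k where "k = root n a"
  have k: "0 < k" "k < 1" "k ^ n = a" using a n(2) by (auto simp: k_def)
  have vj: "(?M2 ^^ j) v z \<le> (1 / a) * k ^ j * v z" for j z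
  proof -
    have "(?M2 ^^ j) v z \<le> (?M2 ^^ (n * (j div n))) v z" by (intro dec) simp
    also have "\<dots> \<le> a ^ (j div n) * v z" by (rule vnk)
    also have "\<dots> \<le> (1 / a) * k ^ j * v z"
    proof (rule mult_right_mono)
      have "j \<le> n * Suc (j div n)"
        using n(2) by (metis dividend_less_div_times less_imp_le mult.commute mult_Suc_right add.commute)
      then have "k ^ (n * Suc (j div n)) \<le> k ^ j" using k by (intro power_decreasing) auto
      then have "a * a ^ (j div n) \<le> k ^ j" by (simp only: power_mult k(3) power_Suc)
      then show "a ^ (j div n) \<le> (1 / a) * k ^ j" using a by (simp add: field_simps)
    qed (rule v01)
    finally show ?thesis .
  qed
  show ?thesis
  proof (rule that[of \<beta> "C / (a * c)" k])
    show "0 < C / (a * c)" using u a by simp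
    fix j x y
    have "(?M2 ^^ j) (\<lambda>z. dist (fst z) (snd z) powr \<beta>) (x, y) \<le> (?M2 ^^ j) (\<lambda>z. (\<kappa> / c) * v z) (x, y)"
    proof (rule M_iter_mono)
      fix z :: "circle \<times> circle"
      show "dist (fst z) (snd z) powr \<beta> \<le> (\<kappa> / c) * v z"
        using u(1,2) u(8)[of "fst z" "snd z"] by (simp add: v_def field_simps)
    qed
    also have "\<dots> = (\<kappa> / c) * (?M2 ^^ j) v (x, y)" by (simp only: M_iter_cmult)
    also have "\<dots> \<le> (\<kappa> / c) * ((1 / a) * k ^ j * v (x, y))"
      using u(1,2) by (intro mult_left_mono vj) auto
    also have "\<dots> = (k ^ j / (a * c)) * u (x, y)" using u(1) by (simp add: v_def)
    also have "\<dots> \<le> (k ^ j / (a * c)) * (C * dist x y powr \<beta>)"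
      using u(2) a k by (intro mult_left_mono u(9)) auto
    finally show "(?M2 ^^ j) (\<lambda>z. dist (fst z) (snd z) powr \<beta>) (x, y) \<le> C / (a * c) * k ^ j * dist x y powr \<beta>"
      by (simp add: mult_ac)
  qed (use \<beta> k in auto)
qed

end

section \<open>Stationary measures and Poisson's equation\<close>

lemma holder_diff:
  assumes "holder \<beta> \<phi>" "holder \<beta> \<psi>" shows "holder \<beta> (\<lambda>x. \<phi> x - \<psi> x)"
proof -
  obtain L K where "\<And>x y. \<bar>\<phi> x - \<phi> y\<bar> \<le> L * dist x y powr \<beta>" "\<And>x y. \<bar>\<psi> x - \<psi> y\<bar> \<le> K * dist x y powr \<beta>"
    using assms by (auto simp: holder_def)
  then show ?thesis
    by (intro holderI[where L = "L + K"]) (smt (verit) distrib_right)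
qed

lemma holder_square:
  assumes "holder \<beta> \<phi>" "\<And>x. \<bar>\<phi> x\<bar> \<le> B" shows "holder \<beta> (\<lambda>x. (\<phi> x)\<^sup>2)"
proof -
  obtain L where L: "L \<ge> 0" "\<And>x y. \<bar>\<phi> x - \<phi> y\<bar> \<le> L * dist x y powr \<beta>"
    using assms(1) by (auto simp: holder_def)
  show ?thesis
  proof (rule holderI)
    fix x y
    have "\<bar>(\<phi> x)\<^sup>2 - (\<phi> y)\<^sup>2\<bar> = \<bar>\<phi> x + \<phi> y\<bar> * \<bar>\<phi> x - \<phi> y\<bar>"
      by (simp add: power2_eq_square square_diff_square_factored abs_mult)
    also have "\<dots> \<le> (2 * B) * (L * dist x y powr \<beta>)"
      using assms(2)[of x] assms(2)[of y] L by (intro mult_mono) auto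
    finally show "\<bar>(\<phi> x)\<^sup>2 - (\<phi> y)\<^sup>2\<bar> \<le> (2 * B * L) * dist x y powr \<beta>" by simp
  qed
qed

lemma dist_circle_powr_mono:
  assumes "0 < \<beta>" "\<beta> \<le> \<alpha>" shows "dist (x :: circle) y powr \<alpha> \<le> dist x y powr \<beta>"
  using assms dist_circle_le_1[of x y] by (intro powr_mono') auto

locale bernoulli_ifs = circle_ifs + prob_space \<mu> for \<mu> :: "nat measure" +
  assumes sets_\<mu>: "sets \<mu> = Pow {..<N}" and p_\<mu>: "i < N \<Longrightarrow> p i = measure \<mu> {i}"
begin

lemma integral_\<mu>:
  fixes \<phi> :: "nat \<Rightarrow> 'b::{banach, second_countable_topology}"
  shows "(\<integral>i. \<phi> i \<partial>\<mu>) = (\<Sum>i<N. p i *\<^sub>R \<phi> i)"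
proof -
  have "\<mu> = density (count_space {..<N}) (\<lambda>i. ennreal (measure \<mu> {i}))"
  proof (rule measure_eqI_countable[where A = "{..<N}"])
    fix a assume a: "a \<in> {..<N}"
    have "emeasure (density (count_space {..<N}) (\<lambda>i. ennreal (measure \<mu> {i}))) {a} =
       (\<integral>\<^sup>+x. ennreal (measure \<mu> {x}) * indicator {a} x \<partial>count_space {..<N})"
      using a by (subst emeasure_density) auto
    also have "\<dots> = ennreal (measure \<mu> {a})"
      using a by (subst nn_integral_count_space_finite) (auto simp: indicator_def if_distrib sum.delta cong: if_cong)
    finally show "emeasure \<mu> {a} = emeasure (density (count_space {..<N}) (\<lambda>i. ennreal (measure \<mu> {i}))) {a}"
      by (simp add: emeasure_eq_measure)
  qed (auto simp: sets_\<mu>)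
  then have "(\<integral>i. \<phi> i \<partial>\<mu>) = (\<integral>i. \<phi> i \<partial>density (count_space {..<N}) (\<lambda>i. ennreal (measure \<mu> {i})))"
    by simp
  also have "\<dots> = (\<Sum>i<N. measure \<mu> {i} *\<^sub>R \<phi> i)"
    by (subst integral_density) (auto simp: lebesgue_integral_count_space_finite)
  finally show ?thesis by (simp add: p_\<mu>)
qed

lemma measurable_apply_f:
  assumes "k \<in> measurable A \<mu>" "R \<in> measurable A borel"
  shows "(\<lambda>w. f (k w) (R w)) \<in> measurable A borel"
proof (rule measurable_compose_countable'[where I = "{..<N}"])
  show "k \<in> measurable A (count_space {..<N})"
    using assms(1) measurable_cong_sets[of A A \<mu> "count_space {..<N}"] by (simp add: sets_\<mu>)
  fix i assume "i \<in> {..<N}"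
  then show "(\<lambda>w. f i (R w)) \<in> measurable A borel"
    using measurable_compose[OF assms(2) f_measurable[of i]] by simp
qed simp

text \<open>The law of one random step started from \<nu>. As an image measure it is a probability
  by construction, and stationarity becomes the fixed point equation of
  \<open>stationary_iff_mixture\<close>.\<close>

definition mixture :: "circle measure \<Rightarrow> circle measure" where
  "mixture \<nu> = distr (\<mu> \<Otimes>\<^sub>M \<nu>) borel (\<lambda>(i, x). f i x)"

lemma mixture:
  assumes \<nu>: "borel_prob \<nu>"
  shows borel_prob_mixture: "borel_prob (mixture \<nu>)"
    and integral_mixture: "\<And>\<phi> B. \<phi> \<in> borel_measurable borel \<Longrightarrow> (\<And>x. \<bar>\<phi> x\<bar> \<le> (B::real)) \<Longrightarrow>
      (\<integral>x. \<phi> x \<partial>mixture \<nu>) = (\<Sum>i<N. p i * (\<integral>x. \<phi> (f i x) \<partial>\<nu>))"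
proof -
  interpret \<nu>: prob_space \<nu> using \<nu> by (simp add: borel_prob_def)
  interpret P: pair_prob_space \<mu> \<nu> ..
  have s[measurable_cong]: "sets \<nu> = sets borel" using \<nu> by (simp add: borel_prob_def)
  have [measurable]: "(\<lambda>(i, x). f i x) \<in> measurable (\<mu> \<Otimes>\<^sub>M \<nu>) borel"
    unfolding case_prod_beta by (rule measurable_apply_f) measurable
  show "borel_prob (mixture \<nu>)"
    unfolding borel_prob_def mixture_def by (auto intro: P.prob_space_distr)
  fix \<phi> :: "circle \<Rightarrow> real" and B
  assume [measurable]: "\<phi> \<in> borel_measurable borel" and B: "\<And>x. \<bar>\<phi> x\<bar> \<le> B"
  have "(\<integral>x. \<phi> x \<partial>mixture \<nu>) = (\<integral>z. \<phi> ((\<lambda>(i, x). f i x) z) \<partial>(\<mu> \<Otimes>\<^sub>M \<nu>))"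
    unfolding mixture_def by (rule integral_distr) auto
  also have "\<dots> = (\<integral>i. (\<integral>x. \<phi> (f i x) \<partial>\<nu>) \<partial>\<mu>)"
    using B by (subst P.integral_fst'[symmetric]) (auto intro!: P.P.integrable_const_bound[where B = B])
  also have "\<dots> = (\<Sum>i<N. p i * (\<integral>x. \<phi> (f i x) \<partial>\<nu>))"
    by (simp add: integral_\<mu>)
  finally show "(\<integral>x. \<phi> x \<partial>mixture \<nu>) = (\<Sum>i<N. p i * (\<integral>x. \<phi> (f i x) \<partial>\<nu>))" .
qed

lemma integral_M:
  assumes \<nu>: "borel_prob \<nu>" and \<phi>: "\<phi> \<in> borel_measurable borel" "\<And>x. \<bar>\<phi> x\<bar> \<le> B"
  shows "(\<integral>x. M f \<phi> x \<partial>\<nu>) = (\<Sum>i<N. p i * (\<integral>x. \<phi> (f i x) \<partial>\<nu>))"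
proof -
  have "integrable \<nu> (\<lambda>x. \<phi> (f i x))" if "i < N" for i
    using that \<phi> by (intro borel_prob_integrable[OF \<nu>, where B = B]) (auto intro: measurable_compose)
  then show ?thesis unfolding markov_def by (subst Bochner_Integration.integral_sum) auto
qed

lemma stationary_iff_mixture:
  "stationary N f \<mu> \<nu> \<longleftrightarrow> borel_prob \<nu> \<and> mixture \<nu> = \<nu>"
proof (cases "borel_prob \<nu>")
  case True
  have s: "sets \<nu> = sets borel" using True by (simp add: borel_prob_def)
  have s': "sets (mixture \<nu>) = sets borel" by (simp add: mixture_def)
  interpret \<nu>: prob_space \<nu> using True by (simp add: borel_prob_def)
  interpret m: prob_space "mixture \<nu>" using borel_prob_mixture[OF True] by (simp add: borel_prob_def)
  have "measure (mixture \<nu>) A = (\<Sum>i<N. measure \<mu> {i} * measure (distr \<nu> borel (f i)) A)" if A: "A \<in> sets borel" for A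
  proof -
    have "measure (mixture \<nu>) A = (\<integral>x. indicator A x \<partial>mixture \<nu>)"
      using A s' sets_eq_imp_space_eq[OF s'] by simp
    also have "\<dots> = (\<Sum>i<N. p i * (\<integral>x. indicator A (f i x) \<partial>\<nu>))"
      using A by (intro integral_mixture[OF True, where B = 1]) (auto simp: indicator_def)
    also have "\<dots> = (\<Sum>i<N. measure \<mu> {i} * measure (distr \<nu> borel (f i)) A)"
    proof (intro sum.cong refl)
      fix i assume "i \<in> {..<N}"
      then have i: "i < N" by simp
      have [measurable]: "f i \<in> measurable \<nu> borel" using f_measurable[OF i] by (simp add: measurable_cong_sets[OF s refl])
      have "(\<integral>x. indicator A (f i x) \<partial>\<nu>) = (\<integral>x. indicator A x \<partial>distr \<nu> borel (f i) :: real)"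
        using A by (subst integral_distr) auto
      also have "\<dots> = measure (distr \<nu> borel (f i)) A" using A by simp
      finally show "p i * (\<integral>x. indicator A (f i x) \<partial>\<nu>) = measure \<mu> {i} * measure (distr \<nu> borel (f i)) A"
        using p_\<mu>[OF i] by simp
    qed
    finally show ?thesis .
  qed
  moreover have "mixture \<nu> = \<nu> \<longleftrightarrow> (\<forall>A\<in>sets borel. measure (mixture \<nu>) A = measure \<nu> A)"
    using s s' by (auto intro!: measure_eqI simp: m.emeasure_eq_measure \<nu>.emeasure_eq_measure)
  ultimately show ?thesis using True unfolding stationary_def by auto
qed (simp add: stationary_def)

lemma stationary_integral_M_iter:
  assumes \<nu>: "stationary N f \<mu> \<nu>" and \<phi>: "continuous_on UNIV \<phi>"
  shows "(\<integral>x. (M f ^^ n) \<phi> x \<partial>\<nu>) = (\<integral>x. \<phi> x \<partial>\<nu>)"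
proof (induction n)
  case (Suc n)
  have c: "continuous_on UNIV ((M f ^^ n) \<phi>)" by (intro M_iter_continuous f_cont \<phi>)
  obtain B where B: "\<And>x. \<bar>(M f ^^ n) \<phi> x\<bar> \<le> B" using circle_bounded[OF c] by blast
  have b: "borel_prob \<nu>" "mixture \<nu> = \<nu>" using \<nu> stationary_iff_mixture by auto
  show ?case
    using integral_M[OF b(1) borel_measurable_continuous_onI[OF c] B]
      integral_mixture[OF b(1) borel_measurable_continuous_onI[OF c] B] Suc b(2) by simp
qed simp

end

locale contracting_ifs = bernoulli_ifs +
  fixes \<beta> C k :: real
  assumes \<beta>_pos: "0 < \<beta>" and C_pos: "0 < C" and k_pos: "0 < k" and k_less_1: "k < 1"
    and contraction: "(M (pair_maps f) ^^ n) (\<lambda>z. dist (fst z) (snd z) powr \<beta>) (x, y) \<le> C * k ^ n * dist x y powr \<beta>"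
begin

lemma M_iter_holder:
  assumes "\<And>x y. \<bar>\<phi> x - \<phi> y\<bar> \<le> L * dist x y powr \<beta>" "L \<ge> 0"
  shows "\<bar>(M f ^^ n) \<phi> x - (M f ^^ n) \<phi> y\<bar> \<le> L * C * k ^ n * dist x y powr \<beta>"
proof -
  have "\<bar>(M f ^^ n) \<phi> x - (M f ^^ n) \<phi> y\<bar>
      \<le> (M (pair_maps f) ^^ n) (\<lambda>z. L * dist (fst z) (snd z) powr \<beta>) (x, y)"
    by (rule M_iter_osc) (simp add: assms)
  also have "\<dots> = L * (M (pair_maps f) ^^ n) (\<lambda>z. dist (fst z) (snd z) powr \<beta>) (x, y)"
    by (simp only: M_iter_cmult)
  also have "\<dots> \<le> L * (C * k ^ n * dist x y powr \<beta>)"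
    by (intro mult_left_mono contraction assms)
  finally show ?thesis by (simp add: mult_ac)
qed

lemma M_iter_osc_le:
  assumes "\<And>x y. \<bar>\<phi> x - \<phi> y\<bar> \<le> L * dist x y powr \<beta>" "L \<ge> 0"
  shows "\<bar>(M f ^^ n) \<phi> x - (M f ^^ n) \<phi> y\<bar> \<le> L * C * k ^ n"
proof -
  have "dist x y powr \<beta> \<le> 1 powr \<beta>"
    using \<beta>_pos dist_circle_le_1[of x y] by (intro powr_mono2) auto
  then have "L * C * k ^ n * dist x y powr \<beta> \<le> L * C * k ^ n * 1"
    using assms(2) C_pos k_pos by (intro mult_left_mono) auto
  then show ?thesis using M_iter_holder[OF assms, of n x y] by linarith
qed

lemma holder_M: "holder \<beta> \<phi> \<Longrightarrow> holder \<beta> (M f \<phi>)"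
proof -
  assume "holder \<beta> \<phi>"
  then obtain L where L: "L \<ge> 0" "\<And>x y. \<bar>\<phi> x - \<phi> y\<bar> \<le> L * dist x y powr \<beta>"
    by (auto simp: holder_def)
  show ?thesis using M_iter_holder[OF L(2,1), of 1] by (intro holderI) simp
qed

text \<open>Iteration preserves the integral against a stationary measure, and the n-th iterate
  oscillates by at most \<open>L * C * k ^ n\<close>, so each value is that close to its
  mean.\<close>

lemma M_iter_converges:
  assumes \<nu>: "stationary N f \<mu> \<nu>" and L: "\<And>x y. \<bar>\<phi> x - \<phi> y\<bar> \<le> L * dist x y powr \<beta>" "L \<ge> 0"
  shows "\<bar>(M f ^^ n) \<phi> x - (\<integral>y. \<phi> y \<partial>\<nu>)\<bar> \<le> L * C * k ^ n"
proof -
  have c: "continuous_on UNIV \<phi>"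
    using holderI[OF L(1)] \<beta>_pos by (rule holder_continuous_on)
  have b: "borel_prob \<nu>" using \<nu> by (simp add: stationary_def)
  interpret \<nu>: prob_space \<nu> using b by (simp add: borel_prob_def)
  have cn: "continuous_on UNIV ((M f ^^ n) \<phi>)" by (intro M_iter_continuous f_cont c)
  obtain B where B: "\<And>x. \<bar>(M f ^^ n) \<phi> x\<bar> \<le> B" using circle_bounded[OF cn] by blast
  have i: "integrable \<nu> ((M f ^^ n) \<phi>)"
    by (rule borel_prob_integrable[OF b borel_measurable_continuous_onI[OF cn] B])
  have "(M f ^^ n) \<phi> x - L * C * k ^ n \<le> (\<integral>y. (M f ^^ n) \<phi> y \<partial>\<nu>)"
    using M_iter_osc_le[OF L, of n x] by (intro \<nu>.integral_ge_const i AE_I2) (simp add: abs_le_iff algebra_simps)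
  moreover have "(\<integral>y. (M f ^^ n) \<phi> y \<partial>\<nu>) \<le> (M f ^^ n) \<phi> x + L * C * k ^ n"
    using M_iter_osc_le[OF L, of n _ x] by (intro \<nu>.integral_le_const i AE_I2) (simp add: abs_le_iff algebra_simps)
  ultimately show ?thesis unfolding stationary_integral_M_iter[OF \<nu> c] by (simp add: abs_le_iff)
qed

lemma lipschitz_holder:
  fixes \<phi> :: "circle \<Rightarrow> real"
  assumes "\<beta> \<le> 1" "\<And>x y. \<bar>\<phi> x - \<phi> y\<bar> \<le> L * dist x y"
  shows "\<bar>\<phi> x - \<phi> y\<bar> \<le> \<bar>L\<bar> * dist x y powr \<beta>"
proof -
  have "\<bar>\<phi> x - \<phi> y\<bar> \<le> L * dist x y" by (rule assms)
  also have "\<dots> \<le> \<bar>L\<bar> * dist x y powr 1" by (simp add: mult_right_mono)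
  also have "\<dots> \<le> \<bar>L\<bar> * dist x y powr \<beta>"
    using \<beta>_pos assms(1) by (intro mult_left_mono dist_circle_powr_mono) auto
  finally show ?thesis .
qed

lemma power_k_tendsto_0: "(\<lambda>n. c * k ^ n) \<longlonglongrightarrow> 0"
  using k_pos k_less_1 by (intro tendsto_mult_right_zero LIMSEQ_power_zero) auto

text \<open>The limit of the iterates at any point determines the integral of every Lipschitz
  function. The bound \<open>\<beta> \<le> 1\<close> makes Lipschitz functions \<beta>-Hoelder on a
  space of diameter at most 1.\<close>

lemma stationary_unique:
  assumes "\<beta> \<le> 1" "stationary N f \<mu> \<nu>" "stationary N f \<mu> \<nu>'"
  shows "\<nu> = \<nu>'"
proof (rule borel_prob_eqI)
  fix \<phi> :: "circle \<Rightarrow> real" and L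
  assume "\<And>x y. \<bar>\<phi> x - \<phi> y\<bar> \<le> L * dist x y"
  note L = lipschitz_holder[OF assms(1) this]
  have lim: "(\<lambda>n. (M f ^^ n) \<phi> x) \<longlonglongrightarrow> (\<integral>y. \<phi> y \<partial>\<nu>)" if "stationary N f \<mu> \<nu>" for \<nu> x
    by (rule LIM_zero_cancel, rule Lim_null_comparison[OF _ power_k_tendsto_0[of "\<bar>L\<bar> * C"]])
      (use M_iter_converges[OF that L] in simp)
  show "(\<integral>x. \<phi> x \<partial>\<nu>) = (\<integral>x. \<phi> x \<partial>\<nu>')"
    by (rule LIMSEQ_unique[OF lim[OF assms(2)] lim[OF assms(3)]])
qed (use assms in \<open>simp_all add: stationary_def\<close>)

text \<open>Push arc length forward \<open>r n\<close> steps and take a weak limit. Invariance of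
  the limit follows because consecutive iterates of a Lipschitz function become uniformly close, by
  contraction.\<close>

lemma stationary_exists:
  assumes "\<beta> \<le> 1" shows "\<exists>\<nu>. stationary N f \<mu> \<nu>"
proof -
  have d1: "density_fun (\<lambda>_. 1)" by (simp add: density_fun_def)
  obtain r :: "nat \<Rightarrow> nat" and \<nu> where r: "strict_mono r" and \<nu>: "borel_prob \<nu>"
    and lim: "\<And>\<phi>. continuous_on UNIV \<phi> \<Longrightarrow>
      (\<lambda>n. circle_int (\<lambda>x. \<phi> x * (transfer ^^ r n) (\<lambda>_. 1) x)) \<longlonglongrightarrow> (\<integral>x. \<phi> x \<partial>\<nu>)"
    by (rule circle_prob_compactness[of "\<lambda>n. (transfer ^^ n) (\<lambda>_. 1)", OF density_transfer_iter[OF d1]]) (rule that)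
  have "mixture \<nu> = \<nu>"
  proof (rule borel_prob_eqI[OF borel_prob_mixture[OF \<nu>] \<nu>])
    fix \<phi> :: "circle \<Rightarrow> real" and L
    assume "\<And>x y. \<bar>\<phi> x - \<phi> y\<bar> \<le> L * dist x y" and \<phi>01: "\<And>x. 0 \<le> \<phi> x \<and> \<phi> x \<le> 1"
    note L = lipschitz_holder[OF assms this(1)]
    have c: "continuous_on UNIV \<phi>"
      using holderI[OF L] \<beta>_pos by (rule holder_continuous_on)
    have B: "\<bar>\<phi> x\<bar> \<le> 1" for x using \<phi>01[of x] by simp
    have cM: "continuous_on UNIV (M f \<phi>)" by (intro M_continuous f_cont c)
    have cn: "continuous_on UNIV ((M f ^^ n) \<phi>)" for n by (intro M_iter_continuous f_cont c)
    \<comment> \<open>The difference is \<open>M f\<close> applied to an oscillation of the n-th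
      iterate, whose bound it inherits.\<close>
    have step: "\<bar>(M f ^^ n) (M f \<phi>) x - (M f ^^ n) \<phi> x\<bar> \<le> \<bar>L\<bar> * C * k ^ n" for n x
    proof -
      have "\<bar>M f (\<lambda>y. (M f ^^ n) \<phi> y - (M f ^^ n) \<phi> x) x\<bar> \<le> \<bar>L\<bar> * C * k ^ n"
        using M_iter_bound[where \<phi> = "\<lambda>y. (M f ^^ n) \<phi> y - (M f ^^ n) \<phi> x" and B = "\<bar>L\<bar> * C * k ^ n"
            and f = f and n = 1 and x = x]
          M_iter_osc_le[OF L, of n _ x] by simp
      moreover have "M f (\<lambda>y. (M f ^^ n) \<phi> y - (M f ^^ n) \<phi> x) x = (M f ^^ n) (M f \<phi>) x - (M f ^^ n) \<phi> x"
        by (simp add: M_diff funpow_swap1)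
      ultimately show ?thesis by simp
    qed
    have "(\<lambda>n. circle_int (\<lambda>x. M f \<phi> x * (transfer ^^ r n) (\<lambda>_. 1) x)
        - circle_int (\<lambda>x. \<phi> x * (transfer ^^ r n) (\<lambda>_. 1) x)) \<longlonglongrightarrow> 0"
    proof (rule Lim_null_comparison)
      show "(\<lambda>n. \<bar>L\<bar> * C * k ^ r n) \<longlonglongrightarrow> 0"
        using LIMSEQ_subseq_LIMSEQ[OF power_k_tendsto_0 r] by (simp add: o_def)
      have bd: "\<bar>circle_int \<psi>\<bar> \<le> b" if "continuous_on UNIV \<psi>" "\<And>x. \<bar>\<psi> x\<bar> \<le> b" for \<psi> b
      proof -
        have "circle_int \<psi> \<le> circle_int (\<lambda>_. b)" "circle_int (\<lambda>_. - b) \<le> circle_int \<psi>"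
          using that by (intro circle_int_mono; simp add: abs_le_iff minus_le_iff)+
        then show ?thesis by simp
      qed
      have "\<bar>circle_int (\<lambda>x. (M f ^^ n) (M f \<phi>) x * 1) - circle_int (\<lambda>x. (M f ^^ n) \<phi> x * 1)\<bar> \<le> \<bar>L\<bar> * C * k ^ n" for n
        using step by (subst circle_int_diff[symmetric])
          (auto intro!: bd continuous_intros cn M_iter_continuous f_cont cM)
      then show "\<forall>\<^sub>F n in sequentially. norm (circle_int (\<lambda>x. M f \<phi> x * (transfer ^^ r n) (\<lambda>_. 1) x)
        - circle_int (\<lambda>x. \<phi> x * (transfer ^^ r n) (\<lambda>_. 1) x)) \<le> \<bar>L\<bar> * C * k ^ r n"
        unfolding circle_int_transfer_iter[OF d1 cM] circle_int_transfer_iter[OF d1 c] by simp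
    qed
    moreover have "(\<lambda>n. circle_int (\<lambda>x. M f \<phi> x * (transfer ^^ r n) (\<lambda>_. 1) x)
        - circle_int (\<lambda>x. \<phi> x * (transfer ^^ r n) (\<lambda>_. 1) x)) \<longlonglongrightarrow> (\<integral>x. M f \<phi> x \<partial>\<nu>) - (\<integral>x. \<phi> x \<partial>\<nu>)"
      by (intro tendsto_diff lim cM c)
    ultimately have "(\<integral>x. M f \<phi> x \<partial>\<nu>) - (\<integral>x. \<phi> x \<partial>\<nu>) = 0" by (rule LIMSEQ_unique[rotated])
    then show "(\<integral>x. \<phi> x \<partial>mixture \<nu>) = (\<integral>x. \<phi> x \<partial>\<nu>)"
      using integral_mixture[OF \<nu> borel_measurable_continuous_onI[OF c] B]
        integral_M[OF \<nu> borel_measurable_continuous_onI[OF c] B] by simp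
  qed
  then show ?thesis using \<nu> stationary_iff_mixture by blast
qed

text \<open>The Neumann series of the centred iterates converges geometrically, also in
  \<beta>-Hoelder seminorm. Applying \<open>M f\<close> deletes its first term, which is the
  equation.\<close>

lemma poisson_solution:
  assumes \<nu>: "stationary N f \<mu> \<nu>" and \<phi>: "holder \<beta> \<phi>"
  obtains h where "holder \<beta> h" "\<And>x. \<phi> x - (\<integral>y. \<phi> y \<partial>\<nu>) = h x - M f h x"
proof -
  obtain L where L: "L \<ge> 0" "\<And>x y. \<bar>\<phi> x - \<phi> y\<bar> \<le> L * dist x y powr \<beta>"
    using \<phi> by (auto simp: holder_def)
  let ?c = "\<integral>y. \<phi> y \<partial>\<nu>"
  have geo: "summable (\<lambda>n. a * k ^ n)" for a
    using k_pos k_less_1 by (intro summable_mult summable_geometric) auto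
  define h where "h x = (\<Sum>n. (M f ^^ n) \<phi> x - ?c)" for x
  have h: "(\<lambda>n. (M f ^^ n) \<phi> x - ?c) sums h x" for x
    unfolding h_def
    by (rule summable_sums, rule summable_comparison_test'[OF geo[of "L * C"]])
      (use M_iter_converges[OF \<nu> L(2,1)] in simp)
  show ?thesis
  proof
    show "holder \<beta> h"
    proof (rule holderI)
      fix x y :: circle
      let ?d = "L * C * dist x y powr \<beta>"
      have s: "(\<lambda>n. (M f ^^ n) \<phi> x - (M f ^^ n) \<phi> y) sums (h x - h y)"
        using sums_diff[OF h[of x] h[of y]] by simp
      have le: "\<bar>(M f ^^ n) \<phi> x - (M f ^^ n) \<phi> y\<bar> \<le> ?d * k ^ n" for n
        using M_iter_holder[OF L(2,1), of n x y] by (simp add: mult_ac)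
      have "summable (\<lambda>n. \<bar>(M f ^^ n) \<phi> x - (M f ^^ n) \<phi> y\<bar>)"
        by (rule summable_comparison_test'[OF geo[of ?d]]) (use le in simp)
      then have "\<bar>h x - h y\<bar> \<le> (\<Sum>n. \<bar>(M f ^^ n) \<phi> x - (M f ^^ n) \<phi> y\<bar>)"
        unfolding sums_unique[OF s] by (rule summable_rabs)
      also have "\<dots> \<le> (\<Sum>n. ?d * k ^ n)"
        by (intro suminf_le le geo) fact
      also have "\<dots> = ?d * (\<Sum>n. k ^ n)"
        using k_pos k_less_1 by (intro suminf_mult summable_geometric) auto
      finally show "\<bar>h x - h y\<bar> \<le> (L * C * (\<Sum>n. k ^ n)) * dist x y powr \<beta>" by (simp add: mult_ac)
    qed
    fix x :: circle
    have "(\<lambda>n. \<Sum>i<N. p i * ((M f ^^ n) \<phi> (f i x) - ?c)) sums (\<Sum>i<N. p i * h (f i x))"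
      by (intro sums_sum sums_mult h)
    moreover have "(\<Sum>i<N. p i * ((M f ^^ n) \<phi> (f i x) - ?c)) = (M f ^^ Suc n) \<phi> x - ?c" for n
      using p_sum by (simp add: markov_def right_diff_distrib sum_subtractf flip: sum_distrib_right)
    ultimately have "(\<lambda>n. (M f ^^ Suc n) \<phi> x - ?c) sums M f h x"
      unfolding markov_def[of N p f h x] by simp
    from sums_unique2[OF sums_Suc[OF this] h[of x]]
    show "\<phi> x - ?c = h x - M f h x" by simp
  qed
qed

end

section \<open>Martingale approximation and the law of large numbers\<close>

text \<open>\<open>rand_iter\<close> appends letters at the end, whereas the inductions below
  condition on the first letter and restart from \<open>f i x\<close>.\<close>

lemma rand_iter_case_nat:
  "rand_iter f (case_nat i \<omega>) (Suc n) x = rand_iter f \<omega> n (f i x)"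
  by (induction n) simp_all

lemma birkhoff_sum_case_nat:
  "birkhoff_sum f \<phi> (Suc n) (case_nat i \<omega>) x = \<phi> x + birkhoff_sum f \<phi> n \<omega> (f i x)"
proof -
  have "birkhoff_sum f \<phi> (Suc n) (case_nat i \<omega>) x
      = \<phi> x + (\<Sum>k<n. \<phi> (rand_iter f (case_nat i \<omega>) (Suc k) x))"
    unfolding birkhoff_sum_def by (subst sum.lessThan_Suc_shift) simp
  then show ?thesis by (simp only: rand_iter_case_nat birkhoff_sum_def)
qed

lemma birkhoff_sum_bound:
  assumes "\<And>x. \<bar>\<phi> x\<bar> \<le> b" shows "\<bar>birkhoff_sum f \<phi> n \<omega> x\<bar> \<le> real n * b"
proof -
  have "\<bar>birkhoff_sum f \<phi> n \<omega> x\<bar> \<le> (\<Sum>k<n. b)"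
    unfolding birkhoff_sum_def by (rule order_trans[OF sum_abs]) (intro sum_mono assms)
  then show ?thesis by simp
qed

text \<open>Between consecutive squares there are at most 2 m further steps beyond m^2, so the sum
  changes by at most 2 m b, which is negligible against m^2.\<close>

lemma average_limit_from_squares:
  fixes s :: "nat \<Rightarrow> real"
  assumes incr: "\<And>n. \<bar>s (Suc n) - s n\<bar> \<le> b" and sq: "(\<lambda>m. s (m\<^sup>2) / real (m\<^sup>2)) \<longlonglongrightarrow> 0"
  shows "(\<lambda>n. s n / real n) \<longlonglongrightarrow> 0"
proof -
  have b: "b \<ge> 0" using incr[of 0] by simp
  have gap: "\<bar>s (a + d) - s a\<bar> \<le> real d * b" for a d
  proof (induction d)
    case (Suc d)
    then show ?case using incr[of "a + d"] by (simp add: algebra_simps)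
  qed simp
  have lim: "filterlim floor_sqrt at_top sequentially"
    unfolding filterlim_at_top
  proof
    fix Z
    show "\<forall>\<^sub>F n in sequentially. Z \<le> floor_sqrt n"
      using eventually_ge_at_top[of "Z\<^sup>2"] by eventually_elim (simp add: le_floor_sqrt_iff)
  qed
  have "(\<lambda>m. \<bar>s (m\<^sup>2) / real (m\<^sup>2)\<bar> + 2 * b * inverse (real m)) \<longlonglongrightarrow> \<bar>0\<bar> + 2 * b * 0"
    by (intro tendsto_intros sq tendsto_inverse_0_at_top filterlim_real_sequentially)
  from filterlim_compose[OF this lim]
  have "(\<lambda>n. \<bar>s ((floor_sqrt n)\<^sup>2) / real ((floor_sqrt n)\<^sup>2)\<bar> + 2 * b * inverse (real (floor_sqrt n))) \<longlonglongrightarrow> 0"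
    by simp
  moreover have "\<forall>\<^sub>F n in sequentially. norm (s n / real n) \<le>
      \<bar>s ((floor_sqrt n)\<^sup>2) / real ((floor_sqrt n)\<^sup>2)\<bar> + 2 * b * inverse (real (floor_sqrt n))"
    using eventually_gt_at_top[of 0]
  proof eventually_elim
    case (elim n)
    define m where "m = floor_sqrt n"
    have m: "m\<^sup>2 \<le> n" "n < (Suc m)\<^sup>2" "m > 0"
      using elim by (simp_all add: m_def Suc_floor_sqrt_power2_gt)
    have m2: "real (m\<^sup>2) > 0" using m(3) by simp
    define d where "d = n - m\<^sup>2"
    have d: "n = m\<^sup>2 + d" "d \<le> 2 * m" using m by (auto simp: d_def power2_eq_square)
    have "\<bar>s n\<bar> \<le> \<bar>s (m\<^sup>2)\<bar> + real d * b" using gap[of "m\<^sup>2" d] d(1) by simp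
    also have "\<dots> \<le> \<bar>s (m\<^sup>2)\<bar> + real (2 * m) * b"
      using d(2) b by (intro add_left_mono mult_right_mono) auto
    finally have "\<bar>s n\<bar> \<le> \<bar>s (m\<^sup>2)\<bar> + real (2 * m) * b" .
    moreover have "real (m\<^sup>2) \<le> real n" using m(1) by (simp only: of_nat_le_iff)
    moreover have "0 \<le> \<bar>s (m\<^sup>2)\<bar> + real (2 * m) * b" using b by simp
    ultimately have "\<bar>s n\<bar> / real n \<le> (\<bar>s (m\<^sup>2)\<bar> + real (2 * m) * b) / real (m\<^sup>2)"
      using m2 by (intro frac_le)
    also have "\<dots> = \<bar>s (m\<^sup>2) / real (m\<^sup>2)\<bar> + 2 * b * inverse (real m)"
    proof -
      have "real (2 * m) * b / real (m\<^sup>2) = 2 * b * inverse (real m)"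
        using m(3) by (simp add: power2_eq_square inverse_eq_divide)
      then show ?thesis by (simp add: add_divide_distrib)
    qed
    finally show ?case by (simp add: m_def abs_divide)
  qed
  ultimately show ?thesis by (rule Lim_null_comparison[rotated])
qed

section \<open>Normal laws and their characteristic functions\<close>

lemma real_distribution_normal_law:
  assumes "\<sigma>2 \<ge> 0" shows "real_distribution (normal_law \<sigma>2)"
proof (cases "\<sigma>2 = 0")
  case True
  then show ?thesis unfolding normal_law_def real_distribution_def real_distribution_axioms_def
    by (auto intro: prob_space_return)
next
  case False
  then show ?thesis unfolding normal_law_def real_distribution_def real_distribution_axioms_def
    using assms by (auto intro!: prob_space_normal_density)
qed

lemma char_normal_law:
  assumes "\<sigma>2 \<ge> 0" shows "char (normal_law \<sigma>2) t = complex_of_real (exp (- (\<sigma>2 * t\<^sup>2 / 2)))"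
proof (cases "\<sigma>2 = 0")
  case True
  then show ?thesis by (simp add: normal_law_def char_def integral_return)
next
  case False
  define \<sigma> where "\<sigma> = sqrt \<sigma>2"
  have \<sigma>: "\<sigma> > 0" "\<sigma>\<^sup>2 = \<sigma>2" using False assms by (auto simp: \<sigma>_def)
  have "char (normal_law \<sigma>2) t = (\<integral>x. normal_density 0 \<sigma> x *\<^sub>R iexp (t * x) \<partial>lborel)"
    using False unfolding normal_law_def char_def by (simp add: integral_density normal_density_nonneg \<sigma>_def)
  also have "\<dots> = \<bar>\<sigma>\<bar> *\<^sub>R (\<integral>x. normal_density 0 \<sigma> (0 + \<sigma> * x) *\<^sub>R iexp (t * (0 + \<sigma> * x)) \<partial>lborel)"
    using \<sigma> by (intro lborel_integral_real_affine) auto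
  also have "\<dots> = (\<integral>x. std_normal_density x *\<^sub>R iexp ((t * \<sigma>) * x) \<partial>lborel)"
  proof -
    have "normal_density 0 \<sigma> (0 + \<sigma> * x) = std_normal_density x / \<sigma>" for x
      using \<sigma>(1) by (simp add: normal_density_def power_mult_distrib real_sqrt_mult)
    then show ?thesis using \<sigma>(1) by (simp add: mult_ac flip: integral_scaleR_right)
  qed
  also have "\<dots> = char std_normal_distribution (t * \<sigma>)"
    unfolding char_def by (simp add: integral_density normal_density_nonneg)
  also have "\<dots> = complex_of_real (exp (- (\<sigma>2 * t\<^sup>2 / 2)))"
    by (simp add: char_std_normal_distribution power_mult_distrib \<sigma>(2) mult.commute)
  finally show ?thesis .
qed

section \<open>Random words under the Bernoulli measure\<close>

context bernoulli_ifs
begin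

abbreviation \<Omega> :: "(nat \<Rightarrow> nat) measure" where
  "\<Omega> \<equiv> bernoulli_measure \<mu>"

lemma prob_space_\<Omega>: "prob_space \<Omega>"
  by (intro prob_space_PiM prob_space_axioms)

lemma measurable_rand_iter:
  assumes W: "W \<in> measurable A \<Omega>" and R: "R \<in> measurable A borel"
  shows "(\<lambda>z. rand_iter f (W z) n (R z)) \<in> measurable A borel"
proof (induction n)
  case (Suc n)
  have "(\<lambda>z. W z n) \<in> measurable A \<mu>"
    using measurable_compose[OF W measurable_component_singleton[OF UNIV_I]] .
  from measurable_apply_f[OF this Suc] show ?case by simp
qed (simp add: R)

lemma measurable_birkhoff_sum:
  assumes "W \<in> measurable A \<Omega>" "R \<in> measurable A borel" "\<phi> \<in> borel_measurable borel"
  shows "(\<lambda>z. birkhoff_sum f \<phi> n (W z) (R z)) \<in> borel_measurable A"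
  unfolding birkhoff_sum_def
  by (intro borel_measurable_sum measurable_compose[OF measurable_rand_iter assms(3)] assms)

text \<open>The Markov property at time one: prepending an independent letter to a Bernoulli
  sequence reproduces the Bernoulli measure, and Fubini integrates that letter last.\<close>

lemma integral_\<Omega>_front:
  fixes F :: "(nat \<Rightarrow> nat) \<Rightarrow> 'b::{banach, second_countable_topology}"
  assumes F[measurable]: "F \<in> borel_measurable \<Omega>" and B: "\<And>\<omega>. norm (F \<omega>) \<le> B"
  shows "(\<integral>\<omega>. F \<omega> \<partial>\<Omega>) = (\<Sum>i<N. p i *\<^sub>R (\<integral>\<omega>. F (case_nat i \<omega>) \<partial>\<Omega>))"
proof -
  interpret sequence_space \<mu> by unfold_locales
  interpret \<Omega>: prob_space \<Omega> by (rule prob_space_\<Omega>)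
  interpret P: pair_prob_space \<mu> \<Omega> ..
  have [measurable]: "(\<lambda>(s, \<omega>). case_nat s \<omega>) \<in> measurable (\<mu> \<Otimes>\<^sub>M \<Omega>) \<Omega>" by measurable
  have "(\<integral>\<omega>. F \<omega> \<partial>\<Omega>) = (\<integral>\<omega>. F \<omega> \<partial>distr (\<mu> \<Otimes>\<^sub>M \<Omega>) \<Omega> (\<lambda>(s, \<omega>). case_nat s \<omega>))"
    by (simp only: PiM_iter)
  also have "\<dots> = (\<integral>z. F ((\<lambda>(s, \<omega>). case_nat s \<omega>) z) \<partial>(\<mu> \<Otimes>\<^sub>M \<Omega>))"
    by (rule integral_distr) measurable
  also have "\<dots> = (\<integral>i. (\<integral>\<omega>. F (case_nat i \<omega>) \<partial>\<Omega>) \<partial>\<mu>)"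
    using B by (subst P.integral_fst'[symmetric])
      (auto intro!: P.P.integrable_const_bound[where B = B] simp: case_prod_beta)
  also have "\<dots> = (\<Sum>i<N. p i *\<^sub>R (\<integral>\<omega>. F (case_nat i \<omega>) \<partial>\<Omega>))" by (rule integral_\<mu>)
  finally show ?thesis .
qed

lemma integrable_\<Omega>:
  fixes F :: "(nat \<Rightarrow> nat) \<Rightarrow> 'b::{banach, second_countable_topology}"
  assumes "F \<in> borel_measurable \<Omega>" "\<And>\<omega>. norm (F \<omega>) \<le> B"
  shows "integrable \<Omega> F"
proof -
  interpret \<Omega>: prob_space \<Omega> by (rule prob_space_\<Omega>)
  show ?thesis using assms by (intro \<Omega>.integrable_const_bound[where B = B]) auto
qed

end

text \<open>A solution \<open>h\<close> of Poisson's equation makes the Birkhoff sums of \<open>\<phi>\<close> a martingale up to a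
  bounded error.\<close>

locale poisson_ifs = bernoulli_ifs +
  fixes \<phi> h :: "circle \<Rightarrow> real" and H :: real
  assumes h_cont: "continuous_on UNIV h" and h_bound: "\<bar>h x\<bar> \<le> H"
    and poisson: "\<phi> x = h x - M f h x"
begin

definition incr :: "nat \<Rightarrow> circle \<Rightarrow> real" where
  "incr i x = h (f i x) - M f h x"

text \<open>Telescoping \<open>h\<close> along the orbit shows that this is the sum of the
  increments \<open>incr\<close>. The closed form makes its bounded distance from the Birkhoff sum
  evident.\<close>

definition mart :: "nat \<Rightarrow> (nat \<Rightarrow> nat) \<Rightarrow> circle \<Rightarrow> real" where
  "mart n \<omega> x = birkhoff_sum f \<phi> n \<omega> x + h (rand_iter f \<omega> n x) - h x"

text \<open>The increments have mean zero by \<open>incr_mean\<close>, so this is the conditional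
  variance of the next increment from \<open>x\<close>.\<close>

definition cvar :: "circle \<Rightarrow> real" where
  "cvar x = (\<Sum>i<N. p i * (incr i x)\<^sup>2)"

lemma H_nonneg: "H \<ge> 0"
  using h_bound[of undefined] by linarith

lemma Mh_cont: "continuous_on UNIV (M f h)"
  by (intro M_continuous f_cont h_cont)

lemma Mh_bound: "\<bar>M f h x\<bar> \<le> H"
  using M_iter_bound[of h H 1 f x] h_bound by simp

lemma \<phi>_cont: "continuous_on UNIV \<phi>"
  unfolding poisson[abs_def] by (intro continuous_intros h_cont Mh_cont)

lemma \<phi>_bound: "\<bar>\<phi> x\<bar> \<le> 2 * H"
  using h_bound[of x] Mh_bound[of x] unfolding poisson by linarith

lemma \<phi>_meas [measurable]: "\<phi> \<in> borel_measurable borel"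
  by (rule borel_measurable_continuous_onI[OF \<phi>_cont])

lemma h_meas [measurable]: "h \<in> borel_measurable borel"
  by (rule borel_measurable_continuous_onI[OF h_cont])

lemma incr_bound: "\<bar>incr i x\<bar> \<le> 2 * H"
  using h_bound[of "f i x"] Mh_bound[of x] unfolding incr_def by linarith

lemma incr_mean: "(\<Sum>i<N. p i * incr i x) = 0"
  using p_sum by (simp add: incr_def right_diff_distrib sum_subtractf markov_def flip: sum_distrib_right)

lemma cvar_cont: "continuous_on UNIV cvar"
  unfolding cvar_def incr_def
  by (intro continuous_intros Mh_cont continuous_on_compose2[OF h_cont f_cont]) auto

lemma cvar_meas [measurable]: "cvar \<in> borel_measurable borel"
  by (rule borel_measurable_continuous_onI[OF cvar_cont])

lemma cvar_nonneg: "cvar x \<ge> 0"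
  unfolding cvar_def by (intro sum_nonneg mult_nonneg_nonneg) (auto simp: p_pos less_imp_le)

lemma cvar_bound: "cvar x \<le> 4 * H\<^sup>2"
proof -
  have "(incr i x)\<^sup>2 \<le> 4 * H\<^sup>2" for i
    using power_mono[OF incr_bound abs_ge_zero, of i x 2] by (simp add: power_mult_distrib)
  then have "cvar x \<le> (\<Sum>i<N. p i * (4 * H\<^sup>2))"
    unfolding cvar_def by (intro sum_mono mult_left_mono) (auto simp: p_pos less_imp_le)
  also have "\<dots> = 4 * H\<^sup>2" by (simp add: p_sum flip: sum_distrib_right)
  finally show ?thesis .
qed

lemma mart_0 [simp]: "mart 0 \<omega> x = 0"
  by (simp add: mart_def birkhoff_sum_def)

lemma mart_Suc: "mart (Suc n) (case_nat i \<omega>) x = incr i x + mart n \<omega> (f i x)"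
  unfolding mart_def birkhoff_sum_case_nat rand_iter_case_nat incr_def poisson[of x] by simp

lemma mart_meas: "(\<lambda>\<omega>. mart n \<omega> x) \<in> borel_measurable \<Omega>"
  unfolding mart_def
  by (intro borel_measurable_add borel_measurable_diff borel_measurable_const measurable_birkhoff_sum
      measurable_compose[OF measurable_rand_iter h_meas]) measurable

lemma mart_close: "\<bar>mart n \<omega> x - birkhoff_sum f \<phi> n \<omega> x\<bar> \<le> 2 * H"
  using h_bound[of x] h_bound[of "rand_iter f \<omega> n x"] unfolding mart_def by linarith

lemma birkhoff_\<phi>_bound: "\<bar>birkhoff_sum f \<phi> n \<omega> x\<bar> \<le> real n * (2 * H)"
  by (rule birkhoff_sum_bound) (rule \<phi>_bound)

lemma mart_bound: "\<bar>mart n \<omega> x\<bar> \<le> real n * (2 * H) + 2 * H"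
  using mart_close[of n \<omega> x] birkhoff_\<phi>_bound[of n \<omega> x] by linarith

lemma birkhoff_meas: "\<psi> \<in> borel_measurable borel \<Longrightarrow> (\<lambda>\<omega>. birkhoff_sum f \<psi> n \<omega> x) \<in> borel_measurable \<Omega>"
  by (rule measurable_birkhoff_sum) measurable

lemma mart_integrable: "integrable \<Omega> (\<lambda>\<omega>. mart n \<omega> x)"
  using mart_bound by (intro integrable_\<Omega>[OF mart_meas, where B = "real n * (2 * H) + 2 * H"]) simp

lemma mart_sq_bound: "\<bar>(mart n \<omega> x)\<^sup>2\<bar> \<le> (real n * (2 * H) + 2 * H)\<^sup>2"
  using mart_bound[of n \<omega> x] power_mono[OF mart_bound abs_ge_zero, of n \<omega> x 2] by simp

lemma mart_sq_integrable: "integrable \<Omega> (\<lambda>\<omega>. (mart n \<omega> x)\<^sup>2)"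
  using mart_sq_bound
  by (intro integrable_\<Omega>[OF borel_measurable_power[OF mart_meas], where B = "(real n * (2 * H) + 2 * H)\<^sup>2"]) simp

lemma mart_mean: "(\<integral>\<omega>. mart n \<omega> x \<partial>\<Omega>) = 0"
proof (induction n arbitrary: x)
  case (Suc n)
  interpret \<Omega>: prob_space \<Omega> by (rule prob_space_\<Omega>)
  have "(\<integral>\<omega>. mart (Suc n) \<omega> x \<partial>\<Omega>) = (\<Sum>i<N. p i * (\<integral>\<omega>. incr i x + mart n \<omega> (f i x) \<partial>\<Omega>))"
    using mart_bound by (subst integral_\<Omega>_front[OF mart_meas, where B = "real (Suc n) * (2 * H) + 2 * H"])
      (simp_all add: mart_Suc del: of_nat_Suc)
  also have "\<dots> = (\<Sum>i<N. p i * incr i x)"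
    by (simp add: Suc mart_integrable \<Omega>.prob_space)
  finally show ?case by (simp add: incr_mean)
qed simp

text \<open>Martingale increments are orthogonal: after the first letter is split off, the cross
  term vanishes by \<open>mart_mean\<close>.\<close>

lemma mart_second_moment: "(\<integral>\<omega>. (mart n \<omega> x)\<^sup>2 \<partial>\<Omega>) = (\<Sum>k<n. (M f ^^ k) cvar x)"
proof (induction n arbitrary: x)
  case (Suc n)
  interpret \<Omega>: prob_space \<Omega> by (rule prob_space_\<Omega>)
  have sq_step: "(\<integral>\<omega>. (incr i x + mart n \<omega> (f i x))\<^sup>2 \<partial>\<Omega>) = (incr i x)\<^sup>2 + (\<Sum>k<n. (M f ^^ k) cvar (f i x))" for i
  proof -
    have "(\<integral>\<omega>. (incr i x + mart n \<omega> (f i x))\<^sup>2 \<partial>\<Omega>) =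
        (\<integral>\<omega>. (incr i x)\<^sup>2 + 2 * incr i x * mart n \<omega> (f i x) + (mart n \<omega> (f i x))\<^sup>2 \<partial>\<Omega>)"
      by (intro Bochner_Integration.integral_cong) (auto simp: power2_sum)
    then show ?thesis
      by (simp add: mart_integrable mart_sq_integrable mart_mean Suc \<Omega>.prob_space)
  qed
  have "(\<integral>\<omega>. (mart (Suc n) \<omega> x)\<^sup>2 \<partial>\<Omega>) = (\<Sum>i<N. p i * (\<integral>\<omega>. (incr i x + mart n \<omega> (f i x))\<^sup>2 \<partial>\<Omega>))"
    using mart_sq_bound[of "Suc n"]
    by (subst integral_\<Omega>_front[OF borel_measurable_power[OF mart_meas], where B = "(real (Suc n) * (2 * H) + 2 * H)\<^sup>2"])
      (simp_all add: mart_Suc del: of_nat_Suc)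
  also have "\<dots> = cvar x + M f (\<lambda>y. \<Sum>k<n. (M f ^^ k) cvar y) x"
    unfolding sq_step by (simp add: cvar_def markov_def distrib_left sum.distrib)
  also have "\<dots> = (\<Sum>k<Suc n. (M f ^^ k) cvar x)"
    unfolding M_sum by (subst sum.lessThan_Suc_shift) simp
  finally show ?case .
qed simp

lemma M_iter_cvar_bound: "\<bar>(M f ^^ k) cvar x\<bar> \<le> 4 * H\<^sup>2"
  by (rule M_iter_bound) (use cvar_nonneg cvar_bound in \<open>simp add: abs_le_iff order_trans[of _ 0]\<close>)

lemma mart_second_moment_le: "(\<integral>\<omega>. (mart n \<omega> x)\<^sup>2 \<partial>\<Omega>) \<le> real n * (4 * H\<^sup>2)"
proof -
  have "(\<Sum>k<n. (M f ^^ k) cvar x) \<le> (\<Sum>k<n. 4 * H\<^sup>2)"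
    using M_iter_cvar_bound by (intro sum_mono) (simp add: abs_le_iff)
  then show ?thesis by (simp add: mart_second_moment)
qed

lemma birkhoff_sq_integrable: "integrable \<Omega> (\<lambda>\<omega>. (birkhoff_sum f \<phi> n \<omega> x)\<^sup>2)"
proof (rule integrable_\<Omega>)
  show "norm ((birkhoff_sum f \<phi> n \<omega> x)\<^sup>2) \<le> (real n * (2 * H))\<^sup>2" for \<omega>
    using power_mono[OF birkhoff_\<phi>_bound[of n \<omega> x] abs_ge_zero, of 2] by simp
qed (intro borel_measurable_power birkhoff_meas \<phi>_meas)

lemma birkhoff_second_moment:
  assumes "n \<ge> 1"
  shows "\<bar>(\<integral>\<omega>. (birkhoff_sum f \<phi> n \<omega> x)\<^sup>2 \<partial>\<Omega>) - (\<Sum>k<n. (M f ^^ k) cvar x)\<bar>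
    \<le> 2 * H * (4 * H\<^sup>2 + 1) * sqrt n + 4 * H\<^sup>2"
proof -
  interpret \<Omega>: prob_space \<Omega> by (rule prob_space_\<Omega>)
  have sn: "sqrt n > 0" using assms by simp
  have pw: "\<bar>(birkhoff_sum f \<phi> n \<omega> x)\<^sup>2 - (mart n \<omega> x)\<^sup>2\<bar>
      \<le> 2 * H / sqrt n * (mart n \<omega> x)\<^sup>2 + (2 * H * sqrt n + 4 * H\<^sup>2)" for \<omega>
  proof -
    define m r where "m = mart n \<omega> x" and "r = mart n \<omega> x - birkhoff_sum f \<phi> n \<omega> x"
    have r: "\<bar>r\<bar> \<le> 2 * H" using mart_close by (simp add: r_def)
    \<comment> \<open>The weight sqrt n balances the cross term: since the second moment of
      \<open>mart\<close> is O(n), both m^2 / sqrt n in mean and sqrt n are O(sqrt n).\<close>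
    have "0 \<le> (\<bar>m\<bar> - sqrt n)\<^sup>2" by simp
    then have "2 * \<bar>m\<bar> * sqrt n \<le> m\<^sup>2 + n" by (simp add: power2_diff)
    then have "2 * \<bar>m\<bar> * sqrt n / sqrt n \<le> (m\<^sup>2 + n) / sqrt n" using sn by (intro divide_right_mono) auto
    then have m: "2 * \<bar>m\<bar> \<le> m\<^sup>2 / sqrt n + sqrt n"
      using sn by (simp add: add_divide_distrib real_div_sqrt)
    have "\<bar>(m - r)\<^sup>2 - m\<^sup>2\<bar> = \<bar>r\<^sup>2 - (2 * m) * r\<bar>" by (simp add: power2_diff algebra_simps)
    also have "\<dots> \<le> \<bar>r\<bar>\<^sup>2 + (2 * \<bar>m\<bar>) * \<bar>r\<bar>"
      using abs_triangle_ineq4[of "r\<^sup>2" "(2 * m) * r"] by (simp add: abs_mult)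
    also have "\<dots> \<le> (2 * H)\<^sup>2 + (m\<^sup>2 / sqrt n + sqrt n) * (2 * H)"
      using r m sn H_nonneg by (intro add_mono power_mono mult_mono) auto
    finally show ?thesis
      by (simp add: m_def r_def algebra_simps power_mult_distrib)
  qed
  have "\<bar>(\<integral>\<omega>. (birkhoff_sum f \<phi> n \<omega> x)\<^sup>2 \<partial>\<Omega>) - (\<integral>\<omega>. (mart n \<omega> x)\<^sup>2 \<partial>\<Omega>)\<bar>
      = \<bar>\<integral>\<omega>. (birkhoff_sum f \<phi> n \<omega> x)\<^sup>2 - (mart n \<omega> x)\<^sup>2 \<partial>\<Omega>\<bar>"
    by (simp add: birkhoff_sq_integrable mart_sq_integrable)
  also have "\<dots> \<le> (\<integral>\<omega>. \<bar>(birkhoff_sum f \<phi> n \<omega> x)\<^sup>2 - (mart n \<omega> x)\<^sup>2\<bar> \<partial>\<Omega>)"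
    by (rule integral_abs_bound)
  also have "\<dots> \<le> (\<integral>\<omega>. 2 * H / sqrt n * (mart n \<omega> x)\<^sup>2 + (2 * H * sqrt n + 4 * H\<^sup>2) \<partial>\<Omega>)"
    by (intro integral_mono pw integrable_abs Bochner_Integration.integrable_diff
        Bochner_Integration.integrable_add integrable_mult_right birkhoff_sq_integrable
        mart_sq_integrable \<Omega>.integrable_const)
  also have "\<dots> = 2 * H / sqrt n * (\<integral>\<omega>. (mart n \<omega> x)\<^sup>2 \<partial>\<Omega>) + (2 * H * sqrt n + 4 * H\<^sup>2)"
    by (simp add: mart_sq_integrable \<Omega>.prob_space)
  also have "\<dots> \<le> 2 * H / sqrt n * (real n * (4 * H\<^sup>2)) + (2 * H * sqrt n + 4 * H\<^sup>2)"
    using H_nonneg by (intro add_right_mono mult_left_mono mart_second_moment_le) auto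
  also have "2 * H / sqrt n * (real n * (4 * H\<^sup>2)) = 2 * H * (4 * H\<^sup>2) * sqrt n"
  proof -
    have "2 * H / s * (s * s * (4 * H\<^sup>2)) = 2 * H * (4 * H\<^sup>2) * s" if "s > 0" for s :: real
      using that by simp
    from this[OF sn] show ?thesis by simp
  qed
  finally show ?thesis by (simp add: mart_second_moment algebra_simps)
qed

text \<open>Second moments of Birkhoff sums are O(n), so along squares the normalized second moments
  are summable. The sum of the normalized squares is then finite almost surely, and boundedness of
  \<phi> fills the gaps.\<close>

lemma slln_zero: "AE \<omega> in \<Omega>. (\<lambda>n. birkhoff_sum f \<phi> n \<omega> x / real n) \<longlonglongrightarrow> 0"
proof -
  interpret \<Omega>: prob_space \<Omega> by (rule prob_space_\<Omega>)
  \<comment> \<open>The index starts at 1 to keep the denominators positive; the shift is undone by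
    \<open>LIMSEQ_imp_Suc\<close>.\<close>
  define a where "a m \<omega> = (birkhoff_sum f \<phi> ((Suc m)\<^sup>2) \<omega> x / real ((Suc m)\<^sup>2))\<^sup>2" for m \<omega>
  have a_eq: "a m \<omega> = (1 / real (Suc m) ^ 4) * (birkhoff_sum f \<phi> ((Suc m)\<^sup>2) \<omega> x)\<^sup>2" for m \<omega>
    by (simp add: a_def power_divide flip: power_mult)
  have ai: "integrable \<Omega> (a m)" for m
    unfolding a_eq[abs_def] by (intro integrable_mult_right birkhoff_sq_integrable)
  have [measurable]: "a m \<in> borel_measurable \<Omega>" for m using ai by auto
  have E: "(\<integral>\<omega>. a m \<omega> \<partial>\<Omega>) \<le> 16 * H\<^sup>2 * (1 / real (Suc m) ^ 2)" for m
  proof -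
    define n where "n = (Suc m)\<^sup>2"
    have n: "n \<ge> 1" by (simp add: n_def)
    have "(\<integral>\<omega>. (birkhoff_sum f \<phi> n \<omega> x)\<^sup>2 \<partial>\<Omega>) \<le> (\<integral>\<omega>. 2 * (mart n \<omega> x)\<^sup>2 + 8 * H\<^sup>2 \<partial>\<Omega>)"
    proof (intro integral_mono birkhoff_sq_integrable)
      fix \<omega>
      define r where "r = mart n \<omega> x - birkhoff_sum f \<phi> n \<omega> x"
      have "r\<^sup>2 \<le> (2 * H)\<^sup>2"
        using power_mono[OF mart_close[of n \<omega> x] abs_ge_zero, of 2] by (simp add: r_def)
      moreover have "0 \<le> (mart n \<omega> x + r)\<^sup>2" by simp
      moreover have "birkhoff_sum f \<phi> n \<omega> x = mart n \<omega> x - r" by (simp add: r_def)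
      ultimately show "(birkhoff_sum f \<phi> n \<omega> x)\<^sup>2 \<le> 2 * (mart n \<omega> x)\<^sup>2 + 8 * H\<^sup>2"
        by (simp add: power2_sum power2_diff power_mult_distrib)
    qed (simp add: mart_sq_integrable)
    also have "\<dots> = 2 * (\<integral>\<omega>. (mart n \<omega> x)\<^sup>2 \<partial>\<Omega>) + 8 * H\<^sup>2"
      by (simp add: mart_sq_integrable \<Omega>.prob_space)
    also have "\<dots> \<le> 2 * (real n * (4 * H\<^sup>2)) + real n * (8 * H\<^sup>2)"
      using n mult_right_mono[of 1 "real n" "8 * H\<^sup>2"]
      by (intro add_mono mult_left_mono mart_second_moment_le) auto
    finally have "(\<integral>\<omega>. (birkhoff_sum f \<phi> n \<omega> x)\<^sup>2 \<partial>\<Omega>) \<le> 16 * H\<^sup>2 * real (Suc m) ^ 2"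
      by (simp add: n_def mult_ac)
    then have "(1 / real (Suc m) ^ 4) * (\<integral>\<omega>. (birkhoff_sum f \<phi> n \<omega> x)\<^sup>2 \<partial>\<Omega>)
        \<le> (1 / real (Suc m) ^ 4) * (16 * H\<^sup>2 * real (Suc m) ^ 2)"
      by (intro mult_left_mono) auto
    also have "\<dots> = 16 * H\<^sup>2 * (1 / real (Suc m) ^ 2)"
      by (simp add: power4_eq_xxxx power2_eq_square)
    finally show ?thesis by (simp add: a_eq n_def)
  qed
  have "summable (\<lambda>m. 1 / real (Suc m) ^ 2)"
    using inverse_power_summable[of 2, where 'a = real] summable_Suc_iff[of "\<lambda>m. inverse (real m ^ 2)"]
    by (simp add: inverse_eq_divide)
  then have sm: "summable (\<lambda>m. 16 * H\<^sup>2 * (1 / real (Suc m) ^ 2))" by (rule summable_mult)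
  have "(\<integral>\<^sup>+\<omega>. (\<Sum>m. ennreal (a m \<omega>)) \<partial>\<Omega>) = (\<Sum>m. \<integral>\<^sup>+\<omega>. ennreal (a m \<omega>) \<partial>\<Omega>)"
    by (rule nn_integral_suminf) measurable
  also have "\<dots> = (\<Sum>m. ennreal (\<integral>\<omega>. a m \<omega> \<partial>\<Omega>))"
    by (intro suminf_cong nn_integral_eq_integral ai) (simp add: a_def)
  also have "\<dots> \<le> (\<Sum>m. ennreal (16 * H\<^sup>2 * (1 / real (Suc m) ^ 2)))"
    by (intro suminf_le ennreal_leI E) auto
  also have "\<dots> = ennreal (\<Sum>m. 16 * H\<^sup>2 * (1 / real (Suc m) ^ 2))"
    by (intro suminf_ennreal2 sm) auto
  also have "\<dots> < \<infinity>" by simp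
  finally have "(\<integral>\<^sup>+\<omega>. (\<Sum>m. ennreal (a m \<omega>)) \<partial>\<Omega>) \<noteq> \<infinity>" by simp
  then have "AE \<omega> in \<Omega>. (\<Sum>m. ennreal (a m \<omega>)) \<noteq> \<infinity>"
    by (intro nn_integral_PInf_AE) measurable
  then show ?thesis
  proof eventually_elim
    case (elim \<omega>)
    have "summable (\<lambda>m. a m \<omega>)"
      using elim by (intro summable_suminf_not_top) (auto simp: a_def)
    then have "(\<lambda>m. a m \<omega>) \<longlonglongrightarrow> 0" by (rule summable_LIMSEQ_zero)
    then have "(\<lambda>m. sqrt (a m \<omega>)) \<longlonglongrightarrow> sqrt 0" by (rule tendsto_real_sqrt)
    then have "(\<lambda>m. birkhoff_sum f \<phi> ((Suc m)\<^sup>2) \<omega> x / real ((Suc m)\<^sup>2)) \<longlonglongrightarrow> 0"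
      unfolding a_def real_sqrt_abs real_sqrt_zero by (rule tendsto_rabs_zero_cancel)
    then have "(\<lambda>m. birkhoff_sum f \<phi> (m\<^sup>2) \<omega> x / real (m\<^sup>2)) \<longlonglongrightarrow> 0"
      by (rule LIMSEQ_imp_Suc)
    then show ?case
      by (intro average_limit_from_squares[where b = "2 * H"])
        (simp_all add: birkhoff_sum_def \<phi>_bound)
  qed
qed

end

section \<open>The central limit theorem\<close>

lemma iexp_lipschitz: "cmod (iexp a - iexp b) \<le> \<bar>a - b\<bar>"
proof -
  have "iexp a - iexp b = iexp b * (iexp (a - b) - 1)"
    by (simp add: algebra_simps flip: exp_add)
  then have "cmod (iexp a - iexp b) = cmod (iexp (a - b) - 1)"
    by (simp add: norm_mult)
  also have "\<dots> \<le> \<bar>a - b\<bar>" using iexp_approx1[of "a - b" 0] by simp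
  finally show ?thesis .
qed

context poisson_ifs
begin

text \<open>The factor compensating the conditional variances makes the expectation of \<open>expo\<close> nearly
  constant.\<close>

definition expo :: "real \<Rightarrow> nat \<Rightarrow> (nat \<Rightarrow> nat) \<Rightarrow> circle \<Rightarrow> complex" where
  "expo s n \<omega> x = exp (\<i> * complex_of_real (s * mart n \<omega> x)
    + complex_of_real (s\<^sup>2 / 2 * birkhoff_sum f cvar n \<omega> x))"

definition expo_step :: "real \<Rightarrow> nat \<Rightarrow> circle \<Rightarrow> complex" where
  "expo_step s i x = exp (\<i> * complex_of_real (s * incr i x) + complex_of_real (s\<^sup>2 / 2 * cvar x))"

lemma expo_meas: "(\<lambda>\<omega>. expo s n \<omega> x) \<in> borel_measurable \<Omega>"
proof -
  have [measurable]: "(\<lambda>\<omega>. mart n \<omega> x) \<in> borel_measurable \<Omega>"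
    "(\<lambda>\<omega>. birkhoff_sum f cvar n \<omega> x) \<in> borel_measurable \<Omega>"
    by (rule mart_meas, rule birkhoff_meas[OF cvar_meas])
  show ?thesis unfolding expo_def by measurable
qed

lemma expo_norm: "cmod (expo s n \<omega> x) \<le> exp (real n * (2 * H\<^sup>2 * s\<^sup>2))"
proof -
  have "birkhoff_sum f cvar n \<omega> x \<le> real n * (4 * H\<^sup>2)"
    using birkhoff_sum_bound[of cvar "4 * H\<^sup>2" f n \<omega> x] cvar_nonneg cvar_bound by simp
  then have "s\<^sup>2 / 2 * birkhoff_sum f cvar n \<omega> x \<le> s\<^sup>2 / 2 * (real n * (4 * H\<^sup>2))"
    by (intro mult_left_mono) auto
  then show ?thesis by (simp add: expo_def algebra_simps)
qed

lemma expo_integrable: "integrable \<Omega> (\<lambda>\<omega>. expo s n \<omega> x)"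
  by (rule integrable_\<Omega>[OF expo_meas expo_norm])

lemma expo_Suc: "expo s (Suc n) (case_nat i \<omega>) x = expo_step s i x * expo s n \<omega> (f i x)"
  unfolding expo_def expo_step_def mart_Suc birkhoff_sum_case_nat
  by (simp add: algebra_simps flip: exp_add)

lemma expo_step_norm: "cmod (expo_step s i x) \<le> exp (2 * H\<^sup>2 * s\<^sup>2)"
proof -
  have "s\<^sup>2 / 2 * cvar x \<le> s\<^sup>2 / 2 * (4 * H\<^sup>2)" by (intro mult_left_mono cvar_bound) auto
  then show ?thesis by (simp add: expo_step_def algebra_simps)
qed

text \<open>Collects the two errors of \<open>expo_step_mean\<close>: the cubic Taylor remainder
  with increments bounded by 2 H, and w^2, where w is half of s^2 times the conditional variance.
  The exponential bounds exp w.\<close>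

definition clt_const :: real where
  "clt_const = exp (2 * H\<^sup>2) * (2 * H ^ 3 + 4 * H ^ 4)"

lemma clt_const_nonneg: "clt_const \<ge> 0"
  using H_nonneg by (simp add: clt_const_def)

text \<open>Without compensation the mean is 1 - w + O(|s|^3), because the linear term averages to
  zero; multiplying by exp w gives 1 + O(w^2) plus the same order, and w is O(s^2).\<close>

lemma expo_step_mean:
  assumes "\<bar>s\<bar> \<le> 1"
  shows "cmod ((\<Sum>i<N. p i *\<^sub>R expo_step s i x) - 1) \<le> clt_const * \<bar>s\<bar> ^ 3"
proof -
  define w where "w = s\<^sup>2 / 2 * cvar x"
  have s2: "s\<^sup>2 \<le> 1" using assms by (simp add: abs_square_le_1)
  have w0: "0 \<le> w" using cvar_nonneg by (simp add: w_def)
  have "w \<le> s\<^sup>2 / 2 * (4 * H\<^sup>2)" unfolding w_def by (intro mult_left_mono cvar_bound) auto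
  then have w1: "w \<le> s\<^sup>2 * (2 * H\<^sup>2)" by (simp add: mult_ac)
  also have "\<dots> \<le> 1 * (2 * H\<^sup>2)" using s2 by (intro mult_right_mono) auto
  finally have w2: "w \<le> 2 * H\<^sup>2" by simp
  have "w\<^sup>2 \<le> (s\<^sup>2 * (2 * H\<^sup>2))\<^sup>2" using w0 w1 by (rule power_mono[rotated])
  also have "\<dots> = \<bar>s\<bar> ^ 4 * (4 * H ^ 4)"
    by (simp add: power_mult_distrib flip: power_mult)
  also have "\<dots> \<le> \<bar>s\<bar> ^ 3 * (4 * H ^ 4)"
    using assms H_nonneg by (intro mult_right_mono power_decreasing) auto
  finally have ww: "w\<^sup>2 \<le> 4 * H ^ 4 * \<bar>s\<bar> ^ 3" by (simp add: mult_ac)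
  define T where "T z = 1 + \<i> * complex_of_real z - complex_of_real (z\<^sup>2 / 2)" for z :: real
  have T: "cmod (iexp z - T z) \<le> \<bar>z\<bar> ^ 3 / 6" for z
  proof -
    have "(\<Sum>k\<le>2. (\<i> * complex_of_real z) ^ k / fact k) = T z"
    proof -
      have "{..2::nat} = {0, 1, 2}" by auto
      then show ?thesis by (simp add: T_def power_mult_distrib)
    qed
    then show ?thesis using iexp_approx1[of z 2] by (simp add: fact_numeral)
  qed
  have Tsum: "(\<Sum>i<N. p i *\<^sub>R T (s * incr i x)) = complex_of_real (1 - w)"
  proof -
    have "(\<Sum>i<N. p i *\<^sub>R T (s * incr i x)) = complex_of_real (\<Sum>i<N. p i)
        + \<i> * complex_of_real (s * (\<Sum>i<N. p i * incr i x))
        - complex_of_real (s\<^sup>2 / 2 * (\<Sum>i<N. p i * (incr i x)\<^sup>2))"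
      by (simp add: T_def scaleR_conv_of_real sum.distrib sum_subtractf sum_distrib_left
          algebra_simps power_mult_distrib)
    then show ?thesis by (simp add: p_sum incr_mean w_def cvar_def)
  qed
  have "(\<Sum>i<N. p i *\<^sub>R expo_step s i x) = exp w *\<^sub>R (\<Sum>i<N. p i *\<^sub>R iexp (s * incr i x))"
    unfolding expo_step_def w_def[symmetric]
    by (simp add: exp_add sum_distrib_left scaleR_conv_of_real exp_of_real mult_ac)
  also have "\<dots> = exp w *\<^sub>R (\<Sum>i<N. p i *\<^sub>R (iexp (s * incr i x) - T (s * incr i x))) + exp w *\<^sub>R complex_of_real (1 - w)"
    unfolding Tsum[symmetric] by (simp add: scaleR_right_diff_distrib sum_subtractf)
  finally have eq: "(\<Sum>i<N. p i *\<^sub>R expo_step s i x) - 1 =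
      exp w *\<^sub>R (\<Sum>i<N. p i *\<^sub>R (iexp (s * incr i x) - T (s * incr i x))) + complex_of_real (exp w * (1 - w) - 1)"
    by (simp add: scaleR_conv_of_real)
  have "cmod (\<Sum>i<N. p i *\<^sub>R (iexp (s * incr i x) - T (s * incr i x))) \<le> (\<Sum>i<N. p i * (2 * H ^ 3 * \<bar>s\<bar> ^ 3))"
  proof (rule order_trans[OF norm_sum], rule sum_mono)
    fix i assume "i \<in> {..<N}"
    then have pi: "p i > 0" using p_pos by simp
    have "cmod (iexp (s * incr i x) - T (s * incr i x)) \<le> \<bar>s\<bar> ^ 3 * \<bar>incr i x\<bar> ^ 3 / 6"
      using T[of "s * incr i x"] by (simp add: abs_mult power_mult_distrib)
    also have "\<dots> \<le> \<bar>s\<bar> ^ 3 * (2 * H) ^ 3 / 6"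
      by (intro divide_right_mono mult_left_mono power_mono incr_bound) auto
    also have "\<dots> \<le> 2 * H ^ 3 * \<bar>s\<bar> ^ 3"
      using H_nonneg by (simp add: power_mult_distrib)
    finally show "cmod (p i *\<^sub>R (iexp (s * incr i x) - T (s * incr i x))) \<le> p i * (2 * H ^ 3 * \<bar>s\<bar> ^ 3)"
      using pi by (simp add: mult_left_mono)
  qed
  also have "\<dots> = 2 * H ^ 3 * \<bar>s\<bar> ^ 3" by (simp add: p_sum flip: sum_distrib_right)
  finally have "cmod (exp w *\<^sub>R (\<Sum>i<N. p i *\<^sub>R (iexp (s * incr i x) - T (s * incr i x)))) \<le> exp w * (2 * H ^ 3 * \<bar>s\<bar> ^ 3)"
    by simp
  moreover have "\<bar>exp w * (1 - w) - 1\<bar> \<le> exp w * (4 * H ^ 4 * \<bar>s\<bar> ^ 3)"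
  proof -
    have "exp w * (1 - w) - 1 = exp w * (1 - w - exp (- w))"
      by (simp add: right_diff_distrib flip: exp_add)
    then have "\<bar>exp w * (1 - w) - 1\<bar> = exp w * \<bar>1 - w - exp (- w)\<bar>"
      by (simp add: abs_mult)
    also have "\<bar>1 - w - exp (- w)\<bar> \<le> w\<^sup>2"
      using exp_le_quadratic[of "- w"] exp_ge_add_one_self[of "- w"] w0 by simp
    also have "\<dots> \<le> 4 * H ^ 4 * \<bar>s\<bar> ^ 3" by (rule ww)
    finally show ?thesis by simp
  qed
  ultimately have "cmod ((\<Sum>i<N. p i *\<^sub>R expo_step s i x) - 1)
      \<le> exp w * (2 * H ^ 3 * \<bar>s\<bar> ^ 3) + exp w * (4 * H ^ 4 * \<bar>s\<bar> ^ 3)"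
    unfolding eq by (intro norm_triangle_le add_mono) (simp_all only: norm_of_real)
  also have "\<dots> = exp w * ((2 * H ^ 3 + 4 * H ^ 4) * \<bar>s\<bar> ^ 3)" by (simp add: algebra_simps)
  also have "\<dots> \<le> exp (2 * H\<^sup>2) * ((2 * H ^ 3 + 4 * H ^ 4) * \<bar>s\<bar> ^ 3)"
    using w2 H_nonneg by (intro mult_right_mono) auto
  finally show ?thesis by (simp add: clt_const_def mult.assoc)
qed

text \<open>Induction over the first letter: each step adds one error of
  \<open>expo_step_mean\<close> and multiplies the old ones by at most exp (2 H^2 s^2). For s = t /
  sqrt n the total is O(1 / sqrt n).\<close>

lemma expo_mean:
  assumes "\<bar>s\<bar> \<le> 1"
  shows "cmod ((\<integral>\<omega>. expo s n \<omega> x \<partial>\<Omega>) - 1) \<le> real n * (clt_const * \<bar>s\<bar> ^ 3) * exp (real n * (2 * H\<^sup>2 * s\<^sup>2))"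
proof (induction n arbitrary: x)
  case 0
  interpret \<Omega>: prob_space \<Omega> by (rule prob_space_\<Omega>)
  show ?case by (simp add: expo_def birkhoff_sum_def \<Omega>.prob_space)
next
  case (Suc n)
  define b e where "b = 2 * H\<^sup>2 * s\<^sup>2" and "e = clt_const * \<bar>s\<bar> ^ 3"
  have b: "b \<ge> 0" and e: "e \<ge> 0" using clt_const_nonneg by (auto simp: b_def e_def)
  let ?E = "\<lambda>x. \<integral>\<omega>. expo s n \<omega> x \<partial>\<Omega>"
  have "(\<integral>\<omega>. expo s (Suc n) \<omega> x \<partial>\<Omega>) = (\<Sum>i<N. p i *\<^sub>R (\<integral>\<omega>. expo s (Suc n) (case_nat i \<omega>) x \<partial>\<Omega>))"
    by (rule integral_\<Omega>_front[OF expo_meas expo_norm])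
  also have "\<dots> = (\<Sum>i<N. p i *\<^sub>R (expo_step s i x * ?E (f i x)))"
    unfolding expo_Suc by (simp add: expo_integrable)
  finally have "(\<integral>\<omega>. expo s (Suc n) \<omega> x \<partial>\<Omega>) - 1 =
      (\<Sum>i<N. p i *\<^sub>R (expo_step s i x * (?E (f i x) - 1))) + ((\<Sum>i<N. p i *\<^sub>R expo_step s i x) - 1)"
    by (simp add: right_diff_distrib scaleR_right_diff_distrib sum_subtractf)
  moreover have "cmod (\<Sum>i<N. p i *\<^sub>R (expo_step s i x * (?E (f i x) - 1)))
      \<le> (\<Sum>i<N. p i * (exp b * (real n * e * exp (real n * b))))"
  proof (rule order_trans[OF norm_sum], rule sum_mono)
    fix i assume "i \<in> {..<N}"
    then have pi: "p i > 0" using p_pos by simp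
    have "cmod (expo_step s i x * (?E (f i x) - 1)) \<le> exp b * (real n * e * exp (real n * b))"
      unfolding norm_mult b_def e_def by (intro mult_mono expo_step_norm Suc.IH) auto
    then show "cmod (p i *\<^sub>R (expo_step s i x * (?E (f i x) - 1))) \<le> p i * (exp b * (real n * e * exp (real n * b)))"
      using pi by (simp add: mult_left_mono)
  qed
  moreover have "(\<Sum>i<N. p i * (exp b * (real n * e * exp (real n * b)))) = real n * e * exp (real (Suc n) * b)"
    by (simp add: p_sum distrib_right exp_add flip: sum_distrib_right)
  moreover have "cmod ((\<Sum>i<N. p i *\<^sub>R expo_step s i x) - 1) \<le> e * exp (real (Suc n) * b)"
  proof -
    have "1 \<le> exp (real (Suc n) * b)" using b by simp
    then have "e * 1 \<le> e * exp (real (Suc n) * b)" using e by (rule mult_left_mono)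
    moreover have "cmod ((\<Sum>i<N. p i *\<^sub>R expo_step s i x) - 1) \<le> e"
      unfolding e_def by (rule expo_step_mean[OF assms])
    ultimately show ?thesis by linarith
  qed
  ultimately have "cmod ((\<integral>\<omega>. expo s (Suc n) \<omega> x \<partial>\<Omega>) - 1)
      \<le> real n * e * exp (real (Suc n) * b) + e * exp (real (Suc n) * b)"
    by (simp only:) (intro norm_triangle_le add_mono)
  also have "\<dots> = real (Suc n) * e * exp (real (Suc n) * b)"
    by (simp add: distrib_right)
  finally show ?case unfolding b_def e_def .
qed

text \<open>The compensating factor in \<open>expo\<close> is random, but by hypothesis it converges
  almost surely to a constant. Dominated convergence replaces it by that constant, which can then be
  divided out of the expectation.\<close>

lemma clt:
  assumes V: "AE \<omega> in \<Omega>. (\<lambda>n. birkhoff_sum f cvar n \<omega> x / real n) \<longlonglongrightarrow> \<sigma>2" and "\<sigma>2 \<ge> 0"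
  shows "weak_conv_m (\<lambda>n. distr \<Omega> borel (\<lambda>\<omega>. 1 / sqrt (real n) * birkhoff_sum f \<phi> n \<omega> x)) (normal_law \<sigma>2)"
proof (rule levy_continuity)
  interpret \<Omega>: prob_space \<Omega> by (rule prob_space_\<Omega>)
  have [measurable]: "(\<lambda>\<omega>. birkhoff_sum f \<phi> n \<omega> x) \<in> borel_measurable \<Omega>"
    "(\<lambda>\<omega>. birkhoff_sum f cvar n \<omega> x) \<in> borel_measurable \<Omega>"
    "(\<lambda>\<omega>. mart n \<omega> x) \<in> borel_measurable \<Omega>" "(\<lambda>\<omega>. expo s n \<omega> x) \<in> borel_measurable \<Omega>" for n s
    by (rule birkhoff_meas[OF \<phi>_meas] birkhoff_meas[OF cvar_meas] mart_meas expo_meas)+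
  show "real_distribution (distr \<Omega> borel (\<lambda>\<omega>. 1 / sqrt (real n) * birkhoff_sum f \<phi> n \<omega> x))" for n
    by (intro \<Omega>.real_distribution_distr) measurable
  show "real_distribution (normal_law \<sigma>2)" by (rule real_distribution_normal_law) fact
  fix t :: real
  define s where "s n = t / sqrt (real n)" for n
  let ?S = "\<lambda>n \<omega>. iexp (s n * birkhoff_sum f \<phi> n \<omega> x)" and ?Z = "\<lambda>n \<omega>. iexp (s n * mart n \<omega> x)"
    and ?V = "\<lambda>n \<omega>. birkhoff_sum f cvar n \<omega> x / real n"
  \<comment> \<open>Both the almost sure limit of the compensating factor and the reciprocal of the
    characteristic function to be reached.\<close>
  define E where "E = exp (\<sigma>2 * t\<^sup>2 / 2)"
  have E: "E > 0" by (simp add: E_def)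
  have sqrt_lim: "(\<lambda>n. c / sqrt (real n)) \<longlonglongrightarrow> 0" for c
    by (intro tendsto_divide_0[OF tendsto_const] filterlim_at_top_imp_at_infinity
        filterlim_compose[OF sqrt_at_top filterlim_real_sequentially])
  have s2: "real n * (2 * H\<^sup>2 * (s n)\<^sup>2) \<le> 2 * H\<^sup>2 * t\<^sup>2" for n
    by (cases "n = 0") (simp_all add: s_def power_divide)
  have lim1: "(\<lambda>n. \<integral>\<omega>. expo (s n) n \<omega> x \<partial>\<Omega>) \<longlonglongrightarrow> 1"
  proof (rule LIM_zero_cancel, rule Lim_null_comparison)
    show "(\<lambda>n. (clt_const * \<bar>t\<bar> ^ 3 * exp (2 * H\<^sup>2 * t\<^sup>2)) / sqrt (real n)) \<longlonglongrightarrow> 0" by (rule sqrt_lim)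
    have "\<forall>\<^sub>F n in sequentially. \<bar>s n\<bar> < 1"
      using tendsto_rabs[OF sqrt_lim[of t]] unfolding s_def by (intro order_tendstoD) auto
    then show "\<forall>\<^sub>F n in sequentially. cmod ((\<integral>\<omega>. expo (s n) n \<omega> x \<partial>\<Omega>) - 1)
        \<le> (clt_const * \<bar>t\<bar> ^ 3 * exp (2 * H\<^sup>2 * t\<^sup>2)) / sqrt (real n)"
      using eventually_gt_at_top[of 0]
    proof eventually_elim
      case (elim n)
      have r: "real n * \<bar>s n\<bar> ^ 3 = \<bar>t\<bar> ^ 3 / sqrt (real n)"
      proof -
        have "a\<^sup>2 * (\<bar>t\<bar> / a) ^ 3 = \<bar>t\<bar> ^ 3 / a" if "a > 0" for a :: real
          using that by (simp add: power_divide power2_eq_square power3_eq_cube)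
        from this[of "sqrt (real n)"] show ?thesis using elim(2) by (simp add: s_def abs_divide)
      qed
      have "cmod ((\<integral>\<omega>. expo (s n) n \<omega> x \<partial>\<Omega>) - 1)
          \<le> real n * (clt_const * \<bar>s n\<bar> ^ 3) * exp (real n * (2 * H\<^sup>2 * (s n)\<^sup>2))"
        using elim by (intro expo_mean) auto
      also have "\<dots> \<le> real n * (clt_const * \<bar>s n\<bar> ^ 3) * exp (2 * H\<^sup>2 * t\<^sup>2)"
        using s2[of n] clt_const_nonneg by (intro mult_left_mono) auto
      also have "\<dots> = clt_const * (real n * \<bar>s n\<bar> ^ 3) * exp (2 * H\<^sup>2 * t\<^sup>2)" by simp
      finally show ?case unfolding r by simp
    qed
  qed
  have expo_eq: "expo (s n) n \<omega> x = exp ((s n)\<^sup>2 / 2 * birkhoff_sum f cvar n \<omega> x) *\<^sub>R ?Z n \<omega>" for n \<omega>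
    by (simp add: expo_def exp_add scaleR_conv_of_real flip: exp_of_real)
  have lim2: "(\<lambda>n. \<integral>\<omega>. E *\<^sub>R ?Z n \<omega> - expo (s n) n \<omega> x \<partial>\<Omega>) \<longlonglongrightarrow> (\<integral>\<omega>. 0 \<partial>\<Omega>)"
  proof (rule integral_dominated_convergence[where w = "\<lambda>_. E + exp (2 * H\<^sup>2 * t\<^sup>2)"])
    show "AE \<omega> in \<Omega>. (\<lambda>n. E *\<^sub>R ?Z n \<omega> - expo (s n) n \<omega> x) \<longlonglongrightarrow> 0"
      using V
    proof eventually_elim
      case (elim \<omega>)
      have "(\<lambda>n. E - exp (t\<^sup>2 / 2 * ?V n \<omega>)) \<longlonglongrightarrow> E - exp (t\<^sup>2 / 2 * \<sigma>2)"
        by (intro tendsto_intros elim)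
      then have "(\<lambda>n. E - exp (t\<^sup>2 / 2 * ?V n \<omega>)) \<longlonglongrightarrow> 0"
        by (simp add: E_def mult.commute)
      then have "(\<lambda>n. \<bar>E - exp (t\<^sup>2 / 2 * ?V n \<omega>)\<bar>) \<longlonglongrightarrow> 0"
        by (rule tendsto_rabs_zero)
      then show ?case
      proof (rule Lim_null_comparison[rotated])
        show "\<forall>\<^sub>F n in sequentially. cmod (E *\<^sub>R ?Z n \<omega> - expo (s n) n \<omega> x)
            \<le> \<bar>E - exp (t\<^sup>2 / 2 * ?V n \<omega>)\<bar>"
        proof (intro always_eventually allI)
          fix n
          have "(s n)\<^sup>2 / 2 * birkhoff_sum f cvar n \<omega> x = t\<^sup>2 / 2 * ?V n \<omega>"
            by (simp add: s_def power_divide)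
          then have "E *\<^sub>R ?Z n \<omega> - expo (s n) n \<omega> x =
              (E - exp (t\<^sup>2 / 2 * ?V n \<omega>)) *\<^sub>R ?Z n \<omega>"
            unfolding expo_eq by (simp add: scaleR_left_diff_distrib)
          then show "cmod (E *\<^sub>R ?Z n \<omega> - expo (s n) n \<omega> x)
            \<le> \<bar>E - exp (t\<^sup>2 / 2 * ?V n \<omega>)\<bar>" by simp
        qed
      qed
    qed
    show "AE \<omega> in \<Omega>. norm (E *\<^sub>R ?Z n \<omega> - expo (s n) n \<omega> x) \<le> E + exp (2 * H\<^sup>2 * t\<^sup>2)" for n
    proof (rule AE_I2)
      fix \<omega>
      have "cmod (expo (s n) n \<omega> x) \<le> exp (2 * H\<^sup>2 * t\<^sup>2)"
        by (rule order_trans[OF expo_norm]) (simp only: exp_le_cancel_iff s2)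
      moreover have "cmod (E *\<^sub>R ?Z n \<omega>) \<le> E" using E by simp
      ultimately show "norm (E *\<^sub>R ?Z n \<omega> - expo (s n) n \<omega> x) \<le> E + exp (2 * H\<^sup>2 * t\<^sup>2)"
        by (intro order_trans[OF norm_triangle_ineq4] add_mono)
    qed
  qed (auto simp del: times_divide_eq_left)
  have int_iexp: "integrable \<Omega> (\<lambda>\<omega>. iexp (Y \<omega>))" if [measurable]: "Y \<in> borel_measurable \<Omega>" for Y
    by (rule integrable_\<Omega>[where B = 1]) auto
  have lim3: "(\<lambda>n. \<integral>\<omega>. ?S n \<omega> - ?Z n \<omega> \<partial>\<Omega>) \<longlonglongrightarrow> 0"
  proof (rule Lim_null_comparison)
    show "(\<lambda>n. \<bar>t / sqrt (real n)\<bar> * (2 * H)) \<longlonglongrightarrow> 0"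
      using tendsto_mult[OF tendsto_rabs_zero[OF sqrt_lim[of t]] tendsto_const[of "2 * H"]] by simp
    have "cmod (\<integral>\<omega>. ?S n \<omega> - ?Z n \<omega> \<partial>\<Omega>) \<le> \<bar>s n\<bar> * (2 * H)" for n
    proof (rule order_trans[OF integral_norm_bound], rule \<Omega>.integral_le_const)
      show "AE \<omega> in \<Omega>. cmod (?S n \<omega> - ?Z n \<omega>) \<le> \<bar>s n\<bar> * (2 * H)"
      proof (rule AE_I2)
        fix \<omega>
        have "cmod (?S n \<omega> - ?Z n \<omega>)
            \<le> \<bar>s n * birkhoff_sum f \<phi> n \<omega> x - s n * mart n \<omega> x\<bar>" by (rule iexp_lipschitz)
        also have "\<dots> = \<bar>s n\<bar> * \<bar>mart n \<omega> x - birkhoff_sum f \<phi> n \<omega> x\<bar>"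
          by (simp add: abs_minus_commute flip: right_diff_distrib abs_mult)
        also have "\<dots> \<le> \<bar>s n\<bar> * (2 * H)" by (intro mult_left_mono mart_close) auto
        finally show "cmod (?S n \<omega> - ?Z n \<omega>) \<le> \<bar>s n\<bar> * (2 * H)" .
      qed
      show "integrable \<Omega> (\<lambda>\<omega>. cmod (?S n \<omega> - ?Z n \<omega>))"
        by (intro integrable_norm Bochner_Integration.integrable_diff int_iexp) measurable
    qed
    then show "\<forall>\<^sub>F n in sequentially. cmod (\<integral>\<omega>. ?S n \<omega> - ?Z n \<omega> \<partial>\<Omega>)
        \<le> \<bar>t / sqrt (real n)\<bar> * (2 * H)" by (simp add: s_def)
  qed
  have char_eq: "char (distr \<Omega> borel (\<lambda>\<omega>. 1 / sqrt (real n) * birkhoff_sum f \<phi> n \<omega> x)) t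
      = (\<integral>\<omega>. ?S n \<omega> \<partial>\<Omega>)" for n
    unfolding char_def by (subst integral_distr) (auto simp: s_def)
  \<comment> \<open>An exact identity; the three integrals on the right tend to 1, 0 and 0.\<close>
  have decomp: "(\<integral>\<omega>. ?S n \<omega> \<partial>\<Omega>) =
      (1 / E) *\<^sub>R ((\<integral>\<omega>. expo (s n) n \<omega> x \<partial>\<Omega>)
        + (\<integral>\<omega>. E *\<^sub>R ?Z n \<omega> - expo (s n) n \<omega> x \<partial>\<Omega>))
      + (\<integral>\<omega>. ?S n \<omega> - ?Z n \<omega> \<partial>\<Omega>)" for n
  proof -
    have i: "integrable \<Omega> (\<lambda>\<omega>. ?S n \<omega>)"
      "integrable \<Omega> (\<lambda>\<omega>. ?Z n \<omega>)"
      by (intro int_iexp; measurable)+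
    have "(\<integral>\<omega>. E *\<^sub>R ?Z n \<omega> - expo (s n) n \<omega> x \<partial>\<Omega>)
        = E *\<^sub>R (\<integral>\<omega>. ?Z n \<omega> \<partial>\<Omega>) - (\<integral>\<omega>. expo (s n) n \<omega> x \<partial>\<Omega>)"
      by (subst Bochner_Integration.integral_diff)
        (auto intro!: i integrable_scaleR_right expo_integrable simp del: of_real_mult)
    moreover have "(\<integral>\<omega>. ?S n \<omega> - ?Z n \<omega> \<partial>\<Omega>)
        = (\<integral>\<omega>. ?S n \<omega> \<partial>\<Omega>) - (\<integral>\<omega>. ?Z n \<omega> \<partial>\<Omega>)"
      by (rule Bochner_Integration.integral_diff[OF i])
    ultimately show ?thesis using E by simp
  qed
  have "(\<lambda>n. \<integral>\<omega>. ?S n \<omega> \<partial>\<Omega>) \<longlonglongrightarrow> (1 / E) *\<^sub>R (1 + (\<integral>\<omega>. 0 \<partial>\<Omega>)) + 0"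
    unfolding decomp by (intro tendsto_intros lim1 lim2 lim3)
  moreover have "(1 / E) *\<^sub>R (1 + (\<integral>\<omega>. 0 \<partial>\<Omega>)) + 0 = char (normal_law \<sigma>2) t"
    unfolding char_normal_law[OF assms(2)] by (simp add: E_def exp_minus inverse_eq_divide scaleR_conv_of_real)
  ultimately show "(\<lambda>n. char (distr \<Omega> borel (\<lambda>\<omega>. 1 / sqrt (real n) * birkhoff_sum f \<phi> n \<omega> x)) t) \<longlonglongrightarrow> char (normal_law \<sigma>2) t"
    unfolding char_eq by (simp only:)
qed

end

section \<open>Limit theorems for Hoelder observables\<close>

context contracting_ifs
begin

lemma poisson_interpretation:
  assumes \<nu>: "stationary N f \<mu> \<nu>" and \<phi>: "holder \<beta> \<phi>"
  obtains h H where "holder \<beta> h" "poisson_ifs N p f g J \<mu> (\<lambda>x. \<phi> x - (\<integral>y. \<phi> y \<partial>\<nu>)) h H"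
proof -
  obtain h where h: "holder \<beta> h" "\<And>x. \<phi> x - (\<integral>y. \<phi> y \<partial>\<nu>) = h x - M f h x"
    using poisson_solution[OF \<nu> \<phi>] by blast
  have c: "continuous_on UNIV h" using h(1) \<beta>_pos by (rule holder_continuous_on)
  obtain H where "\<And>x. \<bar>h x\<bar> \<le> H" using circle_bounded[OF c] by blast
  then have "poisson_ifs N p f g J \<mu> (\<lambda>x. \<phi> x - (\<integral>y. \<phi> y \<partial>\<nu>)) h H"
    using c h(2) by unfold_locales
  with h(1) show ?thesis by (rule that)
qed

lemma birkhoff_sum_centred:
  "birkhoff_sum f (\<lambda>x. \<phi> x - c) n \<omega> x = birkhoff_sum f \<phi> n \<omega> x - real n * c"
  by (simp add: birkhoff_sum_def sum_subtractf)

lemma slln: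
  assumes \<nu>: "stationary N f \<mu> \<nu>" and \<phi>: "holder \<beta> \<phi>"
  shows "AE \<omega> in \<Omega>. (\<lambda>n. birkhoff_sum f \<phi> n \<omega> x / real n) \<longlonglongrightarrow> (\<integral>y. \<phi> y \<partial>\<nu>)"
proof -
  let ?c = "\<integral>y. \<phi> y \<partial>\<nu>"
  obtain h H where "poisson_ifs N p f g J \<mu> (\<lambda>x. \<phi> x - ?c) h H"
    using poisson_interpretation[OF assms] by blast
  then interpret P: poisson_ifs N p f g J \<mu> "\<lambda>x. \<phi> x - ?c" h H .
  from P.slln_zero[of x] show ?thesis
  proof eventually_elim
    case (elim \<omega>)
    have "(\<lambda>n. birkhoff_sum f (\<lambda>x. \<phi> x - ?c) n \<omega> x / real n + ?c) \<longlonglongrightarrow> 0 + ?c"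
      by (intro tendsto_add elim tendsto_const)
    moreover have "\<forall>\<^sub>F n in sequentially. birkhoff_sum f (\<lambda>x. \<phi> x - ?c) n \<omega> x / real n + ?c
        = birkhoff_sum f \<phi> n \<omega> x / real n"
      using eventually_gt_at_top[of 0]
      by eventually_elim (simp add: birkhoff_sum_centred diff_divide_distrib)
    ultimately show ?case by (simp add: tendsto_cong)
  qed
qed

text \<open>The variance is the \<nu>-mean of the conditional variance. That function is again
  \<beta>-Hoelder, so \<open>slln\<close> applies to it from every starting point and supplies the
  hypothesis of \<open>clt\<close>; the same function controls the second moments.\<close>

lemma limit_theorems:
  assumes \<nu>: "stationary N f \<mu> \<nu>" and \<phi>: "holder \<beta> \<phi>"
  defines "c \<equiv> \<integral>y. \<phi> y \<partial>\<nu>"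
  shows "\<exists>\<sigma>2. (\<lambda>n. 1 / real n * (\<integral>(\<omega>, x). (birkhoff_sum f \<phi> n \<omega> x - real n * c)\<^sup>2 \<partial>(\<Omega> \<Otimes>\<^sub>M \<nu>))) \<longlonglongrightarrow> \<sigma>2 \<and>
    (\<forall>x. AE \<omega> in \<Omega>. (\<lambda>n. 1 / real n * birkhoff_sum f \<phi> n \<omega> x) \<longlonglongrightarrow> c) \<and>
    (\<forall>x. weak_conv_m (\<lambda>n. distr \<Omega> borel (\<lambda>\<omega>. 1 / sqrt (real n) * (birkhoff_sum f \<phi> n \<omega> x - real n * c)))
      (normal_law \<sigma>2))"
proof -
  obtain h H where h: "holder \<beta> h" and P: "poisson_ifs N p f g J \<mu> (\<lambda>x. \<phi> x - c) h H"
    using poisson_interpretation[OF \<nu> \<phi>] unfolding c_def by blast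
  interpret P: poisson_ifs N p f g J \<mu> "\<lambda>x. \<phi> x - c" h H by (rule P)
  have b\<nu>: "borel_prob \<nu>" using \<nu> by (simp add: stationary_def)
  interpret \<nu>: prob_space \<nu> using b\<nu> by (simp add: borel_prob_def)
  interpret \<Omega>: prob_space \<Omega> by (rule prob_space_\<Omega>)
  interpret O\<nu>: pair_prob_space \<Omega> \<nu> ..
  have s\<nu>[measurable_cong]: "sets \<nu> = sets borel" using b\<nu> by (simp add: borel_prob_def)
  let ?S = "\<lambda>n \<omega> x. birkhoff_sum f (\<lambda>x. \<phi> x - c) n \<omega> x"
  \<comment> \<open>Written through \<open>M f\<close> and squares, the conditional variance
    inherits \<beta>-Hoelder regularity from \<open>holder_M\<close> and
    \<open>holder_square\<close>.\<close>
  have v_eq: "P.cvar = (\<lambda>x. M f (\<lambda>x. (h x)\<^sup>2) x - (M f h x)\<^sup>2)"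
  proof
    fix x
    have "P.cvar x = (\<Sum>i<N. p i * (h (f i x))\<^sup>2) - 2 * M f h x * (\<Sum>i<N. p i * h (f i x)) + (M f h x)\<^sup>2 * (\<Sum>i<N. p i)"
      unfolding P.cvar_def P.incr_def sum_distrib_left sum_subtractf[symmetric] sum.distrib[symmetric]
      by (intro sum.cong) (auto simp: power2_diff algebra_simps)
    also have "(\<Sum>i<N. p i * h (f i x)) = M f h x" by (simp add: markov_def)
    finally show "P.cvar x = M f (\<lambda>x. (h x)\<^sup>2) x - (M f h x)\<^sup>2"
      by (simp add: p_sum markov_def power2_eq_square)
  qed
  have v: "holder \<beta> P.cvar"
    unfolding v_eq
    by (intro holder_diff holder_M holder_square[where B = H] h P.h_bound P.Mh_bound)
  define \<sigma>2 where "\<sigma>2 = (\<integral>y. P.cvar y \<partial>\<nu>)"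
  have \<sigma>2: "\<sigma>2 \<ge> 0" unfolding \<sigma>2_def by (intro Bochner_Integration.integral_nonneg P.cvar_nonneg)
  obtain L where L: "L \<ge> 0" "\<And>x y. \<bar>P.cvar x - P.cvar y\<bar> \<le> L * dist x y powr \<beta>"
    using v by (auto simp: holder_def)
  define Q where "Q n x = (\<integral>\<omega>. (?S n \<omega> x)\<^sup>2 \<partial>\<Omega>)" for n x
  \<comment> \<open>\<open>A\<close> and the first summand of \<open>B\<close> come from
    \<open>birkhoff_second_moment\<close>; the last summand sums the geometric convergence of the
    iterates of \<open>P.cvar\<close>. Both are uniform in the starting point, so the bound can be
    integrated against \<nu>.\<close>
  define A B where "A = 2 * H * (4 * H\<^sup>2 + 1)" and "B = 4 * H\<^sup>2 + L * C * (1 / (1 - k))"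
  have Q: "\<bar>Q n x - real n * \<sigma>2\<bar> \<le> A * sqrt n + B" if "n \<ge> 1" for n x
  proof -
    have "\<bar>(\<Sum>j<n. (M f ^^ j) P.cvar x) - real n * \<sigma>2\<bar> = \<bar>\<Sum>j<n. (M f ^^ j) P.cvar x - \<sigma>2\<bar>"
      by (simp add: sum_subtractf)
    also have "\<dots> \<le> (\<Sum>j<n. L * C * k ^ j)"
      unfolding \<sigma>2_def by (intro order_trans[OF sum_abs] sum_mono M_iter_converges[OF \<nu> L(2,1)])
    also have "\<dots> = L * C * (\<Sum>j<n. k ^ j)" by (simp add: sum_distrib_left)
    also have "\<dots> \<le> L * C * (1 / (1 - k))"
    proof (rule mult_left_mono)
      have "(\<Sum>j<n. k ^ j) = (1 - k ^ n) / (1 - k)" using k_less_1 by (simp add: sum_gp_strict)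
      also have "\<dots> \<le> 1 / (1 - k)" using k_pos k_less_1 by (intro divide_right_mono) auto
      finally show "(\<Sum>j<n. k ^ j) \<le> 1 / (1 - k)" .
    qed (use L(1) C_pos in simp)
    finally show ?thesis
      using P.birkhoff_second_moment[OF that, of x] unfolding Q_def A_def B_def by linarith
  qed
  have joint: "integrable (\<Omega> \<Otimes>\<^sub>M \<nu>) (\<lambda>(\<omega>, x). (?S n \<omega> x)\<^sup>2)" for n
  proof (rule O\<nu>.P.integrable_const_bound[where B = "(real n * (2 * H))\<^sup>2"])
    show "AE z in \<Omega> \<Otimes>\<^sub>M \<nu>. norm (case z of (\<omega>, x) \<Rightarrow> (?S n \<omega> x)\<^sup>2) \<le> (real n * (2 * H))\<^sup>2"
    proof (rule AE_I2, clarsimp simp del: power_mult_distrib)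
      fix \<omega> x
      show "(?S n \<omega> x)\<^sup>2 \<le> (real n * (2 * H))\<^sup>2"
        using power_mono[OF P.birkhoff_\<phi>_bound[of n \<omega> x] abs_ge_zero, of 2] by simp
    qed
    show "(\<lambda>(\<omega>, x). (?S n \<omega> x)\<^sup>2) \<in> borel_measurable (\<Omega> \<Otimes>\<^sub>M \<nu>)"
      unfolding case_prod_beta
      by (intro borel_measurable_power measurable_birkhoff_sum P.\<phi>_meas) measurable
  qed
  have fub: "(\<integral>(\<omega>, x). (?S n \<omega> x)\<^sup>2 \<partial>(\<Omega> \<Otimes>\<^sub>M \<nu>)) = (\<integral>x. Q n x \<partial>\<nu>)" for n
    unfolding Q_def by (rule O\<nu>.integral_snd[OF joint, symmetric])
  have Qi: "integrable \<nu> (Q n)" for n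
    unfolding Q_def[abs_def] by (rule O\<nu>.integrable_snd[OF joint])
  have var: "(\<lambda>n. 1 / real n * (\<integral>(\<omega>, x). (?S n \<omega> x)\<^sup>2 \<partial>(\<Omega> \<Otimes>\<^sub>M \<nu>))) \<longlonglongrightarrow> \<sigma>2"
  proof (rule LIM_zero_cancel, rule Lim_null_comparison)
    have "(\<lambda>n. A * (1 / sqrt (real n)) + B * (1 / real n)) \<longlonglongrightarrow> A * 0 + B * 0"
      by (intro tendsto_intros tendsto_divide_0[OF tendsto_const] filterlim_at_top_imp_at_infinity
        filterlim_compose[OF sqrt_at_top filterlim_real_sequentially] filterlim_real_sequentially)
    then show "(\<lambda>n. A * (1 / sqrt (real n)) + B * (1 / real n)) \<longlonglongrightarrow> 0" by simp
    show "\<forall>\<^sub>F n in sequentially. norm (1 / real n * (\<integral>(\<omega>, x). (?S n \<omega> x)\<^sup>2 \<partial>(\<Omega> \<Otimes>\<^sub>M \<nu>)) - \<sigma>2)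
        \<le> A * (1 / sqrt (real n)) + B * (1 / real n)"
      using eventually_ge_at_top[of 1]
    proof eventually_elim
      case (elim n)
      have "real n * \<sigma>2 - (A * sqrt n + B) \<le> (\<integral>x. Q n x \<partial>\<nu>)"
        using Q[OF elim] by (intro \<nu>.integral_ge_const Qi AE_I2) (simp add: abs_le_iff algebra_simps)
      moreover have "(\<integral>x. Q n x \<partial>\<nu>) \<le> real n * \<sigma>2 + (A * sqrt n + B)"
        using Q[OF elim] by (intro \<nu>.integral_le_const Qi AE_I2) (simp add: abs_le_iff algebra_simps)
      ultimately have "\<bar>(\<integral>x. Q n x \<partial>\<nu>) - real n * \<sigma>2\<bar> \<le> A * sqrt n + B" by (simp add: abs_le_iff)
      then have "\<bar>(\<integral>x. Q n x \<partial>\<nu>) - real n * \<sigma>2\<bar> / real n \<le> (A * sqrt n + B) / real n"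
        by (rule divide_right_mono) simp
      moreover have "\<bar>(\<integral>x. Q n x \<partial>\<nu>) - real n * \<sigma>2\<bar> / real n = \<bar>1 / real n * (\<integral>x. Q n x \<partial>\<nu>) - \<sigma>2\<bar>"
      proof -
        have "1 / real n * (\<integral>x. Q n x \<partial>\<nu>) - \<sigma>2 = ((\<integral>x. Q n x \<partial>\<nu>) - real n * \<sigma>2) / real n"
          using elim by (simp add: diff_divide_distrib)
        then show ?thesis by (simp only: abs_divide abs_of_nat)
      qed
      moreover have "(A * sqrt n + B) / real n = A * (1 / sqrt (real n)) + B * (1 / real n)"
      proof -
        have "sqrt (real n) / real n = 1 / sqrt (real n)"
          using elim by (simp add: sqrt_divide_self_eq inverse_eq_divide)
        then have "A * sqrt (real n) / real n = A * (1 / sqrt (real n))"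
          by (simp only: times_divide_eq_right[symmetric])
        then show ?thesis by (simp add: add_divide_distrib)
      qed
      ultimately show ?case unfolding fub by simp
    qed
  qed
  have "AE \<omega> in \<Omega>. (\<lambda>n. birkhoff_sum f P.cvar n \<omega> x / real n) \<longlonglongrightarrow> \<sigma>2" for x
    unfolding \<sigma>2_def by (rule slln[OF \<nu> v])
  then have "weak_conv_m (\<lambda>n. distr \<Omega> borel (\<lambda>\<omega>. 1 / sqrt (real n) * ?S n \<omega> x)) (normal_law \<sigma>2)" for x
    using \<sigma>2 by (rule P.clt)
  moreover have "AE \<omega> in \<Omega>. (\<lambda>n. 1 / real n * birkhoff_sum f \<phi> n \<omega> x) \<longlonglongrightarrow> c" for x
    using slln[OF \<nu> \<phi>, of x] by (simp add: c_def)
  ultimately show ?thesis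
    using var unfolding birkhoff_sum_centred by blast
qed

end

theorem theorem1p10:
  fixes N :: nat
    and f :: "nat \<Rightarrow> circle \<Rightarrow> circle"
    and \<mu> :: "nat measure"
  assumes "\<And>i. i < N \<Longrightarrow> C1_circle_diffeo (f i)"
    and "proximal N f"
    and "\<not> (\<exists>m. borel_prob m \<and> (\<forall>i<N. distr m borel (f i) = m))"
    and "prob_space \<mu>"
    and "sets \<mu> = Pow {..<N}"
    and "\<And>i. i < N \<Longrightarrow> measure \<mu> {i} > 0"
  shows "(\<exists>!\<nu>. stationary N f \<mu> \<nu>) \<and>
    (\<forall>\<nu> h. stationary N f \<mu> \<nu> \<longrightarrow> holder_continuous h \<longrightarrow>
      (\<exists>\<sigma>2::real.
        (\<lambda>n. 1 / real n *
          (\<integral>(\<omega>, x). (birkhoff_sum f h n \<omega> x - real n * (\<integral>y. h y \<partial>\<nu>))\<^sup>2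
             \<partial>(bernoulli_measure \<mu> \<Otimes>\<^sub>M \<nu>))) \<longlonglongrightarrow> \<sigma>2 \<and>
        (\<forall>x. AE \<omega> in bernoulli_measure \<mu>.
          (\<lambda>n. 1 / real n * birkhoff_sum f h n \<omega> x) \<longlonglongrightarrow> (\<integral>y. h y \<partial>\<nu>)) \<and>
        (\<forall>x. weak_conv_m
          (\<lambda>n. distr (bernoulli_measure \<mu>) borel
            (\<lambda>\<omega>. 1 / sqrt (real n) * (birkhoff_sum f h n \<omega> x - real n * (\<integral>y. h y \<partial>\<nu>))))
          (normal_law \<sigma>2))))"
proof -
  interpret \<mu>: prob_space \<mu> by fact
  have space: "space \<mu> = {..<N}"
    using assms(5) by (metis Pow_top Union_Pow_eq sets.sets_into_space sets.top subset_antisym PowD)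
  define p where "p i = measure \<mu> {i}" for i
  define g where "g i = inv (f i)" for i
  have bij: "bij (f i)" and C: "C1_circle_map (f i)" "C1_circle_map (g i)" if "i < N" for i
    using assms(1)[OF that] by (auto simp: C1_circle_diffeo_def g_def)
  define jac where "jac i J \<longleftrightarrow> continuous_on UNIV J \<and> (\<forall>x. J x > 0) \<and>
    (\<forall>x y. \<exists>z. dist z x \<le> dist x y \<and> dist (f i x) (f i y) \<le> J z * dist x y) \<and>
    (\<forall>\<psi>. continuous_on UNIV \<psi> \<longrightarrow> circle_int (\<lambda>x. \<psi> (f i x) * J x) = circle_int \<psi>)" for i J
  have "\<exists>J. jac i J" if i: "i < N" for i
  proof (rule C1_circle_diffeo_jacobian[OF assms(1)[OF i]])
    fix J assume "continuous_on UNIV J" "\<And>x. J x > 0"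
      "\<And>x y. \<exists>z. dist z x \<le> dist x y \<and> dist (f i x) (f i y) \<le> J z * dist x y"
      "\<And>\<psi>. continuous_on UNIV \<psi> \<Longrightarrow> circle_int (\<lambda>x. \<psi> (f i x) * J x) = circle_int \<psi>"
    then show ?thesis unfolding jac_def by (intro exI[of _ J]) simp
  qed
  then obtain J where J: "\<And>i. i < N \<Longrightarrow> jac i (J i)" by metis
  interpret bernoulli_ifs N p f g J \<mu>
  proof
    show "p i > 0" if "i < N" for i using assms(6)[OF that] by (simp add: p_def)
    have "(\<Sum>i<N. p i) = measure \<mu> (\<Union>i<N. {i})"
      unfolding p_def
      by (rule \<mu>.finite_measure_finite_Union[symmetric]) (auto simp: assms(5) disjoint_family_on_def)
    also have "\<dots> = 1" using \<mu>.prob_space by (simp add: space)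
    finally show "(\<Sum>i<N. p i) = 1" .
    show "continuous_on UNIV (f i)" "continuous_on UNIV (g i)" if "i < N" for i
      using C[OF that] by (auto intro: C1_circle_map_continuous)
    show "g i (f i x) = x" "f i (g i x) = x" if "i < N" for i x
      using bij[OF that] by (simp_all add: g_def bij_is_inj bij_is_surj surj_f_inv_f)
  qed (use J in \<open>auto simp: jac_def p_def assms(5)\<close>)
  obtain m \<eta> where m: "m > 0" "\<eta> > 0" "\<And>x. log_J_sum m x \<le> real m * (- \<eta>)"
    using negative_exponent[OF assms(3)] by blast
  \<comment> \<open>Used with \<alpha> = 1 for existence and uniqueness, where the test functions
    are Lipschitz, and with the Hoelder exponent of \<open>h\<close> for the limit theorems.\<close>
  have contracting: "\<exists>\<beta> C k. \<beta> \<le> \<alpha> \<and> contracting_ifs N p f g J \<mu> \<beta> C k" if "0 < \<alpha>" for \<alpha>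
  proof (rule global_contraction[OF assms(2) m that])
    fix \<beta> C k
    assume "0 < \<beta>" "\<beta> \<le> \<alpha>" "0 < C" "0 < k" "k < 1"
      "\<And>n x y. (M (pair_maps f) ^^ n) (\<lambda>z. dist (fst z) (snd z) powr \<beta>) (x, y) \<le> C * k ^ n * dist x y powr \<beta>"
    then have "contracting_ifs N p f g J \<mu> \<beta> C k" by unfold_locales
    with \<open>\<beta> \<le> \<alpha>\<close> show ?thesis by blast
  qed
  show ?thesis
  proof (intro conjI allI impI, goal_cases)
    case 1
    obtain \<beta> C k where \<beta>: "\<beta> \<le> 1" "contracting_ifs N p f g J \<mu> \<beta> C k"
      using contracting[of 1] by auto
    interpret c: contracting_ifs N p f g J \<mu> \<beta> C k by (rule \<beta>(2))
    show ?case
      using c.stationary_exists[OF \<beta>(1)] c.stationary_unique[OF \<beta>(1)] by blast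
  next
    case (2 \<nu> h)
    then obtain \<alpha> K where K: "0 < \<alpha>" "\<And>x y. \<bar>h x - h y\<bar> \<le> K * dist x y powr \<alpha>"
      by (auto simp: holder_continuous_def)
    obtain \<beta> C k where \<beta>: "\<beta> \<le> \<alpha>" "contracting_ifs N p f g J \<mu> \<beta> C k"
      using contracting[OF K(1)] by auto
    interpret c: contracting_ifs N p f g J \<mu> \<beta> C k by (rule \<beta>(2))
    have "holder \<beta> h"
    proof (rule holderI)
      fix x y
      have "\<bar>h x - h y\<bar> \<le> \<bar>K\<bar> * dist x y powr \<alpha>"
        by (rule order_trans[OF K(2)]) (auto intro: mult_right_mono)
      also have "\<dots> \<le> \<bar>K\<bar> * dist x y powr \<beta>"
        using c.\<beta>_pos \<beta>(1) by (intro mult_left_mono dist_circle_powr_mono) auto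
      finally show "\<bar>h x - h y\<bar> \<le> \<bar>K\<bar> * dist x y powr \<beta>" .
    qed
    from c.limit_theorems[OF 2(1) this] show ?case .
  qed
qed

end
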